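(* Let $G$ be a finite, simple, connected graph such that $\mathrm{EV}(G)$ is a subgraph of a graph in $\mathcal{G}$. Then either $\mathrm{pn}(G)\le\lfloor |V(G)|/2\rfloor$ (i.e. $G$ is a Gallai graph), or $G$ is a SET graph.
   Context: All graphs are finite and simple. A path decomposition of a graph $G$ is a collection of edge-disjoint paths of $G$ whose union covers $E(G)$; $\mathrm{pn}(G)$ is the minimum cardinality of a path decomposition of $G$. A graph $G$ on $n$ vertices is a Gallai graph if $\mathrm{pn}(G)\le\lfloor n/2\rfloor$. The E-subgraph $\mathrm{EV}(G)$ is the subgraph of $G$ induced by the vertices of even degree in $G$. A vertex is even (odd) if its degree in $G$ is even (odd). A graph $G$ is a SET graph (single even triangle graph) if $\mathrm{EV}(G)$ is a triangle and every odd vertex of $G$ has at least two even neighbors. A block of a graph is a maximal 2-connected subgraph. $\mathcal{G}$ denotes the family of graphs $H$ such that (i) each block of $H$ has maximum degree at most $3$, and (ii) each connected component of $H$ either has maximum degree at most $3$ or has at most one block that contains a triangle. *)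

theory Defs
  imports Main
begin

datatype 'a sgraph = SGraph (verts: "'a set") (edges: "'a set set")

definition simple_graph :: "'a sgraph \<Rightarrow> bool" where
  "simple_graph G \<longleftrightarrow>
     finite (verts G) \<and> (\<forall>e\<in>edges G. e \<subseteq> verts G \<and> card e = 2)"

definition subgraph :: "'a sgraph \<Rightarrow> 'a sgraph \<Rightarrow> bool" where
  "subgraph H G \<longleftrightarrow>
     simple_graph H \<and> verts H \<subseteq> verts G \<and> edges H \<subseteq> edges G"

definition induced_subgraph :: "'a sgraph \<Rightarrow> 'a set \<Rightarrow> 'a sgraph" where
  "induced_subgraph G S = SGraph (verts G \<inter> S) {e \<in> edges G. e \<subseteq> S}"

definition image_graph :: "('a \<Rightarrow> 'b) \<Rightarrow> 'a sgraph \<Rightarrow> 'b sgraph" where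
  "image_graph f G = SGraph (f ` verts G) ((\<lambda>e. f ` e) ` edges G)"

text \<open>
  Subgraph containment up to isomorphism. The host graph may live on another vertex type,
  so that its additional vertices are not limited by the vertex type of the smaller graph.
  For equal types, every literal subgraph is covered by the identity map.
\<close>

definition is_subgraph_of :: "'a sgraph \<Rightarrow> 'b sgraph \<Rightarrow> bool" where
  "is_subgraph_of G H \<longleftrightarrow>
     (\<exists>f. inj_on f (verts G) \<and> subgraph (image_graph f G) H)"

definition degree :: "'a sgraph \<Rightarrow> 'a \<Rightarrow> nat" where
  "degree G v = card {e \<in> edges G. v \<in> e}"

definition max_degree :: "'a sgraph \<Rightarrow> nat" where
  "max_degree G = Max (insert 0 (degree G ` verts G))"

definition neighbors :: "'a sgraph \<Rightarrow> 'a \<Rightarrow> 'a set" where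
  "neighbors G v = {u \<in> verts G. {u, v} \<in> edges G}"

definition connected_graph :: "'a sgraph \<Rightarrow> bool" where
  "connected_graph G \<longleftrightarrow>
     verts G \<noteq> {} \<and>
     (\<forall>u\<in>verts G. \<forall>v\<in>verts G. (u, v) \<in> {(x, y). {x, y} \<in> edges G}\<^sup>*)"

definition component :: "'a sgraph \<Rightarrow> 'a sgraph \<Rightarrow> bool" where
  "component C G \<longleftrightarrow>
     subgraph C G \<and> connected_graph C \<and>
     (\<forall>C'. subgraph C' G \<and> connected_graph C' \<and> subgraph C C' \<longrightarrow> C' = C)"

definition two_connected :: "'a sgraph \<Rightarrow> bool" where
  "two_connected G \<longleftrightarrow>
     card (verts G) \<ge> 3 \<and> connected_graph G \<and>
     (\<forall>v\<in>verts G. connected_graph (induced_subgraph G (verts G - {v})))"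

text \<open>
  Since 2-connected graphs have at least three vertices, single edges (bridges) and isolated
  vertices are not blocks here. Under the convention that counts them as blocks the
  family defined below is the same, as they have maximum degree at most 1 and no triangle.
\<close>

definition block :: "'a sgraph \<Rightarrow> 'a sgraph \<Rightarrow> bool" where
  "block B G \<longleftrightarrow>
     subgraph B G \<and> two_connected B \<and>
     (\<forall>B'. subgraph B' G \<and> two_connected B' \<and> subgraph B B' \<longrightarrow> B' = B)"

definition is_triangle :: "'a sgraph \<Rightarrow> bool" where
  "is_triangle T \<longleftrightarrow>
     (\<exists>a b c. a \<noteq> b \<and> b \<noteq> c \<and> a \<noteq> c \<and> T = SGraph {a, b, c} {{a, b}, {b, c}, {a, c}})"

definition contains_triangle :: "'a sgraph \<Rightarrow> bool" where
  "contains_triangle G \<longleftrightarrow> (\<exists>T. is_triangle T \<and> subgraph T G)"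

definition family_G :: "'a sgraph set" where
  "family_G = {H. simple_graph H \<and>
     (\<forall>B. block B H \<longrightarrow> max_degree B \<le> 3) \<and>
     (\<forall>C. component C H \<longrightarrow>
        max_degree C \<le> 3 \<or> (\<exists>\<^sub>\<le>\<^sub>1 B. block B C \<and> contains_triangle B))}"

definition is_path :: "'a sgraph \<Rightarrow> bool" where
  "is_path P \<longleftrightarrow>
     (\<exists>xs. xs \<noteq> [] \<and> distinct xs \<and>
        P = SGraph (set xs) {{xs ! i, xs ! Suc i} | i. Suc i < length xs})"

definition path_decomposition :: "'a sgraph set \<Rightarrow> 'a sgraph \<Rightarrow> bool" where
  "path_decomposition D G \<longleftrightarrow>
     finite D \<and> (\<forall>P\<in>D. is_path P \<and> subgraph P G) \<and>
     (\<forall>P\<in>D. \<forall>Q\<in>D. P \<noteq> Q \<longrightarrow> edges P \<inter> edges Q = {}) \<and>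
     (\<Union>P\<in>D. edges P) = edges G"

definition pn :: "'a sgraph \<Rightarrow> nat" where
  "pn G = (LEAST k. \<exists>D. path_decomposition D G \<and> card D = k)"

definition EV :: "'a sgraph \<Rightarrow> 'a sgraph" where
  "EV G = induced_subgraph G {v \<in> verts G. even (degree G v)}"

definition SET_graph :: "'a sgraph \<Rightarrow> bool" where
  "SET_graph G \<longleftrightarrow>
     is_triangle (EV G) \<and>
     (\<forall>v\<in>verts G. odd (degree G v) \<longrightarrow>
        card {u \<in> neighbors G v. even (degree G u)} \<ge> 2)"

text \<open>The minimum in the definition of \<^const>\<open>pn\<close> is over a nonempty set.\<close>

lemma path_decomposition_exists:
  assumes "simple_graph G"
  shows "\<exists>D. path_decomposition D G"
proof
  let ?D = "(\<lambda>e. SGraph e {e}) ` edges G"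
  have "edges G \<subseteq> Pow (verts G)" "finite (verts G)"
    using assms by (auto simp: simple_graph_def)
  then have "finite (edges G)" by (meson finite_Pow_iff finite_subset)
  moreover have "is_path (SGraph e {e})" if e: "e \<in> edges G" for e
  proof -
    obtain a b where ab: "e = {a, b}" "a \<noteq> b"
      using assms e by (auto simp: simple_graph_def card_2_iff)
    have "{{[a, b] ! i, [a, b] ! Suc i} | i. Suc i < length [a, b]} = {e}"
      using ab by auto
    then show ?thesis
      unfolding is_path_def using ab by (intro exI[of _ "[a, b]"]) auto
  qed
  moreover have "subgraph (SGraph e {e}) G" if "e \<in> edges G" for e
    using assms that by (auto simp: subgraph_def simple_graph_def intro: finite_subset)
  ultimately show "path_decomposition ?D G"
    unfolding path_decomposition_def by auto
qed

lemma pn_attained: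
  assumes "simple_graph G"
  shows "\<exists>D. path_decomposition D G \<and> card D = pn G"
proof -
  have "\<exists>k D. path_decomposition D G \<and> card D = k"
    using path_decomposition_exists[OF assms] by blast
  then show ?thesis unfolding pn_def by (rule LeastI_ex)
qed

end

theory Submission
  imports Defs "HOL-Library.Multiset"
begin

text \<open>
  Allow trivial one-vertex paths and record a path decomposition only through the number $f(v)$ of
  path ends at each vertex $v$. Then $f(v)$ has the parity of the degree, and the number of paths is half the
  sum of $f$. A Lovasz-type exchange argument shows that an edge $ab$ can be added while one path end is moved from
  $b$ to the pivot $a$, as soon as $f(b)$ exceeds the number of neighbours of $a$ at which no path ends.

  The theorem follows by induction on the number of edges: edges between even vertices (and, at the
  end, edges from an odd vertex to its even neighbours) are deleted so that their ends become odd,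
  hence are path ends, and are then restored one by one with suitable pivots. The induction runs over
  graphs without SET components. Such a component can only arise after a deletion if the deleted edges contain
  a bridge between even vertices, and then joining two paths across that bridge
  saves the extra path which a SET graph needs. The hypothesis on the even subgraph enters only to
  find a deletable configuration: a leaf, a short path of vertices of degree two, or a vertex of
  degree three with at most one neighbour of larger degree, unless all edges lie in isolated triangles.
\<close>

section \<open>Path systems with prescribed ends\<close>

text \<open>The exchange gets stuck only at neighbours of the pivot that carry no path end, and by
  parity such neighbours are even. Deleting edges so that their ends become odd clears the
  surroundings of the pivot in advance; what remains to be counted are the few vertices that lose an
  end during the restoration itself. This is why only the even subgraph matters and why small
  degrees in it help. Nothing can be inherited from a graph with a SET component, so each deletion
  must be shown not to create one. A new SET component meets a deleted edge, and each of its
  vertices has two neighbours in the even triangle; this is impossible at a vertex whose even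
  neighbours have all become odd. The condition on blocks with triangles is used against one
  situation: a triangle hanging at a vertex of degree at least four, where a further branch at that
  vertex contains a second such triangle.\<close>

definition graph :: "'a set set \<Rightarrow> bool" where
  "graph E \<longleftrightarrow> finite E \<and> (\<forall>e\<in>E. card e = 2)"

definition nbhd :: "'a set set \<Rightarrow> 'a \<Rightarrow> 'a set" where
  "nbhd E v = {u. {u, v} \<in> E}"

text \<open>A multiset, so that the single equation with \<open>mset_set E\<close> in
  \<open>realizes\<close> states both that no edge is used twice and that every edge is
  used.\<close>

fun path_edges :: "'a list \<Rightarrow> 'a set multiset" where
  "path_edges (x # y # zs) = add_mset {x, y} (path_edges (y # zs))"
| "path_edges _ = {#}"

definition ends_at :: "'a list \<Rightarrow> 'a \<Rightarrow> nat" where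
  "ends_at p v = of_bool (hd p = v) + of_bool (last p = v)"

text \<open>One-vertex paths are allowed; they contribute two ends.\<close>

definition realizes :: "'a list list \<Rightarrow> 'a set set \<Rightarrow> ('a \<Rightarrow> nat) \<Rightarrow> bool" where
  "realizes ps E f \<longleftrightarrow> (\<forall>p\<in>set ps. p \<noteq> [] \<and> distinct p) \<and>
     (\<Sum>p\<leftarrow>ps. path_edges p) = mset_set E \<and> (\<forall>v. f v = (\<Sum>p\<leftarrow>ps. ends_at p v))"

definition realizable :: "'a set set \<Rightarrow> ('a \<Rightarrow> nat) \<Rightarrow> bool" where
  "realizable E f \<longleftrightarrow> (\<exists>ps. realizes ps E f)"

text \<open>The subtraction is truncated; an end really moves from \<open>b\<close> to
  \<open>a\<close> only for \<open>a\<close> \<noteq> \<open>b\<close> and \<open>f b\<close> \<ge>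
  1, and \<open>shift_sum\<close> asks for both.\<close>

definition shift :: "'a \<Rightarrow> 'a \<Rightarrow> ('a \<Rightarrow> nat) \<Rightarrow> 'a \<Rightarrow> nat" where
  "shift a b f = (\<lambda>v. if v = a then f v + 1 else if v = b then f v - 1 else f v)"

section \<open>Edge sets, list paths and end counts\<close>

lemma nbhd_sym: "u \<in> nbhd E v \<longleftrightarrow> v \<in> nbhd E u"
  by (simp add: nbhd_def insert_commute)

lemma graph_not_self: "graph E \<Longrightarrow> {v, v} \<notin> E"
  by (auto simp: graph_def)

lemma nbhd_irrefl: "graph E \<Longrightarrow> v \<notin> nbhd E v"
  using graph_not_self by (fastforce simp: nbhd_def)

lemma finite_nbhd: "graph E \<Longrightarrow> finite (nbhd E v)"
proof -
  assume g: "graph E"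
  have "nbhd E v \<subseteq> \<Union>E" by (auto simp: nbhd_def)
  moreover have "finite (\<Union>E)"
    using g unfolding graph_def by (metis card.infinite finite_Union zero_neq_numeral)
  ultimately show ?thesis by (rule finite_subset)
qed

lemma graph_edgeE:
  assumes "graph E" "e \<in> E" obtains u v where "e = {u, v}" "u \<noteq> v"
  using assms unfolding graph_def by (metis card_2_iff)

lemma path_edges_append:
  "us \<noteq> [] \<Longrightarrow> ws \<noteq> [] \<Longrightarrow>
    path_edges (us @ ws) = add_mset {last us, hd ws} (path_edges us + path_edges ws)"
proof (induction us rule: path_edges.induct)
  case ("2_2" v)
  then show ?case by (cases ws) auto
qed auto

lemma path_edges_rev: "path_edges (rev p) = path_edges p"
proof (induction p rule: path_edges.induct)
  case (1 x y zs)
  have "path_edges (rev (x # y # zs)) = path_edges (rev (y # zs) @ [x])" by simp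
  also have "\<dots> = add_mset {last (rev (y # zs)), hd [x]} (path_edges (rev (y # zs)) + path_edges [x])"
    by (rule path_edges_append) auto
  also have "\<dots> = path_edges (x # y # zs)"
    using 1 by (simp add: last_rev insert_commute del: rev.simps)
  finally show ?case .
qed auto

lemma path_edges_subset: "e \<in># path_edges p \<Longrightarrow> e \<subseteq> set p"
  by (induction p rule: path_edges.induct) auto

lemma path_edges_cover: "length p \<ge> 2 \<Longrightarrow> v \<in> set p \<Longrightarrow> \<exists>e. e \<in># path_edges p \<and> v \<in> e"
proof (induction p rule: path_edges.induct)
  case (1 x y zs)
  show ?case
  proof (cases "v \<in> set (y # zs) \<and> length (y # zs) \<ge> 2")
    case True then show ?thesis using 1 by auto
  next
    case False
    then have "v = x \<or> v = y" using 1(3) by (cases zs) auto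
    then show ?thesis by auto
  qed
qed auto

lemma ends_at_rev: "p \<noteq> [] \<Longrightarrow> ends_at (rev p) = ends_at p"
  by (auto simp: ends_at_def hd_rev last_rev)

text \<open>Both sides are sums because \<open>g\<close> will take values in multisets and natural
  numbers, where subtraction is truncated.\<close>

lemma sum_list_map_update:
  fixes g :: "'b \<Rightarrow> 'c::comm_monoid_add"
  shows "i < length ps \<Longrightarrow>
    sum_list (map g (ps[i := q])) + g (ps ! i) = sum_list (map g ps) + g q"
proof (induction ps arbitrary: i)
  case (Cons p ps)
  show ?case
  proof (cases i)
    case (Suc j)
    then show ?thesis using Cons by (simp add: add.assoc)
  qed (simp add: ac_simps)
qed simp

text \<open>An inner vertex of a path lies on two of its edges and an end vertex on one; a
  one-vertex path has no edge but two ends, so it fits the same parity.\<close>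

lemma ends_parity:
  "p \<noteq> [] \<Longrightarrow> distinct p \<Longrightarrow>
    even (ends_at p v + size (filter_mset (\<lambda>e. v \<in> e) (path_edges p)))"
  by (induction p rule: path_edges.induct) (auto simp: ends_at_def)

lemma card_nbhd: assumes "graph E" shows "card {e \<in> E. v \<in> e} = card (nbhd E v)"
proof -
  have "bij_betw (\<lambda>u. {u, v}) (nbhd E v) {e \<in> E. v \<in> e}"
    unfolding bij_betw_def
  proof
    show "inj_on (\<lambda>u. {u, v}) (nbhd E v)" by (auto simp: inj_on_def doubleton_eq_iff)
    have "e \<in> (\<lambda>u. {u, v}) ` nbhd E v" if "e \<in> E" "v \<in> e" for e
    proof -
      obtain x y where "e = {x, y}" "x \<noteq> y" using graph_edgeE assms \<open>e \<in> E\<close> by blast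
      then show ?thesis using that by (auto simp: nbhd_def insert_commute)
    qed
    then show "(\<lambda>u. {u, v}) ` nbhd E v = {e \<in> E. v \<in> e}" by (auto simp: nbhd_def)
  qed
  then show ?thesis by (simp add: bij_betw_same_card)
qed

text \<open>Add \<open>ends_parity\<close> over all paths. It is used in two directions: a vertex of
  odd degree carries an end (\<open>realizable_odd_pos\<close>), and a vertex without ends is even
  (\<open>zero_even\<close>).\<close>

lemma realizable_parity:
  assumes "graph E" "realizable E f" shows "even (f v) \<longleftrightarrow> even (card (nbhd E v))"
proof -
  obtain ps where r: "realizes ps E f" using assms by (auto simp: realizable_def)
  have "even ((\<Sum>p\<leftarrow>qs. ends_at p v) + size (filter_mset (\<lambda>e. v \<in> e) (\<Sum>p\<leftarrow>qs. path_edges p)))"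
    if "\<forall>p\<in>set qs. p \<noteq> [] \<and> distinct p" for qs
    using that
  proof (induction qs)
    case (Cons q qs)
    then show ?case using ends_parity[of q v] by auto
  qed simp
  from this[of ps] have "even (f v + size (filter_mset (\<lambda>e. v \<in> e) (mset_set E)))"
    using r by (simp add: realizes_def)
  moreover have "size (filter_mset (\<lambda>e. v \<in> e) (mset_set E)) = card (nbhd E v)"
    using assms(1) by (simp add: filter_mset_mset_set graph_def flip: card_nbhd)
  ultimately show ?thesis by simp
qed

lemma realizable_odd_pos:
  "graph E \<Longrightarrow> realizable E f \<Longrightarrow> odd (card (nbhd E v)) \<Longrightarrow> f v \<ge> 1"
  using realizable_parity[of E f v] by (cases "f v") auto

lemma realizable_union:
  assumes "realizable E1 f1" "realizable E2 f2" "E1 \<inter> E2 = {}" "finite E1" "finite E2"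
  shows "realizable (E1 \<union> E2) (\<lambda>v. f1 v + f2 v)"
proof -
  obtain ps qs where "realizes ps E1 f1" "realizes qs E2 f2"
    using assms by (auto simp: realizable_def)
  then have "realizes (ps @ qs) (E1 \<union> E2) (\<lambda>v. f1 v + f2 v)"
    using assms by (auto simp: realizes_def mset_set_Union)
  then show ?thesis by (auto simp: realizable_def)
qed

lemma realizable_edge: "b \<noteq> c \<Longrightarrow> realizable {{b, c}} (\<lambda>v. of_bool (v = b) + of_bool (v = c))"
  unfolding realizable_def by (rule exI[of _ "[[b, c]]"]) (auto simp: realizes_def ends_at_def)

text \<open>Without edges only one-vertex paths are available, and each uses up two ends. This is
  the base case of \<open>realizable_one_zero\<close>, where moving ends may have piled them up at a
  vertex.\<close>

lemma realizable_trivial: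
  assumes "finite V" "\<And>v. even (f v)" "\<And>v. v \<notin> V \<Longrightarrow> f v = 0"
  shows "realizable {} f"
  using assms
proof (induction "sum f V" arbitrary: f rule: less_induct)
  case less
  show ?case
  proof (cases "\<exists>v. f v \<noteq> 0")
    case False
    then show ?thesis unfolding realizable_def by (intro exI[of _ "[]"]) (auto simp: realizes_def)
  next
    case True
    then obtain v where v: "f v \<noteq> 0" by blast
    then have v2: "f v \<ge> 2" using less.prems(2)[of v] by presburger
    have vV: "v \<in> V" using v less.prems(3)[of v] by auto
    let ?g = "f(v := f v - 2)"
    have "sum ?g V < sum f V"
      using vV v2 less.prems(1) by (intro sum_strict_mono_ex1) (auto intro!: bexI[of _ v])
    moreover have "even (?g x)" for x using less.prems(2)[of x] v2 by auto
    moreover have "x \<notin> V \<Longrightarrow> ?g x = 0" for x using less.prems(3)[of x] by auto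
    ultimately have "realizable {} ?g" using less.hyps[of ?g] less.prems(1) by blast
    then obtain ps where "realizes ps {} ?g" by (auto simp: realizable_def)
    then have "realizes ([v] # ps) {} f" using v2
      unfolding realizes_def by (auto simp: ends_at_def split: if_splits)
    then show ?thesis by (auto simp: realizable_def)
  qed
qed

text \<open>Count ends path by path: each path has two, and both lie in \<open>V\<close> because
  \<open>f\<close> vanishes elsewhere. This turns bounds on \<open>sum f V\<close> into bounds on
  the number of paths.\<close>

lemma realizes_sum:
  assumes "realizes ps E f" "finite V" "\<And>v. v \<notin> V \<Longrightarrow> f v = 0"
  shows "sum f V = 2 * length ps"
proof -
  have "hd p \<in> V \<and> last p \<in> V" if "p \<in> set ps" for p
  proof (rule ccontr)
    assume "\<not> ?thesis"
    then obtain v where v: "v \<notin> V" "ends_at p v \<noteq> 0" by (auto simp: ends_at_def)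
    have "f v = (\<Sum>p\<leftarrow>ps. ends_at p v)" using assms(1) by (auto simp: realizes_def)
    then have "(\<Sum>p\<leftarrow>ps. ends_at p v) = 0" using assms(3)[OF v(1)] by simp
    then have "ends_at p v = 0" using that by (simp add: sum_list_eq_0_iff)
    then show False using v by simp
  qed
  then have "(\<Sum>v\<in>V. \<Sum>p\<leftarrow>ps. ends_at p v) = 2 * length ps"
  proof (induction ps)
    case (Cons p ps)
    have "(\<Sum>v\<in>V. ends_at p v) = 2"
    proof -
      have "(\<Sum>v\<in>V. of_bool (hd p = v)) = (1::nat)" "(\<Sum>v\<in>V. of_bool (last p = v)) = (1::nat)"
        using Cons.prems[of p] assms(2) by (auto simp: of_bool_def)
      then show ?thesis by (simp add: ends_at_def sum.distrib)
    qed
    then show ?case using Cons by (simp add: sum.distrib)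
  qed simp
  then show ?thesis using assms(1) by (simp add: realizes_def)
qed

lemma shift_sum:
  assumes "finite V" "a \<in> V" "b \<in> V" "a \<noteq> b" "f b \<ge> 1"
  shows "sum (shift a b f) V = sum f V"
proof -
  have V: "V = insert a (insert b (V - {a, b}))" using assms by auto
  have "sum (shift a b f) (V - {a, b}) = sum f (V - {a, b})"
    by (rule sum.cong) (auto simp: shift_def)
  moreover have "sum g V = g a + g b + sum g (V - {a, b})" for g :: "'a \<Rightarrow> nat"
    using assms by (subst V) simp
  ultimately show ?thesis using assms by (simp add: shift_def)
qed

section \<open>Moving path ends\<close>

text \<open>A pair \<open>e\<close> of an index and a direction stands for one end of one path, and
  \<open>orient ps e\<close> reads that path from this end. A one-vertex path has two such pairs, in
  agreement with its two ends.\<close>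

definition orient :: "'a list list \<Rightarrow> nat \<times> bool \<Rightarrow> 'a list" where
  "orient ps e = (if snd e then ps ! fst e else rev (ps ! fst e))"

text \<open>If \<open>p\<close> meets \<open>a\<close>, the last vertex of this segment is the one
  from which \<open>p\<close> enters \<open>a\<close>. Exchanges reverse exactly this
  segment.\<close>

definition before :: "'a \<Rightarrow> 'a list \<Rightarrow> 'a list" where
  "before a p = takeWhile (\<lambda>v. v \<noteq> a) p"

lemma before_split: "a \<in> set p \<Longrightarrow> \<exists>ws. p = before a p @ a # ws"
proof -
  assume "a \<in> set p"
  then obtain us ws where "p = us @ a # ws" "a \<notin> set us" using split_list_first by fast
  moreover have "takeWhile (\<lambda>v. v \<noteq> a) (us @ a # ws) = us"
    using \<open>a \<notin> set us\<close> by (subst takeWhile_append2) auto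
  ultimately show ?thesis unfolding before_def by auto
qed

lemma before_app: "a \<notin> set us \<Longrightarrow> before a (us @ a # ws) = us"
  unfolding before_def by (subst takeWhile_append2) auto

lemma notin_before: "a \<notin> set (before a p)"
  by (auto simp: before_def dest: set_takeWhileD)

lemma orient_edges: "path_edges (orient ps e) = path_edges (ps ! fst e)"
  by (simp add: orient_def path_edges_rev)

lemma orient_ok:
  assumes "realizes ps E f" "fst e < length ps"
  shows "orient ps e \<noteq> []" "distinct (orient ps e)"
  using assms by (auto simp: realizes_def orient_def)

lemma orient_ends: 
  assumes "realizes ps E f" "fst e < length ps"
  shows "ends_at (orient ps e) = ends_at (ps ! fst e)"
  using assms by (auto simp: realizes_def orient_def ends_at_rev)

text \<open>The new path is given as read from \<open>e\<close> but stored in the direction of the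
  old one, so that the other pair with the same index still reads it from the opposite end.\<close>

lemma realizes_update:
  assumes r: "realizes ps E f" and e: "fst e < length ps"
    and q: "q \<noteq> []" "distinct q"
    and qE: "path_edges q + mset_set E = path_edges (orient ps e) + mset_set E'"
    and qf: "\<And>v. f' v + ends_at (orient ps e) v = f v + ends_at q v"
  shows "realizes (ps[fst e := (if snd e then q else rev q)]) E' f'"
  unfolding realizes_def
proof (intro conjI allI)
  let ?q = "if snd e then q else rev q"
  let ?ps = "ps[fst e := ?q]"
  show "\<forall>p\<in>set ?ps. p \<noteq> [] \<and> distinct p"
    using r q set_update_subset_insert[of ps "fst e" ?q] by (auto simp: realizes_def)
  have pq: "path_edges ?q = path_edges q" by (simp add: path_edges_rev)
  have eq: "ends_at ?q = ends_at q" using q by (simp add: ends_at_rev)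
  have "(\<Sum>p\<leftarrow>?ps. path_edges p) + path_edges (ps ! fst e) = mset_set E + path_edges q"
    using sum_list_map_update[OF e, of path_edges ?q] r pq by (simp add: realizes_def)
  also have "\<dots> = mset_set E' + path_edges (ps ! fst e)"
    using qE by (simp add: orient_edges ac_simps)
  finally show "(\<Sum>p\<leftarrow>?ps. path_edges p) = mset_set E'" by simp
  fix v
  have "(\<Sum>p\<leftarrow>?ps. ends_at p v) + ends_at (ps ! fst e) v = f v + ends_at q v"
    using sum_list_map_update[OF e, of "\<lambda>p. ends_at p v" ?q] r eq by (simp add: realizes_def)
  also have "\<dots> = f' v + ends_at (ps ! fst e) v"
    using qf[of v] orient_ends[OF r e] by simp
  finally show "f' v = (\<Sum>p\<leftarrow>?ps. ends_at p v)" by simp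
qed

lemma ends_pos:
  assumes "realizes ps E f" "fst e < length ps"
  shows "f (hd (orient ps e)) \<ge> 1"
proof -
  let ?v = "hd (orient ps e)"
  have "ends_at (ps ! fst e) ?v \<ge> 1"
    using orient_ends[OF assms] by (metis ends_at_def le_add1 of_bool_eq(2))
  moreover have "ends_at (ps ! fst e) ?v \<le> (\<Sum>p\<leftarrow>ps. ends_at p ?v)"
    using assms(2) by (intro member_le_sum_list) auto
  ultimately show ?thesis using assms(1) by (simp add: realizes_def)
qed

lemma path_edge_in:
  assumes "realizes ps E f" "i < length ps" "e \<in># path_edges (ps ! i)" "finite E"
  shows "e \<in> E"
proof -
  have "path_edges (ps ! i) \<subseteq># (\<Sum>p\<leftarrow>ps. path_edges p)"
    using assms(2) sum_list_map_remove1[of "ps ! i" ps path_edges] by simp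
  then have "e \<in># mset_set E" using assms by (auto simp: realizes_def dest: mset_subset_eqD)
  then show ?thesis using assms by simp
qed

lemma path_edge_unique:
  assumes "realizes ps E f" "i < length ps" "j < length ps" "i \<noteq> j"
    and "e \<in># path_edges (ps ! i)" "e \<in># path_edges (ps ! j)"
  shows False
proof -
  have "count (\<Sum>p\<leftarrow>ps. path_edges p) e \<le> 1"
    using assms(1) by (simp add: realizes_def count_mset_set')
  have *: "(\<Sum>p\<leftarrow>ps. path_edges p) = (\<Sum>i<length ps. path_edges (ps ! i))"
    by (simp add: sum_list_sum_nth atLeast0LessThan)
  have "count (path_edges (ps ! i)) e + count (path_edges (ps ! j)) e
      = (\<Sum>k\<in>{i, j}. count (path_edges (ps ! k)) e)" using assms by simp
  also have "\<dots> \<le> (\<Sum>k<length ps. count (path_edges (ps ! k)) e)"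
    using assms by (intro sum_mono2) auto
  also have "\<dots> = count (\<Sum>p\<leftarrow>ps. path_edges p) e" by (simp add: * count_sum)
  also have "\<dots> \<le> 1" by fact
  finally have "count (path_edges (ps ! i)) e + count (path_edges (ps ! j)) e \<le> 1" .
  moreover have "count (path_edges (ps ! i)) e \<ge> 1" "count (path_edges (ps ! j)) e \<ge> 1"
    by (metis assms(5) count_greater_eq_one_iff, metis assms(6) count_greater_eq_one_iff)
  ultimately show False by linarith
qed

text \<open>Induction along the chain. If the first path goes from \<open>b\<close> to
  \<open>x\<close> and then enters \<open>a\<close>, reversing the segment before \<open>a\<close>
  makes it use the edge \<open>ab\<close> instead of \<open>ax\<close>. Its end moves from
  \<open>b\<close> to \<open>x\<close>, and now \<open>ax\<close> is missing, for which the rest of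
  the chain, starting at \<open>x\<close>, is responsible. The last path avoids \<open>a\<close> and
  is prolonged.\<close>

lemma chain_realizable:
  assumes "realizes ps E f" "graph E" "{a, b} \<notin> E" "a \<noteq> b"
    and "\<And>i. i \<le> m \<Longrightarrow> fst (c i) < length ps"
    and "hd (orient ps (c 0)) = b"
    and "\<And>i. i < m \<Longrightarrow> a \<in> set (orient ps (c i)) \<and>
           last (before a (orient ps (c i))) = hd (orient ps (c (Suc i)))"
    and "a \<notin> set (orient ps (c m))"
    and "inj_on c {..m}"
  shows "realizable (insert {a, b} E) (shift a b f)"
  using assms
proof (induction m arbitrary: ps E f b c)
  case 0
  let ?Q = "orient ps (c 0)"
  have e: "fst (c 0) < length ps" using 0 by simp
  have Q: "?Q \<noteq> []" "distinct ?Q" using orient_ok[OF 0(1) e] .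
  have fb: "f b \<ge> 1" using ends_pos[OF 0(1) e] 0 by simp
  have "path_edges (a # ?Q) = add_mset {a, b} (path_edges ?Q)"
    using path_edges_append[of "[a]" ?Q] Q 0 by simp
  then have *: "path_edges (a # ?Q) + mset_set E = path_edges ?Q + mset_set (insert {a, b} E)"
    using 0 by (simp add: graph_def)
  have "realizes (ps[fst (c 0) := (if snd (c 0) then a # ?Q else rev (a # ?Q))])
     (insert {a, b} E) (shift a b f)"
    by (rule realizes_update[OF 0(1) e _ _ *])
       (use Q 0 fb in \<open>auto simp: shift_def ends_at_def\<close>)
  then show ?case by (auto simp: realizable_def)
next
  case (Suc m)
  let ?Q = "orient ps (c 0)"
  have e: "fst (c 0) < length ps" using Suc by simp
  have Q: "?Q \<noteq> []" "distinct ?Q" using orient_ok[OF Suc(2) e] .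
  have fb: "f b \<ge> 1" using ends_pos[OF Suc(2) e] Suc by simp
  define us where "us = before a ?Q"
  obtain ws where ws: "?Q = us @ a # ws" 
    using before_split[of a ?Q] Suc.prems(7)[of 0] unfolding us_def by auto
  have us: "us \<noteq> []" "hd us = b" using ws Suc.prems(4,6) by (cases us; auto)+
  define x where "x = last us"
  have dQ: "distinct (us @ a # ws)" using Q ws by simp
  have xa: "x \<noteq> a" using dQ us unfolding x_def by (metis disjoint_iff distinct_append last_in_set list.set_intros(1))
  have pQ: "path_edges ?Q = add_mset {a, x} (path_edges us + path_edges (a # ws))"
    using path_edges_append[of us "a # ws"] us by (simp add: ws x_def insert_commute)
  have xE: "{a, x} \<in> E"
    using path_edge_in[OF Suc(2) e, of "{a, x}"] Suc.prems(2) pQ orient_edges[of ps "c 0"]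
    by (simp add: graph_def)
  have xb: "x \<noteq> b" using xE Suc.prems(3) by auto
  let ?N = "rev us @ a # ws"
  have pN: "path_edges ?N = add_mset {a, b} (path_edges us + path_edges (a # ws))"
    using path_edges_append[of "rev us" "a # ws"] us by (simp add: path_edges_rev last_rev insert_commute)
  define E1 where "E1 = insert {a, b} (E - {{a, x}})"
  define f1 where "f1 = shift x b f"
  define ps1 where "ps1 = ps[fst (c 0) := (if snd (c 0) then ?N else rev ?N)]"
  have finE: "finite E" using Suc.prems(2) by (simp add: graph_def)
  have mE: "mset_set E = add_mset {a, x} (mset_set (E - {{a, x}}))"
    using xE finE by (metis mset_set.remove)
  have "path_edges ?N + mset_set E = path_edges ?Q + mset_set E1"
    unfolding pN pQ E1_def using Suc.prems(3) finE by (simp add: mE)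
  then have r1: "realizes ps1 E1 f1" unfolding ps1_def
  proof (rule realizes_update[OF Suc(2) e, rotated 2])
    show "f1 v + ends_at ?Q v = f v + ends_at ?N v" for v
      using us fb xb by (auto simp: ws f1_def shift_def ends_at_def x_def hd_rev)
  qed (use dQ in auto)
  have g1: "graph E1" using Suc.prems(2,4) by (auto simp: graph_def E1_def)
  \<comment> \<open>A later member of the chain may be the other end of the path just changed;
    injectivity of \<open>c\<close> excludes the same end. Only one side of \<open>a\<close> was
    reversed, so from the other end the path reads the same up to \<open>a\<close>.\<close>
  have same_total: "fst (c (Suc i)) < length ps1 \<and> hd (orient ps1 (c (Suc i))) = hd (orient ps (c (Suc i))) \<and>
     before a (orient ps1 (c (Suc i))) = before a (orient ps (c (Suc i))) \<and>
     (a \<in> set (orient ps1 (c (Suc i))) \<longleftrightarrow> a \<in> set (orient ps (c (Suc i))))" if "i \<le> m" for i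
  proof -
    have ne: "c (Suc i) \<noteq> c 0" using Suc.prems(9) that by (metis Suc_le_mono atMost_iff inj_onD le0 nat.distinct(1))
    have l: "fst (c (Suc i)) < length ps" using Suc.prems(5) that by simp
    show ?thesis
    proof (cases "fst (c (Suc i)) = fst (c 0)")
      case False
      then show ?thesis using l by (auto simp: ps1_def orient_def)
    next
      case True
      then have s: "snd (c (Suc i)) = (\<not> snd (c 0))" using ne prod_eq_iff by blast
      have o1: "orient ps1 (c (Suc i)) = rev ?N"
        using True s e by (auto simp: orient_def ps1_def)
      have o0: "orient ps (c (Suc i)) = rev ?Q"
        using True s by (auto simp: orient_def)
      have na: "a \<notin> set (rev ws)" using dQ by auto
      have "before a (rev ?N) = rev ws" "before a (rev ?Q) = rev ws"
        using before_app[OF na] by (auto simp: ws)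
      moreover have "hd (rev ?N) = hd (rev ?Q)" by (cases ws rule: rev_cases) (auto simp: ws)
      ultimately show ?thesis using l unfolding o1 o0 by (auto simp: ws ps1_def)
    qed
  qed
  have "realizable (insert {a, x} E1) (shift a x f1)"
  proof (rule Suc.IH[OF r1 g1, of x "\<lambda>i. c (Suc i)"])
    show "{a, x} \<notin> E1" using xb xa by (auto simp: E1_def doubleton_eq_iff)
    show "a \<noteq> x" using xa by simp
    show "fst (c (Suc i)) < length ps1" if "i \<le> m" for i using same_total that by blast
    show "hd (orient ps1 (c (Suc 0))) = x" 
      using same_total[of 0] Suc.prems(7)[of 0] by (simp add: x_def us_def)
    show "a \<in> set (orient ps1 (c (Suc i))) \<and>
        last (before a (orient ps1 (c (Suc i)))) = hd (orient ps1 (c (Suc (Suc i))))" if "i < m" for i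
      using same_total[of i] same_total[of "Suc i"] Suc.prems(7)[of "Suc i"] that by simp
    show "a \<notin> set (orient ps1 (c (Suc m)))" using same_total[of m] Suc.prems(8) by simp
    show "inj_on (\<lambda>i. c (Suc i)) {..m}"
      using Suc.prems(9) by (auto simp: inj_on_def)
  qed
  moreover have "insert {a, x} E1 = insert {a, b} E" using xE by (auto simp: E1_def)
  moreover have "shift a x f1 = shift a b f"
    using xb xa Suc.prems(4) by (auto simp: shift_def f1_def)
  ultimately show ?case by simp
qed

lemma ends_count:
  assumes "realizes ps E f"
  shows "f v = card {e \<in> {..<length ps} \<times> UNIV. hd (orient ps e) = v}"
proof -
  have "f v = (\<Sum>i<length ps. ends_at (ps ! i) v)"
    using assms by (simp add: realizes_def sum_list_sum_nth atLeast0LessThan)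
  also have "\<dots> = (\<Sum>i<length ps. \<Sum>s\<in>UNIV. of_bool (hd (orient ps (i, s)) = v))"
    using assms by (intro sum.cong) (auto simp: UNIV_bool orient_def ends_at_def hd_rev realizes_def)
  also have "\<dots> = (\<Sum>e\<in>{..<length ps} \<times> UNIV. of_bool (hd (orient ps e) = v))"
    by (subst sum.cartesian_product) (simp add: case_prod_unfold)
  also have "\<dots> = card {e \<in> {..<length ps} \<times> UNIV. hd (orient ps e) = v}"
    by (simp add: of_bool_def sum.If_cases Int_def)
  finally show ?thesis .
qed

text \<open>Start from a path end at some $b \in B$. If its path avoids $a$, prolong it to $a$. Otherwise exchange
  the edge by which it enters $a$ for $ab$: now the edge from $a$ to the preceding neighbour is missing and
  that neighbour takes the role of $b$. Chains started from different ends are disjoint, and a chain gets stuck only at a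
  neighbour of $a$ without path ends.\<close>

theorem add_edge_at_pivot:
  assumes g: "graph E" and R: "realizable E f" and B: "finite B" "a \<notin> B" "\<And>b. b \<in> B \<Longrightarrow> {a, b} \<notin> E"
    and less: "card {v \<in> nbhd E a. f v = 0} < sum f B"
  shows "\<exists>b\<in>B. f b \<ge> 1 \<and> realizable (insert {a, b} E) (shift a b f)"
proof -
  obtain ps where r: "realizes ps E f" using R by (auto simp: realizable_def)
  define U where "U = {..<length ps} \<times> (UNIV :: bool set)"
  have finU: "finite U" by (simp add: U_def)
  define S0 where "S0 = {e \<in> U. hd (orient ps e) \<in> B}"
  have "card S0 = card (\<Union>b\<in>B. {e \<in> U. hd (orient ps e) = b})"
    by (rule arg_cong[of _ _ card]) (auto simp: S0_def)
  also have "\<dots> = (\<Sum>b\<in>B. card {e \<in> U. hd (orient ps e) = b})"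
    using B finU by (intro card_UN_disjoint) auto
  also have "\<dots> = sum f B" using ends_count[OF r] by (simp add: U_def)
  finally have cS0: "card S0 = sum f B" .
  have "\<forall>x. \<exists>e. f x > 0 \<longrightarrow> e \<in> U \<and> hd (orient ps e) = x"
  proof
    fix x
    show "\<exists>e. f x > 0 \<longrightarrow> e \<in> U \<and> hd (orient ps e) = x"
    proof (cases "f x > 0")
      case True
      then have "{e \<in> U. hd (orient ps e) = x} \<noteq> {}"
        using ends_count[OF r, of x] unfolding U_def by (metis card.empty less_numeral_extra(3))
      then show ?thesis by blast
    qed simp
  qed
  then obtain c where c: "\<And>x. f x > 0 \<Longrightarrow> c x \<in> U \<and> hd (orient ps (c x)) = x" by metis
  \<comment> \<open>\<open>c\<close> fixes one end at each vertex that has any, which makes the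
    continuation \<open>G\<close> of a chain a function. \<open>P e\<close> says that the chain goes
    on after \<open>e\<close>: the path meets \<open>a\<close>, and the vertex before
    \<open>a\<close> carries an end. \<open>S\<close> collects all ends reached from
    \<open>B\<close>.\<close>
  define nxt where "nxt e = last (before a (orient ps e))" for e
  define G where "G e = c (nxt e)" for e
  define P where "P e \<longleftrightarrow> a \<in> set (orient ps e) \<and> f (nxt e) > 0" for e
  define S where "S = {(G ^^ m) e |m e. e \<in> S0 \<and> (\<forall>i<m. P ((G ^^ i) e))}"
  have S0S: "S0 \<subseteq> S" unfolding S_def by (force intro: exI[of _ 0])
  have GS: "G e \<in> S" if eS: "e \<in> S" and Pe: "P e" for e
  proof -
    obtain m e0 where "e = (G ^^ m) e0" "e0 \<in> S0" "\<forall>i<m. P ((G ^^ i) e0)"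
      using eS by (auto simp: S_def)
    then have "G e = (G ^^ Suc m) e0 \<and> e0 \<in> S0 \<and> (\<forall>i<Suc m. P ((G ^^ i) e0))"
      using Pe by (auto simp: less_Suc_eq)
    then show ?thesis unfolding S_def by blast
  qed
  show ?thesis
  proof (cases "\<exists>e\<in>S. a \<notin> set (orient ps e)")
    case True
    then obtain m e0 where e0: "e0 \<in> S0" "\<forall>i<m. P ((G ^^ i) e0)" "a \<notin> set (orient ps ((G ^^ m) e0))"
      by (auto simp: S_def)
    let ?b = "hd (orient ps e0)"
    define d where "d i = (G ^^ i) e0" for i
    have d0: "d 0 = e0" by (simp add: d_def)
    have dS: "d (Suc i) = c (nxt (d i))" for i by (simp add: d_def G_def)
    have dU: "d i \<in> U" if "i \<le> m" for i
    proof (cases i)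
      case 0 then show ?thesis using e0 d0 by (simp add: S0_def)
    next
      case (Suc j)
      then show ?thesis using that e0(2) dS c by (simp add: P_def flip: d_def)
    qed
    have bB: "?b \<in> B" using e0 by (simp add: S0_def)
    have "realizable (insert {a, ?b} E) (shift a ?b f)"
    proof (rule chain_realizable[OF r g, where m = m and c = d])
      show "{a, ?b} \<notin> E" using B bB by blast
      show "a \<noteq> ?b" using B bB by auto
      show "fst (d i) < length ps" if "i \<le> m" for i using dU[OF that] by (auto simp: U_def)
      show "hd (orient ps (d 0)) = ?b" by (simp add: d0)
      show "a \<in> set (orient ps (d i)) \<and>
         last (before a (orient ps (d i))) = hd (orient ps (d (Suc i)))" if "i < m" for i
      proof -
        have "P (d i)" using e0 that by (simp add: d_def)
        then show ?thesis using c[of "nxt (d i)"] by (simp add: P_def dS nxt_def)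
      qed
      show "a \<notin> set (orient ps (d m))" using e0 by (simp add: d_def)
      show "inj_on d {..m}"
      proof (rule linorder_inj_onI)
        fix i j assume ij: "i < j" "i \<in> {..m}" "j \<in> {..m}"
        \<comment> \<open>Since \<open>G\<close> is a function, a repetition makes the chain
          periodic. Its last term, whose path avoids \<open>a\<close>, would then occur at an
          earlier index, where the path meets \<open>a\<close>.\<close>
        show "d i \<noteq> d j"
        proof
          assume eq: "d i = d j"
          have "d m = (G ^^ (m - j)) (d j)" using ij
            by (metis add.commute atMost_iff d_def funpow_add le_add_diff_inverse o_apply)
          also have "\<dots> = d (m - j + i)" unfolding eq[symmetric] by (simp add: d_def funpow_add)
          finally have "a \<notin> set (orient ps (d (m - j + i)))" using e0(3) by (simp add: d_def)
          moreover have "P (d (m - j + i))" using e0(2) ij by (simp add: d_def)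
          ultimately show False by (simp add: P_def)
        qed
      qed auto
    qed
    moreover have "f ?b \<ge> 1" using ends_pos[OF r, of e0] e0 by (auto simp: S0_def U_def)
    ultimately show ?thesis using bB by blast
  next
    \<comment> \<open>All paths reached meet \<open>a\<close>. Then \<open>nxt\<close> maps
      \<open>S\<close> injectively into the neighbours of \<open>a\<close>, and \<open>S\<close>
      contains, as disjoint sets, the starting ends \<open>S0\<close> and the ends chosen by
      \<open>c\<close> at the vertices of \<open>X1\<close>. So at least \<open>card S0\<close>
      neighbours of \<open>a\<close> carry no end, against \<open>less\<close>.\<close>
    case False
    have hdS: "e \<in> U \<and> hd (orient ps e) \<noteq> a" if eS: "e \<in> S" for e
    proof -
      obtain m e0 where m: "e = (G ^^ m) e0" "e0 \<in> S0" "\<forall>i<m. P ((G ^^ i) e0)"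
        using eS by (auto simp: S_def)
      show ?thesis
      proof (cases m)
        case 0 then show ?thesis using m B by (auto simp: S0_def)
      next
        case (Suc j)
        let ?d = "(G ^^ j) e0"
        have P: "P ?d" using m Suc by blast
        then have eq: "e \<in> U \<and> hd (orient ps e) = nxt ?d" using c m(1) Suc by (simp add: P_def G_def)
        moreover have "nxt ?d \<noteq> a"
        proof -
          have "a \<notin> nbhd E a" using nbhd_irrefl[OF g] .
          show ?thesis
          proof (cases "before a (orient ps ?d) = []")
            case False
            then show ?thesis using notin_before[of a "orient ps ?d"] unfolding nxt_def by (metis last_in_set)
          next
            case True
            then have "hd (orient ps ?d) = a" using before_split[of a "orient ps ?d"] P
              by (metis P_def append_Nil list.sel(1))
            moreover have "hd (orient ps ((G ^^ i) e0)) \<noteq> a" if "i \<le> j" for i using that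
            proof (induction i)
              case 0 then show ?case using m B by (auto simp: S0_def)
            next
              case (Suc i)
              let ?e = "(G ^^ i) e0"
              have Pi: "P ?e" using m(3) Suc \<open>m = Suc j\<close> by auto
              have "before a (orient ps ?e) \<noteq> []"
                using Suc before_split[of a "orient ps ?e"] Pi
                by (metis P_def append_Nil list.sel(1) Suc_leD)
              then have "nxt ?e \<noteq> a" using notin_before[of a "orient ps ?e"] unfolding nxt_def by (metis last_in_set)
              then show ?case using c[of "nxt ?e"] Pi by (simp add: P_def G_def[of ?e])
            qed
            ultimately show ?thesis by blast
          qed
        qed
        ultimately show ?thesis by simp
      qed
    qed
    have split: "\<exists>us ws. orient ps e = us @ a # ws \<and> us \<noteq> [] \<and> last us = nxt e" if "e \<in> S" for e
    proof -
      have "a \<in> set (orient ps e)" using False that by blast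
      then obtain ws where ws: "orient ps e = before a (orient ps e) @ a # ws" using before_split by fast
      moreover have "before a (orient ps e) \<noteq> []" using hdS[OF that] ws by (metis append_Nil list.sel(1))
      ultimately show ?thesis unfolding nxt_def by blast
    qed
    have edge: "{a, nxt e} \<in># path_edges (ps ! fst e)" if eS: "e \<in> S" for e
    proof -
      obtain us ws where "orient ps e = us @ a # ws" "us \<noteq> []" "last us = nxt e" using split[OF eS] by blast
      then have "{a, nxt e} \<in># path_edges (orient ps e)" by (simp add: path_edges_append insert_commute)
      then show ?thesis by (simp add: orient_edges)
    qed
    have len: "fst e < length ps" if "e \<in> S" for e using hdS[OF that] by (auto simp: U_def)
    \<comment> \<open>Two ends with the same \<open>nxt\<close> would use the same edge at
      \<open>a\<close>. Different paths share no edge, and the two ends of one path enter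
      \<open>a\<close> from different sides.\<close>
    have inj: "inj_on nxt S"
    proof (rule inj_onI, rule ccontr)
      fix d e assume de: "d \<in> S" "e \<in> S" "nxt d = nxt e" "d \<noteq> e"
      show False
      proof (cases "fst d = fst e")
        case False
        then show False
          using path_edge_unique[OF r len[OF de(1)] len[OF de(2)] False edge[OF de(1)]] edge[OF de(2)] de(3) by simp
      next
        case True
        then have s: "snd d = (\<not> snd e)" using de prod_eq_iff by blast
        then have "orient ps d = rev (orient ps e)" using True by (auto simp: orient_def)
        moreover obtain us ws where 1: "orient ps e = us @ a # ws" "us \<noteq> []" "last us = nxt e"
          using split[OF de(2)] by blast
        moreover obtain us' ws' where 2: "orient ps d = us' @ a # ws'" "us' \<noteq> []" "last us' = nxt d"
          using split[OF de(1)] by blast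
        ultimately have eq: "rev ws @ a # rev us = us' @ a # ws'" by simp
        have dis: "distinct (us @ a # ws)" using orient_ok[OF r len[OF de(2)]] 1 by simp
        then have "a \<notin> set (rev ws)" "a \<notin> set (rev us)" by auto
        then have "us' = rev ws" using eq by (metis append_Cons_eq_iff before_app in_set_conv_decomp notin_before append_eq_append_conv2)
        then have "nxt d \<in> set ws" using 2 by (metis last_in_set set_rev)
        moreover have "nxt e \<in> set us" using 1 by (metis last_in_set)
        ultimately show False using dis de(3) by auto
      qed
    qed
    define X where "X = nxt ` S"
    have Xnb: "X \<subseteq> nbhd E a"
      using edge path_edge_in[OF r len] g by (fastforce simp: X_def nbhd_def graph_def insert_commute)
    have finS: "finite S" using hdS finU by (meson finite_subset subsetI)
    have cX: "card X = card S" by (simp add: X_def card_image inj)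
    define X1 where "X1 = {x \<in> X. f x > 0}"
    define X0 where "X0 = {x \<in> X. f x = 0}"
    have finX: "finite X" by (simp add: X_def finS)
    have cXX: "card X = card X1 + card X0"
      using finX by (subst card_Un_disjoint[symmetric]) (auto simp: X1_def X0_def intro: arg_cong[of _ _ card])
    have c1: "c ` X1 \<subseteq> S"
    proof
      fix y assume "y \<in> c ` X1"
      then obtain e where "e \<in> S" "f (nxt e) > 0" "y = c (nxt e)" by (auto simp: X1_def X_def)
      then show "y \<in> S" using GS[of e] False by (auto simp: P_def G_def)
    qed
    have c2: "inj_on c X1" using c by (intro inj_onI) (metis (no_types, lifting) X1_def mem_Collect_eq)
    \<comment> \<open>A starting end lies at a vertex of \<open>B\<close>, which is not adjacent to
      \<open>a\<close>; a continuation lies at a neighbour of \<open>a\<close>.\<close>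
    have c3: "S0 \<inter> c ` X1 = {}"
    proof -
      have "hd (orient ps (c x)) \<notin> B" if "x \<in> X1" for x
      proof -
        have "hd (orient ps (c x)) = x" "x \<in> nbhd E a" using c that Xnb by (auto simp: X1_def)
        then show ?thesis using B(3)[of x] by (auto simp: nbhd_def insert_commute)
      qed
      then show ?thesis by (auto simp: S0_def)
    qed
    have "card S0 + card X1 = card (S0 \<union> c ` X1)"
      using c2 c3 finS S0S c1 by (subst card_Un_disjoint) (auto simp: card_image intro: finite_subset)
    also have "\<dots> \<le> card S" using c1 S0S finS by (intro card_mono) auto
    finally have "card S0 \<le> card X0" using cX cXX by simp
    also have "\<dots> \<le> card {v \<in> nbhd E a. f v = 0}"
      using Xnb finite_nbhd[OF g] by (intro card_mono) (auto simp: X0_def)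
    finally show ?thesis using less cS0 by simp
  qed
qed

section \<open>Reinserting deleted edges\<close>

lemma nbhd_remove: "a \<noteq> b \<Longrightarrow> nbhd (E - {{a, b}}) v =
    (if v = a then nbhd E v - {b} else if v = b then nbhd E v - {a} else nbhd E v)"
  by (auto simp: nbhd_def doubleton_eq_iff)

lemma graph_subset: "graph E \<Longrightarrow> E' \<subseteq> E \<Longrightarrow> graph E'"
  by (auto simp: graph_def intro: finite_subset)

lemma nbhd_mono: "E' \<subseteq> E \<Longrightarrow> nbhd E' v \<subseteq> nbhd E v"
  by (auto simp: nbhd_def)

lemma nbhd_edge: "u \<in> nbhd E v \<longleftrightarrow> {u, v} \<in> E" "u \<in> nbhd E v \<longleftrightarrow> {v, u} \<in> E"
  by (auto simp: nbhd_def insert_commute)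

text \<open>\<open>add_edge_at_pivot\<close> for \<open>B = {b}\<close>, seen as undoing a deletion.
  The roles are not symmetric: the neighbours of \<open>a\<close> have to carry ends, while
  \<open>b\<close> pays the end that reappears at \<open>a\<close>.\<close>

lemma restore_edge:
  assumes g: "graph E" and ab: "{a, b} \<in> E" and R: "realizable (E - {{a, b}}) f"
    and less: "card {v \<in> nbhd E a - {b}. f v = 0} < f b"
  shows "realizable E (shift a b f)"
proof -
  let ?E = "E - {{a, b}}"
  have g': "graph ?E" using g graph_subset by blast
  have ne: "a \<noteq> b" using g ab graph_not_self by metis
  have "card {v \<in> nbhd ?E a. f v = 0} < sum f {b}" using less ne by (simp add: nbhd_remove)
  then have "realizable (insert {a, b} ?E) (shift a b f)"
    using add_edge_at_pivot[OF g' R, of "{b}" a] ne by auto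
  moreover have "insert {a, b} ?E = E" using ab by auto
  ultimately show ?thesis by simp
qed

lemma odd_removed:
  assumes g: "graph E" and ab: "{a, b} \<in> E" 
  shows "even (card (nbhd (E - {{a, b}}) v)) \<longleftrightarrow> (if v = a \<or> v = b then odd (card (nbhd E v)) else even (card (nbhd E v)))"
proof -
  have ne: "a \<noteq> b" using g ab graph_not_self by metis
  have *: "even (card (S - {x})) \<longleftrightarrow> odd (card S)" if "finite S" "x \<in> S" for S and x :: 'a
    using that card_Suc_Diff1[OF that] by (metis even_Suc)
  show ?thesis using *[OF finite_nbhd[OF g]] ab ne
    by (auto simp: nbhd_remove nbhd_edge insert_commute)
qed

text \<open>Choose an edge \<open>ab\<close> where \<open>b\<close> is the vertex without ends, if
  there is one. Delete it and move an end from \<open>a\<close> to \<open>b\<close>; now only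
  \<open>a\<close> can be without ends, so the hypotheses persist. On putting \<open>ab\<close> back
  with pivot \<open>a\<close>, no neighbour of \<open>a\<close> blocks. For \<open>f\<close> the
  parity of the degree this is Lovasz's case of at most one nonisolated even vertex.\<close>

theorem realizable_one_zero:
  assumes "graph E" "finite V" "\<And>v. even (f v) \<longleftrightarrow> even (card (nbhd E v))" "\<And>v. v \<notin> V \<Longrightarrow> f v = 0"
    and "\<And>u v. u \<in> \<Union>E \<Longrightarrow> v \<in> \<Union>E \<Longrightarrow> f u = 0 \<Longrightarrow> f v = 0 \<Longrightarrow> u = v" "\<Union>E \<subseteq> V"
  shows "realizable E f"
  using assms
proof (induction "card E" arbitrary: E f)
  case 0
  then have "E = {}" by (simp add: graph_def)
  then show ?case using realizable_trivial[of V f] 0 by (simp add: nbhd_def)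
next
  case (Suc n)
  have "\<exists>a b. {a, b} \<in> E \<and> (\<forall>v\<in>\<Union>E. v \<noteq> b \<longrightarrow> f v \<ge> 1)"
  proof (cases "\<exists>b\<in>\<Union>E. f b = 0")
    case True
    then obtain b e where b: "b \<in> e" "e \<in> E" "f b = 0" by blast
    then obtain a where "e = {a, b}" using graph_edgeE[OF Suc.prems(1), of e] by (metis doubleton_eq_iff insert_iff empty_iff)
    moreover have "\<forall>v\<in>\<Union>E. v \<noteq> b \<longrightarrow> f v \<ge> 1"
      using Suc.prems(5)[of _ b] b by (metis UnionI not_one_le_zero Suc_leI One_nat_def bot_nat_0.not_eq_extremum)
    ultimately show ?thesis using b by blast
  next
    case False
    obtain e where "e \<in> E" using Suc by (metis card.empty ex_in_conv nat.distinct(1))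
    moreover obtain a b where "e = {a, b}" using graph_edgeE[OF Suc.prems(1) \<open>e \<in> E\<close>] by metis
    ultimately show ?thesis using False by (metis One_nat_def Suc_leI bot_nat_0.not_eq_extremum)
  qed
  then obtain a b where ab: "{a, b} \<in> E" and pos: "\<And>v. v \<in> \<Union>E \<Longrightarrow> v \<noteq> b \<Longrightarrow> f v \<ge> 1" by blast
  have ne: "a \<noteq> b" using Suc.prems(1) ab graph_not_self by metis
  let ?E = "E - {{a, b}}" and ?f = "shift b a f"
  have fa: "f a \<ge> 1" using pos ab ne by blast
  have fin: "finite E" using Suc.prems by (simp add: graph_def)
  have "realizable ?E ?f"
  proof (rule Suc.hyps(1))
    show "n = card ?E" using Suc.hyps(2) ab fin by simp
    show "graph ?E" using graph_subset Suc.prems(1) by blast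
    show "finite V" by fact
    show "even (?f v) \<longleftrightarrow> even (card (nbhd ?E v))" for v
      using odd_removed[OF Suc.prems(1) ab, of v] Suc.prems(3)[of v] fa ne by (auto simp: shift_def)
    have "a \<in> V" "b \<in> V" using ab Suc.prems(6) by auto
    then show "?f v = 0" if "v \<notin> V" for v using that Suc.prems(4)[of v] by (auto simp: shift_def)
    have "v = a" if "v \<in> \<Union>?E" "?f v = 0" for v
      using that pos[of v] by (auto simp: shift_def split: if_splits)
    then show "u = v" if "u \<in> \<Union>?E" "v \<in> \<Union>?E" "?f u = 0" "?f v = 0" for u v using that by blast
    show "\<Union>?E \<subseteq> V" using Suc.prems(6) by blast
  qed
  moreover have "card {v \<in> nbhd E a - {b}. ?f v = 0} < ?f b"
  proof -
    have "?f v \<noteq> 0" if "v \<in> nbhd E a - {b}" for v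
    proof -
      have "v \<noteq> a" using that nbhd_irrefl[OF Suc.prems(1)] by auto
      moreover have "v \<in> \<Union>E" using that by (auto simp: nbhd_def)
      ultimately show ?thesis using pos[of v] that by (auto simp: shift_def)
    qed
    then have "{v \<in> nbhd E a - {b}. ?f v = 0} = {}" by blast
    then show ?thesis by (simp only: card.empty) (simp add: shift_def)
  qed
  ultimately have "realizable E (shift a b ?f)"
    using restore_edge[OF Suc.prems(1) ab, of ?f] by blast
  moreover have "shift a b ?f = f" using fa ne by (auto simp: shift_def)
  ultimately show ?case by simp
qed

text \<open>A path ending at \<open>u\<close> and a path starting at \<open>v\<close> are joined by
  \<open>uv\<close>. The first lies inside \<open>C\<close> and the second outside, so the result is
  again a path, and the ends at \<open>u\<close> and \<open>v\<close> disappear.\<close>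

lemma realizable_bridge:
  assumes R: "realizable E1 f1" "realizable E2 f2" and fin: "finite E1" "finite E2"
    and C: "\<Union>E1 \<subseteq> C" "\<And>x. x \<notin> C \<Longrightarrow> f1 x = 0" "\<Union>E2 \<inter> C = {}" "\<And>x. x \<in> C \<Longrightarrow> f2 x = 0"
    and uv: "f1 u \<ge> 1" "f2 v \<ge> 1"
  shows "realizable (insert {u, v} (E1 \<union> E2)) (\<lambda>x. f1 x + f2 x - of_bool (x = u) - of_bool (x = v))"
proof -
  \<comment> \<open>The vertex of a one-vertex path lies on no edge of that path, but it carries
    ends. So the conditions on edges and on ends together confine each path to its side of
    \<open>C\<close>.\<close>
  have cov: "w \<in> \<Union>E \<or> f w \<ge> 1" if r: "realizes ps E f" and p: "p \<in> set ps" and w: "w \<in> set p" and fe: "finite E" 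
    for ps E f p w
  proof -
    obtain i where i: "i < length ps" "p = ps ! i" using p by (metis in_set_conv_nth)
    show ?thesis
    proof (cases "length p \<ge> 2")
      case True
      then obtain e where "e \<in># path_edges p" "w \<in> e" using path_edges_cover[OF True w] by blast
      then show ?thesis using path_edge_in[OF r i(1), of e] i(2) fe by blast
    next
      case False
      then have "p = [w]" using w by (cases p rule: path_edges.cases) auto
      then show ?thesis using ends_pos[OF r, of "(i, True)"] i by (simp add: orient_def)
    qed
  qed
  have pick: "\<exists>as p bs. ps = as @ p # bs \<and> (hd p = w \<or> last p = w)" if "realizes ps E f" "f w \<ge> 1" for ps E f w
  proof -
    have "(\<Sum>p\<leftarrow>ps. ends_at p w) \<noteq> 0" using that unfolding realizes_def by (metis not_one_le_zero)
    then have "\<not> (\<forall>n\<in>set (map (\<lambda>p. ends_at p w) ps). n = 0)" by (simp only: sum_list_eq_0_iff) simp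
    then obtain p where "p \<in> set ps" "ends_at p w \<noteq> 0" by auto
    then have "hd p = w \<or> last p = w" by (auto simp: ends_at_def)
    then show ?thesis using split_list[OF \<open>p \<in> set ps\<close>] by blast
  qed
  obtain ps where ps: "realizes ps E1 f1" using R by (auto simp: realizable_def)
  obtain qs where qs: "realizes qs E2 f2" using R by (auto simp: realizable_def)
  obtain as p bs where p: "ps = as @ p # bs" "hd p = u \<or> last p = u" using pick[OF ps uv(1)] by blast
  obtain cs q ds where q: "qs = cs @ q # ds" "hd q = v \<or> last q = v" using pick[OF qs uv(2)] by blast
  have pne: "p \<noteq> []" "distinct p" "q \<noteq> []" "distinct q" using ps qs p q by (auto simp: realizes_def)
  define p' where "p' = (if last p = u then p else rev p)"
  define q' where "q' = (if hd q = v then q else rev q)"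
  have p': "p' \<noteq> []" "distinct p'" "last p' = u" "path_edges p' = path_edges p" "ends_at p' = ends_at p" "set p' = set p"
    using pne p by (auto simp: p'_def last_rev path_edges_rev ends_at_rev)
  have q': "q' \<noteq> []" "distinct q'" "hd q' = v" "path_edges q' = path_edges q" "ends_at q' = ends_at q" "set q' = set q"
    using pne q by (auto simp: q'_def hd_rev path_edges_rev ends_at_rev)
  have pC: "set p \<subseteq> C"
  proof
    fix w assume "w \<in> set p"
    then have "w \<in> \<Union>E1 \<or> f1 w \<ge> 1" using cov[OF ps, of p w] fin(1) p(1) by simp
    then show "w \<in> C" using C(1) C(2)[of w] by force
  qed
  have qC: "set q \<inter> C = {}"
  proof -
    have "w \<notin> C" if "w \<in> set q" for w
    proof -
      have "w \<in> \<Union>E2 \<or> f2 w \<ge> 1" using cov[OF qs _ that fin(2)] q(1) by simp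
      then show ?thesis using C(3) C(4)[of w] by force
    qed
    then show ?thesis by blast
  qed
  have uC: "u \<in> C" "v \<notin> C" using p' q' pC qC by (metis last_in_set subsetD, metis disjoint_iff list.set_sel(1))
  have dis: "E1 \<inter> E2 = {}" 
  proof -
    have "e = {}" if "e \<in> E1" "e \<in> E2" for e using that C by blast
    moreover have "{} \<notin> E1"
    proof
      assume "{} \<in> E1"
      then have "{} \<in># (\<Sum>p\<leftarrow>ps. path_edges p)" using ps fin by (simp add: realizes_def)
      moreover have "{} \<notin># path_edges r" for r :: "'a list" by (induction r rule: path_edges.induct) auto
      then have "{} \<notin># (\<Sum>p\<leftarrow>rs. path_edges p)" for rs :: "'a list list" by (induction rs) auto
      ultimately show False by blast
    qed
    ultimately show ?thesis by blast
  qed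
  have new: "{u, v} \<notin> E1 \<union> E2" using uC C by blast
  have m: "(\<Sum>p\<leftarrow>ps. path_edges p) = mset_set E1" "(\<Sum>p\<leftarrow>qs. path_edges p) = mset_set E2"
    using ps qs by (auto simp: realizes_def)
  have "realizes ((p' @ q') # as @ bs @ cs @ ds) (insert {u, v} (E1 \<union> E2))
      (\<lambda>x. f1 x + f2 x - of_bool (x = u) - of_bool (x = v))"
    unfolding realizes_def
  proof (intro conjI allI)
    show "\<forall>r\<in>set ((p' @ q') # as @ bs @ cs @ ds). r \<noteq> [] \<and> distinct r"
      using ps qs p q p' q' pC qC unfolding realizes_def by auto
    have "path_edges (p' @ q') = add_mset {u, v} (path_edges p + path_edges q)"
      using path_edges_append[of p' q'] p' q' by simp
    then show "(\<Sum>r\<leftarrow>(p' @ q') # as @ bs @ cs @ ds. path_edges r) = mset_set (insert {u, v} (E1 \<union> E2))"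
      using m fin new dis unfolding p q by (simp add: mset_set_Union p(1) q(1) ac_simps flip: m)
    fix x
    have e: "ends_at (p' @ q') x + of_bool (x = u) + of_bool (x = v) = ends_at p x + ends_at q x"
      using p' q' unfolding p'(5)[symmetric] q'(5)[symmetric] by (simp add: ends_at_def)
    have f: "f1 x = (\<Sum>p\<leftarrow>as @ p # bs. ends_at p x)" "f2 x = (\<Sum>p\<leftarrow>cs @ q # ds. ends_at p x)"
      using ps qs p(1) q(1) by (auto simp: realizes_def)
    show "f1 x + f2 x - of_bool (x = u) - of_bool (x = v) =
        (\<Sum>r\<leftarrow>(p' @ q') # as @ bs @ cs @ ds. ends_at r x)"
      using e unfolding f by simp
  qed
  then show ?thesis by (auto simp: realizable_def)
qed

section \<open>Stars of edges at one vertex\<close>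

definition star :: "'a \<Rightarrow> 'a set \<Rightarrow> 'a set set" where
  "star z A = (\<lambda>b. {z, b}) ` A"

lemma nbhd_minus_star:
  "nbhd (E - star z A) v = (if v = z then nbhd E v - A else if v \<in> A then nbhd E v - {z} else nbhd E v)"
  if "z \<notin> A"
  using that by (auto simp: nbhd_def star_def doubleton_eq_iff image_iff)

text \<open>Half of the edges, the set $W$, are restored with pivot $z$. This provides $z$ with the path ends that are
  spent on restoring the other half with pivots in $A$.\<close>

theorem restore_star:
  assumes g: "graph E" and A: "A \<subseteq> nbhd E z" "x \<in> A"
    and R: "realizable (E - star z A) f"
    and pos: "\<And>v. v \<in> nbhd E z \<Longrightarrow> f v \<ge> 1"
    and d: "f z + card A mod 2 \<ge> 1"
    and zeta: "\<And>W b. W \<subseteq> A \<Longrightarrow> x \<in> W \<Longrightarrow> card W = (card A + 1) div 2 \<Longrightarrow> b \<in> A - W \<Longrightarrow>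
       card {v \<in> nbhd E b - {z}. f v = 0 \<or> v \<in> W} \<le> 2"
    and tight: "\<And>W. W \<subseteq> A \<Longrightarrow> x \<in> W \<Longrightarrow> card W = (card A + 1) div 2 \<Longrightarrow> W \<noteq> A \<Longrightarrow>
       f z + card A mod 2 = 1 \<Longrightarrow> \<exists>b\<in>A - W. card {v \<in> nbhd E b - {z}. f v = 0 \<or> v \<in> W} \<le> 1"
  shows "\<exists>f'. realizable E f' \<and> f' z = f z + card A mod 2 \<and> (\<forall>v. v \<notin> A \<longrightarrow> v \<noteq> z \<longrightarrow> f' v = f v) \<and>
     (\<forall>V. finite V \<longrightarrow> z \<in> V \<longrightarrow> A \<subseteq> V \<longrightarrow> sum f' V = sum f V)"
proof -
  have finA: "finite A" using A finite_nbhd[OF g] by (meson finite_subset)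
  have zA: "z \<notin> A" using A nbhd_irrefl[OF g] by blast
  let ?k = "card A"
  have k1: "?k \<ge> 1" using A finA by (metis One_nat_def Suc_leI card_gt_0_iff empty_iff)
  have AE: "{z, b} \<in> E" if "b \<in> A" for b using that A nbhd_edge(2)[of b E z] by blast
  \<comment> \<open>State after the \<open>j\<close> edges to \<open>W\<close> have been put back
    with pivot \<open>z\<close>: each vertex of \<open>W\<close> has given one end to
    \<open>z\<close>.\<close>
  define h where "h W j = (\<lambda>v. if v = z then f v + j else if v \<in> W then f v - 1 else f v)" for W :: "'a set" and j :: nat
  have posA: "f b \<ge> 1" if "b \<in> A" for b using pos that A by blast
  have gs: "graph (E - S)" for S using g graph_subset by blast
  have ins: "insert {z, b} (E - star z S) = E - star z (S - {b})" if "b \<in> A" for S b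
    using AE[OF that] zA by (auto simp: star_def doubleton_eq_iff)
  \<comment> \<open>The pivot lemma decides which edge comes next. Only the \<open>j\<close>
    vertices of \<open>W\<close> can have run out of ends, while \<open>A - W\<close> still carries
    at least \<open>card A - j\<close> ends, and \<open>j < card A - j\<close> up to the middle of
    \<open>A\<close>. For \<open>j = 0\<close> nothing blocks, so the first edge can be prescribed
    to go to \<open>x\<close>.\<close>
  have stage1: "\<exists>W. W \<subseteq> A \<and> x \<in> W \<and> card W = j \<and> realizable (E - star z (A - W)) (h W j)"
    if "1 \<le> j" "j \<le> (?k + 1) div 2" for j
    using that
  proof (induction j)
    case (Suc j)
    show ?case
    proof (cases "j = 0")
      case True
      have "{v \<in> nbhd (E - star z A) z. f v = 0} = {}"
        using pos nbhd_mono[of "E - star z A" E z] by fastforce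
      then have "\<exists>b\<in>{x}. f b \<ge> 1 \<and> realizable (insert {z, b} (E - star z A)) (shift z b f)"
      proof (intro add_edge_at_pivot[OF gs R])
        assume "{v \<in> nbhd (E - star z A) z. f v = 0} = {}"
        then show "card {v \<in> nbhd (E - star z A) z. f v = 0} < sum f {x}"
          using posA[OF A(2)] by (simp only: card.empty) simp
      qed (use zA A in \<open>auto simp: star_def\<close>)
      then have "realizable (E - star z (A - {x})) (shift z x f)" using ins[OF A(2)] by simp
      moreover have "shift z x f = h {x} 1" by (auto simp: h_def shift_def)
      ultimately show ?thesis using True A by (intro exI[of _ "{x}"]) auto
    next
      case False
      then obtain W where W: "W \<subseteq> A" "x \<in> W" "card W = j" "realizable (E - star z (A - W)) (h W j)"
        using Suc by auto
      have cA: "card (A - W) = ?k - j" using W finA by (simp add: card_Diff_subset finite_subset)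
      have "{v \<in> nbhd (E - star z (A - W)) z. h W j v = 0} \<subseteq> W"
        using pos nbhd_mono[of "E - star z (A - W)" E z] nbhd_irrefl[OF g] by (fastforce simp: h_def split: if_splits)
      then have "card {v \<in> nbhd (E - star z (A - W)) z. h W j v = 0} \<le> j"
        using W finA by (metis card_mono finite_subset)
      also have "j < ?k - j" using Suc.prems by linarith
      also have "\<dots> = (\<Sum>b\<in>A - W. 1)" using cA by simp
      also have "\<dots> \<le> sum (h W j) (A - W)" using posA zA by (intro sum_mono) (auto simp: h_def)
      finally have "\<exists>b\<in>A - W. h W j b \<ge> 1 \<and>
         realizable (insert {z, b} (E - star z (A - W))) (shift z b (h W j))"
        using finA zA by (intro add_edge_at_pivot[OF gs W(4)]) (auto simp: star_def)
      then obtain b where b: "b \<in> A - W" "realizable (E - star z (A - W - {b})) (shift z b (h W j))"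
        using ins by auto
      have "shift z b (h W j) = h (insert b W) (Suc j)" using b zA by (auto simp: h_def shift_def)
      moreover have "A - W - {b} = A - insert b W" by auto
      moreover have "card (insert b W) = Suc j" using b W finA by (simp add: finite_subset)
      ultimately show ?thesis using b W by (intro exI[of _ "insert b W"]) auto
    qed
  qed simp
  let ?j = "(?k + 1) div 2"
  have "1 \<le> ?j" using k1 by linarith
  then obtain W where W: "W \<subseteq> A" "x \<in> W" "card W = ?j" "realizable (E - star z (A - W)) (h W ?j)"
    using stage1[OF _ order_refl] by metis
  define L where "L = A - W"
  have finL: "finite L" "finite W" using finA W by (auto simp: L_def finite_subset)
  have "card L = ?k - ?j" unfolding L_def W(3)[symmetric] using card_Diff_subset[OF finL(2) W(1)] .
  moreover have "(n - (n + 1) div 2) + n mod 2 = (n + 1) div 2" for n :: nat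
    by (cases "even n") (auto elim!: evenE oddE)
  ultimately have cL: "card L + ?k mod 2 = ?j" by metis
  \<comment> \<open>State after the edges to \<open>Y\<close> have been put back too, with pivots in
    \<open>Y\<close>: now \<open>z\<close> pays one end for each.\<close>
  define q where "q Y = (\<lambda>v. if v = z then f v + ?j - card Y else if v \<in> W then f v - 1
      else if v \<in> Y then f v + 1 else f v)" for Y :: "'a set"
  have step: "realizable (E - star z (L - insert b Y)) (q (insert b Y))"
    if Y: "Y \<subseteq> L" "b \<in> L" "b \<notin> Y" and r: "realizable (E - star z (L - Y)) (q Y)"
      and c: "card {v \<in> nbhd E b - {z}. f v = 0 \<or> v \<in> W} < f z + ?j - card Y" for Y b
  proof -
    let ?E = "E - star z (L - insert b Y)"
    have bA: "b \<in> A" using Y by (auto simp: L_def)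
    have finY: "finite Y" using Y finL by (meson finite_subset)
    have e: "{b, z} \<in> ?E" using AE[OF bA] zA bA by (auto simp: star_def doubleton_eq_iff insert_commute)
    have "?E - {{b, z}} = E - star z (L - Y)" using Y by (auto simp: star_def insert_commute)
    moreover have "{v \<in> nbhd ?E b - {z}. q Y v = 0} \<subseteq> {v \<in> nbhd E b - {z}. f v = 0 \<or> v \<in> W}"
      using nbhd_mono[of ?E E b] by (auto simp: q_def split: if_splits)
    then have "card {v \<in> nbhd ?E b - {z}. q Y v = 0} \<le> card {v \<in> nbhd E b - {z}. f v = 0 \<or> v \<in> W}"
      using finite_nbhd[OF g] by (intro card_mono) auto
    then have "card {v \<in> nbhd ?E b - {z}. q Y v = 0} < q Y z" using c by (simp add: q_def)
    ultimately have "realizable ?E (shift b z (q Y))"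
      using restore_edge[OF gs e, of "q Y"] r by simp
    moreover have "shift b z (q Y) = q (insert b Y)"
      using Y finY zA bA by (auto simp: q_def shift_def L_def)
    ultimately show ?thesis by simp
  qed
  have q0: "q {} = h W ?j" by (auto simp: q_def h_def)
  have fin: "realizable E (q L)"
  proof (cases "L = {}")
    case True
    then show ?thesis using W(4) q0 by (simp add: star_def L_def[symmetric])
  next
    case False
    then have WA: "W \<noteq> A" by (auto simp: L_def)
    \<comment> \<open>\<open>l\<close> is saved for last. Until then \<open>z\<close> has at least 3
      ends, so the bound 2 of \<open>zeta\<close> suffices; for \<open>l\<close> itself
      \<open>z\<close> has \<open>f z + card A mod 2 + 1\<close> ends left, and \<open>tight\<close>
      covers the case where these are only 2.\<close>
    have "\<exists>l\<in>L. card {v \<in> nbhd E l - {z}. f v = 0 \<or> v \<in> W} < f z + ?k mod 2 + 1"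
    proof (cases "f z + ?k mod 2 = 1")
      case True
      then show ?thesis using tight[OF W(1-3) WA] by (auto simp: L_def less_Suc_eq_le)
    next
      case False
      then have "f z + ?k mod 2 \<ge> 2" using d by linarith
      moreover obtain l where "l \<in> L" using \<open>L \<noteq> {}\<close> by blast
      moreover have "card {v \<in> nbhd E l - {z}. f v = 0 \<or> v \<in> W} \<le> 2" 
        using zeta[OF W(1-3)] \<open>l \<in> L\<close> by (auto simp: L_def)
      ultimately show ?thesis by (intro bexI[of _ l]) auto
    qed
    then obtain l where l: "l \<in> L" "card {v \<in> nbhd E l - {z}. f v = 0 \<or> v \<in> W} < f z + ?k mod 2 + 1" by blast
    have cLl: "card (L - {l}) + 1 = card L" using card_Suc_Diff1[OF finL(1) l(1)] by simp
    have "realizable (E - star z (L - Y)) (q Y)" if "finite Y" "Y \<subseteq> L - {l}" for Y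
      using that
    proof (induction Y rule: finite_induct)
      case empty
      then show ?case using W(4) q0 by (simp add: L_def)
    next
      case (insert b Y)
      have "insert b Y \<subseteq> L - {l}" using insert by blast
      then have "card (insert b Y) \<le> card (L - {l})" using finL by (intro card_mono) auto
      then have "card Y + 2 \<le> card L" using insert cLl by simp
      then have "3 \<le> f z + ?j - card Y" using cL d by linarith
      moreover have "card {v \<in> nbhd E b - {z}. f v = 0 \<or> v \<in> W} \<le> 2"
        using zeta[OF W(1-3), of b] insert by (auto simp: L_def)
      ultimately show ?case using insert by (intro step) auto
    qed
    from this[of "L - {l}"] have "realizable (E - star z (L - (L - {l}))) (q (L - {l}))" using finL by blast
    then have "realizable (E - star z (L - insert l (L - {l}))) (q (insert l (L - {l})))"
      using l cL cLl by (intro step) auto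
    then show ?thesis using l by (simp add: insert_absorb star_def)
  qed
  have sum: "sum (q L) V = sum f V" if V: "finite V" "z \<in> V" "A \<subseteq> V" for V
  proof -
    have V': "V = insert z (A \<union> (V - insert z A))" using V by auto
    have AA: "A = W \<union> L" "W \<inter> L = {}" using W by (auto simp: L_def)
    have split: "sum s V = s z + (sum s W + sum s L) + sum s (V - insert z A)" for s :: "'a \<Rightarrow> nat"
    proof -
      have "sum s V = s z + sum s (A \<union> (V - insert z A))" using V zA by (subst V') (simp add: finA)
      also have "\<dots> = s z + (sum s A + sum s (V - insert z A))" using V finA by (subst sum.union_disjoint) auto
      also have "sum s A = sum s W + sum s L" unfolding AA(1) using finL AA(2) by (simp add: sum.union_disjoint)
      finally show ?thesis by simp
    qed
    have "sum (q L) W + card W = (\<Sum>v\<in>W. q L v + 1)" by (subst sum.distrib) simp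
    also have "\<dots> = sum f W"
    proof (rule sum.cong)
      fix v assume "v \<in> W"
      then show "q L v + 1 = f v" using W(1) zA posA[of v] by (auto simp: q_def subset_eq)
    qed simp
    finally have 1: "sum (q L) W + card W = sum f W" .
    have "sum (q L) L = (\<Sum>v\<in>L. f v + 1)" using zA by (intro sum.cong) (auto simp: q_def L_def)
    also have "\<dots> = sum f L + card L" by (subst sum.distrib) simp
    finally have 2: "sum (q L) L = sum f L + card L" .
    have 3: "sum (q L) (V - insert z A) = sum f (V - insert z A)"
      using W by (intro sum.cong) (auto simp: q_def L_def)
    have 4: "q L z + card L = f z + card W" using cL W by (simp add: q_def)
    show ?thesis unfolding split 3 using 1 2 4 by linarith
  qed
  have "q L z = f z + ?k mod 2" using cL by (simp add: q_def)
  moreover have "q L v = f v" if "v \<notin> A" "v \<noteq> z" for v using that W by (auto simp: q_def L_def)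
  ultimately show ?thesis using fin sum by blast
qed

section \<open>Exceptional components and bridges\<close>

abbreviation even_vertex :: "'a set set \<Rightarrow> 'a \<Rightarrow> bool" where
  "even_vertex E v \<equiv> even (card (nbhd E v))"

definition even_edges :: "'a set set \<Rightarrow> 'a set set" where
  "even_edges E = {e \<in> E. \<forall>v\<in>e. even_vertex E v}"

definition closed_in :: "'a set set \<Rightarrow> 'a set \<Rightarrow> bool" where
  "closed_in E C \<longleftrightarrow> (\<forall>e\<in>E. e \<inter> C \<noteq> {} \<longrightarrow> e \<subseteq> C)"

definition clique3 :: "'a set set \<Rightarrow> 'a set \<Rightarrow> bool" where
  "clique3 E T \<longleftrightarrow> card T = 3 \<and> (\<forall>u\<in>T. \<forall>v\<in>T. u \<noteq> v \<longrightarrow> {u, v} \<in> E)"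

text \<open>Such a set $C$ is automatically a connected component, as every vertex of $C$ is adjacent to $T$.\<close>

definition SET_component :: "'a set set \<Rightarrow> 'a set \<Rightarrow> 'a set \<Rightarrow> bool" where
  "SET_component E C T \<longleftrightarrow> clique3 E T \<and> T \<subseteq> C \<and> closed_in E C \<and> (\<forall>v\<in>T. even_vertex E v) \<and>
     (\<forall>v\<in>C - T. \<not> even_vertex E v \<and> card (nbhd E v \<inter> T) \<ge> 2)"

definition no_SET_component :: "'a set set \<Rightarrow> bool" where
  "no_SET_component E \<longleftrightarrow> (\<nexists>C T. SET_component E C T)"

text \<open>\<open>sum f V\<close> is twice the number of paths. Isolated vertices enter only
  through \<open>V\<close>, so deleting edges does not lower the bound.\<close>

definition gallai :: "'a set \<Rightarrow> 'a set set \<Rightarrow> bool" where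
  "gallai V E \<longleftrightarrow> (\<exists>f. realizable E f \<and> (\<forall>v. v \<notin> V \<longrightarrow> f v = 0) \<and> sum f V \<le> card V)"

text \<open>A deletion can turn odd vertices even and thereby create new edges between even
  vertices. The condition on \<open>even_edges\<close> forbids this, because the structural
  hypothesis is only known for subsets of one fixed edge set.\<close>

definition gallai_below :: "'a set set \<Rightarrow> bool" where
  "gallai_below E \<longleftrightarrow> (\<forall>E' V. E' \<subset> E \<longrightarrow> even_edges E' \<subseteq> even_edges E \<longrightarrow> no_SET_component E' \<longrightarrow> finite V \<longrightarrow> \<Union>E' \<subseteq> V \<longrightarrow> gallai V E')"

definition same_total :: "'a set \<Rightarrow> ('a \<Rightarrow> nat) \<Rightarrow> ('a \<Rightarrow> nat) \<Rightarrow> bool" where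
  "same_total V f f' \<longleftrightarrow> (\<forall>v. v \<notin> V \<longrightarrow> f' v = f v) \<and> sum f' V = sum f V"

lemma same_total_trans: "same_total V f g \<Longrightarrow> same_total V g h \<Longrightarrow> same_total V f h" by (simp add: same_total_def)

lemma same_total_shift: "finite V \<Longrightarrow> a \<in> V \<Longrightarrow> b \<in> V \<Longrightarrow> a \<noteq> b \<Longrightarrow> f b \<ge> 1 \<Longrightarrow> same_total V f (shift a b f)"
  unfolding same_total_def by (auto simp: shift_sum) (auto simp: shift_def)

text \<open>The frame of the reductions: since \<open>conv\<close> only moves ends inside
  \<open>V\<close>, the bound for \<open>E'\<close> is the bound for \<open>E\<close>.\<close>

lemma gallai_reduce:
  assumes "gallai_below E" "E' \<subset> E" "even_edges E' \<subseteq> even_edges E" "no_SET_component E'" "finite V" "\<Union>E \<subseteq> V"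
    and conv: "\<And>f. realizable E' f \<Longrightarrow> \<exists>f'. realizable E f' \<and> same_total V f f'"
  shows "gallai V E"
proof -
  have "\<Union>E' \<subseteq> V" using assms(2,6) by blast
  then have "gallai V E'" using assms(1-5) unfolding gallai_below_def by blast
  then obtain f where f: "realizable E' f" "\<forall>v. v \<notin> V \<longrightarrow> f v = 0" "sum f V \<le> card V"
    by (auto simp: gallai_def)
  then obtain f' where "realizable E f'" "same_total V f f'" using conv by blast
  then show ?thesis using f unfolding gallai_def same_total_def by (intro exI[of _ f']) auto
qed

lemma nbhd_even_edges: "nbhd (even_edges E) v = (if even_vertex E v then {u \<in> nbhd E v. even_vertex E u} else {})"
  by (auto simp: nbhd_def even_edges_def)

lemma graph_even_edges: "graph E \<Longrightarrow> graph (even_edges E)"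
  using graph_subset[of E "even_edges E"] by (auto simp: even_edges_def)

lemma clique3_nbhd: "clique3 E T \<Longrightarrow> v \<in> T \<Longrightarrow> card (nbhd E v \<inter> T) \<ge> 2"
proof -
  assume T: "clique3 E T" "v \<in> T"
  then have fin: "finite T" by (auto simp: clique3_def intro: card_ge_0_finite)
  have "T - {v} \<subseteq> nbhd E v \<inter> T" using T by (auto simp: clique3_def nbhd_def)
  then have "card (T - {v}) \<le> card (nbhd E v \<inter> T)" using fin by (intro card_mono) auto
  then show ?thesis using T fin by (simp add: clique3_def)
qed

lemma SET_component_nbhd:
  assumes "SET_component E C T" "v \<in> C" shows "card (nbhd E v \<inter> T) \<ge> 2"
  using assms clique3_nbhd[of E T v] unfolding SET_component_def by (cases "v \<in> T") auto

lemma SET_component_edge: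
  assumes "SET_component E C T" "v \<in> C" shows "\<exists>e\<in>E. v \<in> e"
proof -
  have "nbhd E v \<inter> T \<noteq> {}" using SET_component_nbhd[OF assms] by (metis card.empty not_numeral_le_zero)
  then show ?thesis by (auto simp: nbhd_def)
qed

lemma SET_component_transfer:
  assumes sp: "SET_component E' C T" and sub: "E' \<subseteq> E" and all: "\<And>e. e \<in> E \<Longrightarrow> e \<inter> C \<noteq> {} \<Longrightarrow> e \<in> E'"
  shows "SET_component E C T"
proof -
  have nbhd: "nbhd E v = nbhd E' v" if "v \<in> C" for v using sub all that unfolding nbhd_def by blast
  have TC: "T \<subseteq> C" using sp by (auto simp: SET_component_def)
  show ?thesis unfolding SET_component_def
  proof (intro conjI)
    show "clique3 E T" using sp sub by (auto simp: SET_component_def clique3_def)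
    show "closed_in E C" using sp all by (auto simp: SET_component_def closed_in_def)
    show "\<forall>v\<in>T. even_vertex E v" using sp nbhd TC by (auto simp: SET_component_def)
    show "\<forall>v\<in>C - T. \<not> even_vertex E v \<and> card (nbhd E v \<inter> T) \<ge> 2" using sp nbhd by (auto simp: SET_component_def)
  qed (rule TC)
qed

text \<open>A SET component is determined by the edges that meet it, so one that meets no deleted
  edge was there before. Hence only the ends of deleted edges have to be inspected.\<close>

lemma SET_component_touch:
  assumes "no_SET_component E" "SET_component E' C T" "E' \<subseteq> E"
  shows "\<exists>e\<in>E - E'. e \<inter> C \<noteq> {}"
  using SET_component_transfer[OF assms(2,3)] assms(1) unfolding no_SET_component_def by blast

text \<open>\<open>C\<close> is one side of the cut. Both ends are required to be even, so that
  deleting the edge makes them odd and each carries a path end for the join.\<close>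

definition bridge :: "'a set set \<Rightarrow> 'a \<Rightarrow> 'a \<Rightarrow> 'a set \<Rightarrow> bool" where
  "bridge E u v C \<longleftrightarrow> {u, v} \<in> E \<and> u \<in> C \<and> v \<notin> C \<and> closed_in (E - {{u, v}}) C \<and> even_vertex E u \<and> even_vertex E v"

lemma sum_parity: "finite V \<Longrightarrow> even (sum f V) \<longleftrightarrow> even (card {v \<in> V. odd (f v :: nat)})"
proof (induction V rule: finite_induct)
  case (insert x V)
  have "{v \<in> insert x V. odd (f v)} = (if odd (f x) then insert x {v \<in> V. odd (f v)} else {v \<in> V. odd (f v)})" by auto
  then show ?case using insert by auto
qed simp

lemma nbhd_inside: "closed_in E C \<Longrightarrow> x \<in> C \<Longrightarrow> nbhd {e \<in> E. e \<subseteq> C} x = nbhd E x"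
  by (auto simp: nbhd_def closed_in_def)

lemma nbhd_outside: "closed_in E C \<Longrightarrow> x \<notin> C \<Longrightarrow> nbhd {e \<in> E. e \<inter> C = {}} x = nbhd E x"
  by (auto simp: nbhd_def closed_in_def)

text \<open>There is at most one SET component, the one at \<open>u\<close>. Deleting an edge
  \<open>bc\<close> of its triangle leaves a single even vertex in it, so it has an odd number of
  vertices, and the even number of ends is at most \<open>card C - 1\<close>. Adding
  \<open>bc\<close> as a path of its own costs two ends, which gives the excess of 1.\<close>

lemma SET_side:
  assumes g: "graph E" and IH: "\<And>E' V. E' \<subseteq> E \<Longrightarrow> even_edges E' \<subseteq> even_edges E \<Longrightarrow> no_SET_component E' \<Longrightarrow> finite V \<Longrightarrow> \<Union>E' \<subseteq> V \<Longrightarrow> gallai V E'"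
    and u: "\<And>C T. SET_component E C T \<Longrightarrow> u \<in> C" and V: "finite V" "\<Union>E \<subseteq> V"
  shows "\<exists>f. realizable E f \<and> (\<forall>v. v \<notin> V \<longrightarrow> f v = 0) \<and> sum f V \<le> card V + 1"
proof (cases "no_SET_component E")
  case True
  then have "gallai V E" using IH V by blast
  then show ?thesis unfolding gallai_def by (metis le_add1 order.trans)
next
  case False
  then obtain C T where sp: "SET_component E C T" by (auto simp: no_SET_component_def)
  have cl: "closed_in E C" using sp by (simp add: SET_component_def)
  define EC where "EC = {e \<in> E. e \<subseteq> C}"
  define ER where "ER = {e \<in> E. e \<inter> C = {}}"
  have E: "E = EC \<union> ER" using cl by (auto simp: EC_def ER_def closed_in_def)
  have ne: "e \<noteq> {}" if "e \<in> E" for e using g that by (auto simp: graph_def)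
  have dis: "EC \<inter> ER = {}" using ne by (auto simp: EC_def ER_def)
  have nbC: "nbhd EC v = nbhd E v" if "v \<in> C" for v
    unfolding EC_def by (rule nbhd_inside[OF cl that])
  have nbR: "nbhd ER v = nbhd E v" if "v \<notin> C" for v
    unfolding ER_def by (rule nbhd_outside[OF cl that])
  have gC: "graph EC" "graph ER" using g graph_subset[of E] by (auto simp: EC_def ER_def)
  have VC: "C \<subseteq> V" using SET_component_edge[OF sp] V by blast
  \<comment> \<open>A further SET component would be disjoint from \<open>C\<close>, yet both
    contain \<open>u\<close>.\<close>
  have nsR: "no_SET_component ER"
    unfolding no_SET_component_def
  proof safe
    fix C2 T2 assume sp2: "SET_component ER C2 T2"
    have "C2 \<inter> C = {}" using SET_component_edge[OF sp2] by (auto simp: ER_def)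
    then have "SET_component E C2 T2"
      using cl by (intro SET_component_transfer[OF sp2]) (auto simp: ER_def closed_in_def)
    then show False using u[OF sp] u[of C2 T2] \<open>C2 \<inter> C = {}\<close> by blast
  qed
  have "even_edges ER \<subseteq> even_edges E"
    using nbR by (auto simp: even_edges_def ER_def) (metis IntI empty_iff)
  moreover have "\<Union>ER \<subseteq> V - C" using V by (auto simp: ER_def)
  ultimately have "gallai (V - C) ER" using IH[of ER "V - C"] nsR V(1) by (auto simp: ER_def)
  then obtain fR where fR: "realizable ER fR" "\<forall>v. v \<notin> V - C \<longrightarrow> fR v = 0" "sum fR (V - C) \<le> card (V - C)"
    by (auto simp: gallai_def)
  obtain a b c where T: "T = {a, b, c}" "a \<noteq> b" "a \<noteq> c" "b \<noteq> c"
    using sp unfolding SET_component_def clique3_def card_3_iff by blast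
  have TC: "T \<subseteq> C" using sp by (simp add: SET_component_def)
  have bc: "{b, c} \<in> EC" using sp T TC by (auto simp: SET_component_def clique3_def EC_def)
  let ?E = "EC - {{b, c}}"
  have evE: "even_vertex ?E v \<longleftrightarrow> v = a" if "v \<in> C" for v
    using odd_removed[OF gC(1) bc, of v] nbC[OF that] sp T that by (auto simp: SET_component_def)
  have ns: "no_SET_component ?E"
    unfolding no_SET_component_def
  proof safe
    fix C2 T2 assume sp2: "SET_component ?E C2 T2"
    have "T2 \<subseteq> C" using SET_component_edge[OF sp2] sp2 by (fastforce simp: SET_component_def EC_def)
    then have "T2 \<subseteq> {a}" using evE sp2 by (auto simp: SET_component_def)
    then have "card T2 \<le> 1" by (metis card_mono finite.emptyI finite_insert is_singletonI is_singleton_altdef)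
    then show False using sp2 by (simp add: SET_component_def clique3_def)
  qed
  have ee: "even_edges ?E = {}"
  proof -
    have False if "e \<in> even_edges ?E" for e
    proof -
      have e: "e \<in> ?E" "\<forall>v\<in>e. even_vertex ?E v" using that by (auto simp: even_edges_def)
      then have "e \<subseteq> {a}" using evE by (auto simp: EC_def)
      then have "card e \<le> 1" by (metis card_mono finite.emptyI finite_insert is_singletonI is_singleton_altdef)
      then show False using e gC(1) by (auto simp: graph_def)
    qed
    then show ?thesis by blast
  qed
  have finC: "finite C" using VC V by (meson finite_subset)
  have "gallai C ?E" by (rule IH) (use ee ns finC in \<open>auto simp: EC_def\<close>)
  then obtain fC where fC: "realizable ?E fC" "\<forall>v. v \<notin> C \<longrightarrow> fC v = 0" "sum fC C \<le> card C"
    by (auto simp: gallai_def)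
  have gE: "graph ?E" using gC(1) graph_subset by blast
  \<comment> \<open>Slack by parity: \<open>sum fC C\<close> is twice a number of paths, while
    \<open>card C\<close> turns out to be odd.\<close>
  have "even (sum fC C)" using fC(1) realizes_sum[of _ ?E fC C] fC(2) finC by (auto simp: realizable_def)
  moreover have "{v \<in> C. odd (fC v)} = C - {a}" using realizable_parity[OF gE fC(1)] evE by auto
  moreover have "a \<in> C" using T TC by auto
  ultimately have "odd (card C)" using sum_parity[OF finC, of fC] card_Suc_Diff1[OF finC, of a] by (metis even_Suc)
  then have sC: "sum fC C + 1 \<le> card C" using \<open>even (sum fC C)\<close> fC(3) le_neq_implies_less[of "sum fC C" "card C"] by fastforce
  have fin: "finite EC" "finite ER" using gC by (auto simp: graph_def)
  let ?g = "\<lambda>v. fC v + (of_bool (v = b) + of_bool (v = c))"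
  have "realizable (?E \<union> {{b, c}}) ?g"
    using fin by (intro realizable_union[OF fC(1) realizable_edge]) (use T in auto)
  moreover have "?E \<union> {{b, c}} = EC" using bc by auto
  ultimately have rC: "realizable EC ?g" by simp
  have "realizable (EC \<union> ER) (\<lambda>v. ?g v + fR v)" by (rule realizable_union[OF rC fR(1) dis fin])
  then have "realizable E (\<lambda>v. ?g v + fR v)" using E by simp
  moreover have "\<forall>v. v \<notin> V \<longrightarrow> ?g v + fR v = 0" using VC fC(2) fR(2) T TC by auto
  moreover have "sum (\<lambda>v. ?g v + fR v) V \<le> card V + 1"
  proof -
    have bcC: "b \<in> C" "c \<in> C" using T TC by auto
    have "(\<Sum>v\<in>C. of_bool (v = b)) = (1::nat)" "(\<Sum>v\<in>C. of_bool (v = c)) = (1::nat)"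
      using bcC finC by (auto simp: of_bool_def)
    then have gC': "sum ?g C = sum fC C + 2" by (simp add: sum.distrib)
    have "sum (\<lambda>v. ?g v + fR v) V = sum (\<lambda>v. ?g v + fR v) C + sum (\<lambda>v. ?g v + fR v) (V - C)"
      using sum.subset_diff[OF VC V(1)] by (simp add: add.commute)
    also have "sum (\<lambda>v. ?g v + fR v) C = sum ?g C" using fR(2) by (intro sum.cong) auto
    also have "sum (\<lambda>v. ?g v + fR v) (V - C) = sum fR (V - C)" using fC(2) bcC by (intro sum.cong) auto
    finally have "sum (\<lambda>v. ?g v + fR v) V \<le> card C + 1 + card (V - C)" using gC' sC fR(3) by linarith
    moreover have "card C + card (V - C) = card V" using VC V(1) finC by (simp add: card_Diff_subset card_mono)
    ultimately show ?thesis by linarith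
  qed
  ultimately show ?thesis by (intro exI[of _ "\<lambda>v. ?g v + fR v"]) blast
qed

text \<open>A SET component of one side that avoids the bridge would be one of \<open>E\<close>, so
  by \<open>SET_side\<close> each side exceeds its share by at most 1. In their sides
  \<open>u\<close> and \<open>v\<close> are odd, hence path ends, and the join removes two ends,
  which makes up for both excesses.\<close>

lemma gallai_bridge:
  assumes g: "graph E" and ns: "no_SET_component E" and IH: "gallai_below E" and V: "finite V" "\<Union>E \<subseteq> V" and br: "bridge E u v C"
  shows "gallai V E"
proof -
  let ?E = "E - {{u, v}}"
  have uv: "{u, v} \<in> E" "u \<in> C" "v \<notin> C" "closed_in ?E C" "even_vertex E u" "even_vertex E v"
    using br by (auto simp: bridge_def)
  define E1 where "E1 = {e \<in> ?E. e \<subseteq> C}"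
  define E2 where "E2 = {e \<in> ?E. e \<inter> C = {}}"
  have E: "E = insert {u, v} (E1 \<union> E2)" using uv by (auto simp: E1_def E2_def closed_in_def)
  have g1: "graph E1" "graph E2" using g graph_subset[of E] by (auto simp: E1_def E2_def)
  have nb1: "nbhd E1 x = nbhd ?E x" if "x \<in> C" for x
    unfolding E1_def by (rule nbhd_inside[OF uv(4) that])
  have nb2: "nbhd E2 x = nbhd ?E x" if "x \<notin> C" for x
    unfolding E2_def by (rule nbhd_outside[OF uv(4) that])
  have ev1: "even_vertex E1 x \<longleftrightarrow> (x \<noteq> u \<and> even_vertex E x)" if "x \<in> C" for x
    using odd_removed[OF g uv(1), of x] nb1[OF that] uv that by auto
  have ev2: "even_vertex E2 x \<longleftrightarrow> (x \<noteq> v \<and> even_vertex E x)" if "x \<notin> C" for x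
    using odd_removed[OF g uv(1), of x] nb2[OF that] uv that by auto
  have ee1: "even_edges E1 \<subseteq> even_edges E" using ev1 by (auto simp: even_edges_def E1_def)
  have ee2: "even_edges E2 \<subseteq> even_edges E" using ev2 unfolding even_edges_def E2_def by blast
  have ne: "E1 \<subset> E" "E2 \<subset> E" using uv by (auto simp: E1_def E2_def)
  have IH': "gallai V' E''" if "E'' \<subseteq> E'" "E' \<subset> E" "even_edges E'' \<subseteq> even_edges E'" "even_edges E' \<subseteq> even_edges E"
     "no_SET_component E''" "finite V'" "\<Union>E'' \<subseteq> V'" for E' E'' V'
    using IH that unfolding gallai_below_def by (meson order.trans subset_psubset_trans)
  have "\<exists>f. realizable E1 f \<and> (\<forall>v. v \<notin> V \<inter> C \<longrightarrow> f v = 0) \<and> sum f (V \<inter> C) \<le> card (V \<inter> C) + 1"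
  proof (rule SET_side[OF g1(1), of u])
    show "u \<in> C'" if sp: "SET_component E1 C' T" for C' T
    proof (rule ccontr)
      assume uC: "u \<notin> C'"
      have "C' \<subseteq> C" using SET_component_edge[OF sp] by (auto simp: E1_def)
      then have "SET_component E C' T" using uC uv
        by (intro SET_component_transfer[OF sp]) (auto simp: E1_def closed_in_def)
      then show False using ns by (auto simp: no_SET_component_def)
    qed
    show "\<Union>E1 \<subseteq> V \<inter> C" using V by (auto simp: E1_def)
  qed (use V(1) IH' ne(1) ee1 in blast)+
  then obtain f1 where f1: "realizable E1 f1" "\<And>x. x \<notin> V \<inter> C \<Longrightarrow> f1 x = 0" "sum f1 (V \<inter> C) \<le> card (V \<inter> C) + 1" by blast
  have "\<exists>f. realizable E2 f \<and> (\<forall>v. v \<notin> V - C \<longrightarrow> f v = 0) \<and> sum f (V - C) \<le> card (V - C) + 1"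
  proof (rule SET_side[OF g1(2), of v])
    show "v \<in> C'" if sp: "SET_component E2 C' T" for C' T
    proof (rule ccontr)
      assume uC: "v \<notin> C'"
      have "C' \<inter> C = {}" using SET_component_edge[OF sp] by (auto simp: E2_def)
      then have "SET_component E C' T" using uC uv
        by (intro SET_component_transfer[OF sp]) (auto simp: E2_def closed_in_def)
      then show False using ns by (auto simp: no_SET_component_def)
    qed
    show "\<Union>E2 \<subseteq> V - C" using V by (auto simp: E2_def)
  qed (use V(1) IH' ne(2) ee2 in blast)+
  then obtain f2 where f2: "realizable E2 f2" "\<And>x. x \<notin> V - C \<Longrightarrow> f2 x = 0" "sum f2 (V - C) \<le> card (V - C) + 1" by blast
  have pos: "f1 u \<ge> 1" "f2 v \<ge> 1"
    using realizable_odd_pos[OF g1(1) f1(1)] realizable_odd_pos[OF g1(2) f2(1)] ev1[of u] ev2[of v] uv by blast+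
  let ?f = "\<lambda>x. f1 x + f2 x - of_bool (x = u) - of_bool (x = v)"
  have "realizable E ?f"
    unfolding E
    by (rule realizable_bridge[OF f1(1) f2(1), of C]) (use g1 pos f1(2) f2(2) in \<open>auto simp: graph_def E1_def E2_def\<close>)
  moreover have "\<forall>x. x \<notin> V \<longrightarrow> ?f x = 0" using f1(2) f2(2) by auto
  moreover have "sum ?f V \<le> card V"
  proof -
    have inV: "u \<in> V" "v \<in> V" using uv V by auto
    have "sum ?f V + 2 = (\<Sum>x\<in>V. ?f x + (of_bool (x = u) + of_bool (x = v)))"
      using inV V(1) by (simp add: sum.distrib of_bool_def)
    also have "\<dots> = (\<Sum>x\<in>V. f1 x + f2 x)"
      using pos uv by (intro sum.cong) (auto simp: of_bool_def)
    also have "\<dots> = sum f1 V + sum f2 V" by (simp add: sum.distrib)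
    also have "sum f1 V = sum f1 (V \<inter> C)" using V(1) f1(2) by (intro sum.mono_neutral_right) auto
    also have "sum f2 V = sum f2 (V - C)" using V(1) f2(2) by (intro sum.mono_neutral_right) auto
    finally have "sum ?f V \<le> card (V \<inter> C) + card (V - C)" using f1(3) f2(3) by linarith
    also have "\<dots> = card V" using V(1) by (metis card_Int_Diff)
    finally show ?thesis .
  qed
  ultimately show ?thesis unfolding gallai_def by (intro exI[of _ ?f]) blast
qed

section \<open>Reductions at even vertices\<close>

lemma zero_even: "graph E \<Longrightarrow> realizable E f \<Longrightarrow> f v = 0 \<Longrightarrow> even_vertex E v"
  using realizable_parity[of E f v] by simp

lemma ev_star:
  assumes g: "graph E" and A: "A \<subseteq> nbhd E z"
  shows "even_vertex (E - star z A) v \<longleftrightarrow> (if v = z then even (card (nbhd E z) + card A) else if v \<in> A then \<not> even_vertex E v else even_vertex E v)"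
proof -
  have zA: "z \<notin> A" using A nbhd_irrefl[OF g] by blast
  have fin: "finite A" using A finite_nbhd[OF g] by (meson finite_subset)
  have 1: "card (nbhd E z - A) + card A = card (nbhd E z)"
    using A fin finite_nbhd[OF g] by (simp add: card_Diff_subset card_mono)
  have 2: "Suc (card (nbhd E v - {z})) = card (nbhd E v)" if "v \<in> A"
    using card_Suc_Diff1[OF finite_nbhd[OF g], of z v] that A nbhd_sym[of v E z] by blast
  show ?thesis
  proof (cases "v = z")
    case True
    then show ?thesis using zA 1 by (auto simp: nbhd_minus_star) (metis even_add)+
  next
    case False
    then show ?thesis using 2 zA by (auto simp: nbhd_minus_star) (metis even_Suc)+
  qed
qed

lemma even_edges_mono: "E' \<subseteq> E \<Longrightarrow> (\<And>v. v \<in> \<Union>E' \<Longrightarrow> even_vertex E' v \<Longrightarrow> even_vertex E v) \<Longrightarrow> even_edges E' \<subseteq> even_edges E"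
  unfolding even_edges_def by blast

lemma nbF_D: "u \<in> nbhd (even_edges E) v \<Longrightarrow> u \<in> nbhd E v \<and> even_vertex E u \<and> even_vertex E v \<and> {u, v} \<in> E"
  unfolding nbhd_even_edges by (auto simp: nbhd_edge(1) split: if_splits)

lemma nbF_I: "u \<in> nbhd E v \<Longrightarrow> even_vertex E u \<Longrightarrow> even_vertex E v \<Longrightarrow> u \<in> nbhd (even_edges E) v"
  by (simp add: nbhd_even_edges)

text \<open>Once \<open>xb\<close> is deleted, all neighbours of \<open>x\<close> are odd, so
  nothing blocks the restoration with pivot \<open>x\<close>. For the same reason \<open>x\<close>
  lies in no new SET component; a new one contains \<open>b\<close> but not \<open>x\<close>, and
  then \<open>xb\<close> is a bridge between even vertices.\<close>

lemma gallai_leaf: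
  assumes g: "graph E" and ns: "no_SET_component E" and IH: "gallai_below E" and V: "finite V" "\<Union>E \<subseteq> V" 
    and nobr: "\<And>u v C. \<not> bridge E u v C"
    and x: "nbhd (even_edges E) x = {b}"
  shows "gallai V E"
proof -
  have b: "{b, x} \<in> E" "even_vertex E x" "even_vertex E b" "b \<in> nbhd E x" using nbF_D[of b E x] x by auto
  have xb: "{x, b} \<in> E" using b by (simp add: insert_commute)
  have ne: "x \<noteq> b" using g b nbhd_irrefl by metis
  let ?E = "E - {{x, b}}"
  have g': "graph ?E" by (rule graph_subset[OF g]) auto
  have evE: "even_vertex ?E v \<longleftrightarrow> v \<noteq> x \<and> v \<noteq> b \<and> even_vertex E v" for v using odd_removed[OF g xb, of v] b by auto
  have none: "v \<notin> nbhd E x" if "even_vertex ?E v" for v using that evE nbF_I[of v E x] x b by auto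
  show ?thesis
  proof (rule gallai_reduce[OF IH _ _ _ V])
    show "?E \<subset> E" using xb by blast
    show "even_edges ?E \<subseteq> even_edges E" by (rule even_edges_mono) (use evE in auto)
    show "no_SET_component ?E" unfolding no_SET_component_def
    proof safe
      fix C T assume sp: "SET_component ?E C T"
      have touch: "{x, b} \<inter> C \<noteq> {}" using SET_component_touch[OF ns sp] by auto
      have "x \<notin> C"
      proof
        assume "x \<in> C"
        then have "card (nbhd ?E x \<inter> T) \<ge> 2" using SET_component_nbhd[OF sp] by blast
        then have "nbhd ?E x \<inter> T \<noteq> {}" by auto
        then obtain v where "v \<in> nbhd ?E x" "v \<in> T" by blast
        then show False using none[of v] sp nbhd_mono[of ?E E x] by (auto simp: SET_component_def)
      qed
      then have "bridge E b x C" using touch sp b by (auto simp: bridge_def SET_component_def insert_commute)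
      then show False using nobr by blast
    qed
    fix f assume f: "realizable ?E f"
    have fb: "f b \<ge> 1" using realizable_odd_pos[OF g' f, of b] evE by auto
    have "{v \<in> nbhd E x - {b}. f v = 0} = {}" using none zero_even[OF g' f] by blast
    then have "card {v \<in> nbhd E x - {b}. f v = 0} < f b" using fb by (simp only: card.empty)
    then have "realizable E (shift x b f)" by (rule restore_edge[OF g xb f])
    moreover have "same_total V f (shift x b f)" using V xb ne fb by (intro same_total_shift) auto
    ultimately show "\<exists>f'. realizable E f' \<and> same_total V f f'" by blast
  qed
qed

text \<open>Deleting \<open>v1v2\<close> and \<open>v3w\<close> makes all four vertices odd. The
  pivots are \<open>v2\<close> and then \<open>v3\<close>, whose even neighbours are known. The
  first restoration takes an end only from \<open>v1\<close>, which is not an even neighbour of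
  \<open>v3\<close> because \<open>w\<close> \<noteq> \<open>v1\<close>. In a new SET component none
  of \<open>v1\<close>, \<open>v2\<close>, \<open>v3\<close> can lie, as each keeps at most one even
  neighbour; and if \<open>w\<close> lies in it, \<open>v3w\<close> is a bridge.\<close>

lemma gallai_path:
  assumes g: "graph E" and ns: "no_SET_component E" and IH: "gallai_below E" and V: "finite V" "\<Union>E \<subseteq> V" 
    and nobr: "\<And>u v C. \<not> bridge E u v C"
    and dist: "distinct [v1, v2, v3, w]"
    and v2: "nbhd (even_edges E) v2 = {v1, v3}" and v3: "nbhd (even_edges E) v3 = {v2, w}"
    and v1: "card (nbhd (even_edges E) v1) \<le> 2"
  shows "gallai V E"
proof -
  have e: "{v1, v2} \<in> E" "{v3, w} \<in> E" "even_vertex E v1" "even_vertex E v2" "even_vertex E v3" "even_vertex E w"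
    using nbF_D[of v1 E v2] nbF_D[of v3 E v2] nbF_D[of w E v3] v2 v3 by (auto simp: insert_commute)
  let ?E1 = "E - {{v3, w}}"
  let ?E = "?E1 - {{v1, v2}}"
  have e1: "{v1, v2} \<in> ?E1" using e dist by (auto simp: doubleton_eq_iff)
  have g1: "graph ?E1" by (rule graph_subset[OF g]) auto
  have g': "graph ?E" by (rule graph_subset[OF g1]) auto
  have ev1: "even_vertex ?E1 v \<longleftrightarrow> v \<noteq> v3 \<and> v \<noteq> w \<and> even_vertex E v" for v using odd_removed[OF g e(2), of v] e by auto
  have evE: "even_vertex ?E v \<longleftrightarrow> v \<notin> {v1, v2, v3, w} \<and> even_vertex E v" for v
    using odd_removed[OF g1 e1, of v] ev1 e dist by auto
  show ?thesis
  proof (rule gallai_reduce[OF IH _ _ _ V])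
    show "?E \<subset> E" using e by blast
    show "even_edges ?E \<subseteq> even_edges E" by (rule even_edges_mono) (use evE in auto)
    show "no_SET_component ?E" unfolding no_SET_component_def
    proof safe
      fix C T assume sp: "SET_component ?E C T"
      have Tev: "even_vertex ?E t" if "t \<in> T" for t using sp that by (auto simp: SET_component_def)
      have sub: "nbhd ?E x \<inter> T \<subseteq> nbhd (even_edges E) x - {v1, v2, v3, w}" if "even_vertex E x" for x
        using Tev evE nbhd_mono[of ?E E x] that by (auto intro!: nbF_I)
      have fin: "finite (nbhd (even_edges E) x)" for x by (rule finite_nbhd[OF graph_even_edges[OF g]])
      have c2: "card (nbhd ?E x \<inter> T) \<ge> 2" if "x \<in> C" for x using SET_component_nbhd[OF sp that] .
      have not: "v2 \<notin> C" "v3 \<notin> C" using c2 sub[of v2] sub[of v3] e v2 v3 by force+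
      have "v1 \<notin> C"
      proof
        assume "v1 \<in> C"
        have "v2 \<in> nbhd (even_edges E) v1" using v2 nbhd_sym[of v1 _ v2] by auto
        then have "card (nbhd (even_edges E) v1 - {v2}) \<le> 1" using v1 fin by simp
        moreover have "card (nbhd ?E v1 \<inter> T) \<le> card (nbhd (even_edges E) v1 - {v2})"
          using sub[OF e(3)] fin by (intro card_mono) auto
        ultimately show False using c2[OF \<open>v1 \<in> C\<close>] by linarith
      qed
      obtain d where d: "d \<in> E - ?E" "d \<inter> C \<noteq> {}" using SET_component_touch[OF ns sp] by blast
      then have "w \<in> C" using not \<open>v1 \<notin> C\<close> by auto
      moreover have "closed_in (E - {{w, v3}}) C"
        using sp not \<open>v1 \<notin> C\<close> unfolding SET_component_def closed_in_def by (auto simp: insert_commute)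
      ultimately have "bridge E w v3 C" using e not by (auto simp: bridge_def insert_commute)
      then show False using nobr by blast
    qed
    fix f assume f: "realizable ?E f"
    have pos: "f v \<ge> 1" if "v \<in> {v1, v2, v3, w}" for v
      using realizable_odd_pos[OF g' f, of v] evE[of v] that by blast
    have e1': "{v2, v1} \<in> ?E1" using e1 by (simp add: insert_commute)
    have f': "realizable (?E1 - {{v2, v1}}) f" using f by (simp add: insert_commute)
    have "v = v1" if "v \<in> nbhd ?E1 v2" "f v = 0" for v
    proof -
      have "even_vertex ?E v" using zero_even[OF g' f] that by blast
      then have "v \<in> nbhd (even_edges E) v2" using that nbhd_mono[of ?E1 E v2] evE e by (intro nbF_I) auto
      then show ?thesis using v2 that pos[of v3] by auto
    qed
    then have "{v \<in> nbhd ?E1 v2 - {v1}. f v = 0} = {}" by blast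
    then have "card {v \<in> nbhd ?E1 v2 - {v1}. f v = 0} < f v1" using pos[of v1] by (simp only: card.empty) auto
    then have r1: "realizable ?E1 (shift v2 v1 f)" by (rule restore_edge[OF g1 e1' f'])
    let ?f = "shift v2 v1 f"
    have p1: "?f v2 \<ge> 1" "?f w \<ge> 1" using pos[of v2] pos[of w] dist by (auto simp: shift_def)
    have "v = w" if "v \<in> nbhd E v3" "?f v = 0" for v
    proof -
      have "even_vertex ?E1 v" using zero_even[OF g1 r1] that by blast
      then have "v \<in> nbhd (even_edges E) v3" using that ev1 e by (intro nbF_I) auto
      then show ?thesis using v3 that p1 by auto
    qed
    then have "{v \<in> nbhd E v3 - {w}. ?f v = 0} = {}" by blast
    then have "card {v \<in> nbhd E v3 - {w}. ?f v = 0} < ?f w" using p1 by (simp only: card.empty)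
    then have r2: "realizable E (shift v3 w ?f)" by (rule restore_edge[OF g e(2) r1])
    have inV: "v1 \<in> V" "v2 \<in> V" "v3 \<in> V" "w \<in> V" using e V by auto
    have "same_total V f ?f" using V inV dist pos[of v1] by (intro same_total_shift) auto
    moreover have "same_total V ?f (shift v3 w ?f)" using V inV dist p1 by (intro same_total_shift) auto
    ultimately show "\<exists>f'. realizable E f' \<and> same_total V f f'" using r2 same_total_trans by blast
  qed
qed

text \<open>Deleting the star at $x$ could turn $T$ into the even triangle of a SET component.\<close>

definition trapped_triangle :: "'a set set \<Rightarrow> 'a \<Rightarrow> 'a \<Rightarrow> 'a set \<Rightarrow> bool" where
  "trapped_triangle F x b T \<longleftrightarrow> b \<in> nbhd F x \<and> clique3 F T \<and> T \<inter> insert x (nbhd F x) = {} \<and>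
     (\<forall>p\<in>T. nbhd F p \<subseteq> T \<union> nbhd F x) \<and> card (nbhd F b \<inter> T) \<ge> 2"

text \<open>Deleting the star makes \<open>x\<close> and its even neighbours odd. Two edges come
  back with pivot \<open>x\<close>, the one to \<open>b3\<close> among them because
  \<open>b3\<close> may have large degree; the last pivot is \<open>b1\<close> or \<open>b2\<close>,
  with at most two even neighbours besides \<open>x\<close>. A new SET component yields a trapped
  triangle. If \<open>b1b2\<close> is an edge, then \<open>b1\<close> and \<open>b2\<close> have at
  most one neighbour in that triangle, so only \<open>b3\<close> can lie in the component and
  \<open>b3x\<close> is a bridge.\<close>

lemma gallai_star:
  assumes g: "graph E" and ns: "no_SET_component E" and IH: "gallai_below E" and V: "finite V" "\<Union>E \<subseteq> V" 
    and nobr: "\<And>u v C. \<not> bridge E u v C"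
    and x: "nbhd (even_edges E) x = {b1, b2, b3}" and dist: "distinct [b1, b2, b3]"
    and deg: "card (nbhd (even_edges E) b1) \<le> 3" "card (nbhd (even_edges E) b2) \<le> 3"
    and cond: "{b1, b2} \<in> even_edges E \<or> (\<forall>b T. \<not> trapped_triangle (even_edges E) x b T)"
  shows "gallai V E"
proof -
  let ?F = "even_edges E"
  define A where "A = {b1, b2, b3}"
  have cA: "card A = 3" using dist by (simp add: A_def)
  have evA: "even_vertex E x" "\<And>b. b \<in> A \<Longrightarrow> even_vertex E b" using nbF_D[of _ E x] x by (auto simp: A_def)
  have AE: "A \<subseteq> nbhd E x" using nbF_D[of _ E x] x by (auto simp: A_def)
  have xA: "x \<notin> A" using AE nbhd_irrefl[OF g] by blast
  let ?E = "E - star x A"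
  have g': "graph ?E" by (rule graph_subset[OF g]) auto
  have evE: "even_vertex ?E v \<longleftrightarrow> v \<noteq> x \<and> v \<notin> A \<and> even_vertex E v" for v
    using ev_star[OF g AE, of v] evA cA by auto
  have none: "v \<notin> nbhd E x" if "even_vertex ?E v" for v using that evE nbF_I[of v E x] x evA(1) A_def by auto
  have finF: "finite (nbhd ?F v)" for v by (rule finite_nbhd[OF graph_even_edges[OF g]])
  have xb: "x \<in> nbhd ?F b" if "b \<in> A" for b using x that nbhd_sym[of x ?F b] by (auto simp: A_def)
  show ?thesis
  proof (rule gallai_reduce[OF IH _ _ _ V])
    have "{x, b1} \<in> E \<inter> star x A" using AE nbhd_edge(2)[of b1 E x] by (auto simp: star_def A_def)
    then show "?E \<subset> E" by blast
    show "even_edges ?E \<subseteq> even_edges E" by (rule even_edges_mono) (use evE in auto)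
    show "no_SET_component ?E" unfolding no_SET_component_def
    proof safe
      fix C T assume sp: "SET_component ?E C T"
      have Tev: "even_vertex ?E t" if "t \<in> T" for t using sp that by (auto simp: SET_component_def)
      have c2: "card (nbhd ?E v \<inter> T) \<ge> 2" if "v \<in> C" for v using SET_component_nbhd[OF sp that] .
      have sub: "nbhd ?E v \<inter> T \<subseteq> nbhd ?F v \<inter> T" if "even_vertex E v" for v
        using Tev evE nbhd_mono[of ?E E v] that by (auto intro!: nbF_I)
      have TA: "T \<inter> insert x A = {}" using Tev evE by blast
      have TC: "T \<subseteq> C" using sp by (simp add: SET_component_def)
      have xC: "x \<notin> C"
      proof
        assume "x \<in> C"
        then have "nbhd ?E x \<inter> T \<noteq> {}" using c2[of x] by auto
        then obtain v where "v \<in> nbhd ?E x" "v \<in> T" by blast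
        then show False using none[OF Tev] nbhd_mono[of ?E E x] by auto
      qed
      obtain d where d: "d \<in> E - ?E" "d \<inter> C \<noteq> {}" using SET_component_touch[OF ns sp] by blast
      then obtain b where b: "b \<in> A" "b \<in> C" using xC by (auto simp: star_def)
      have cT: "card (nbhd ?F b \<inter> T) \<ge> 2" if "b \<in> A" "b \<in> C" for b
      proof -
        have "card (nbhd ?E b \<inter> T) \<le> card (nbhd ?F b \<inter> T)"
          using sub[of b] evA(2)[of b] that finF by (intro card_mono) auto
        then show ?thesis using c2[of b] that by linarith
      qed
      have "trapped_triangle ?F x b T" unfolding trapped_triangle_def
      proof (intro conjI ballI)
        show "b \<in> nbhd ?F x" using b x by (simp add: A_def)
        show "clique3 ?F T" using sp Tev evE unfolding SET_component_def clique3_def even_edges_def by auto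
        show "T \<inter> insert x (nbhd ?F x) = {}" using TA x by (simp add: A_def)
        show "card (nbhd ?F b \<inter> T) \<ge> 2" using cT b by blast
        fix p assume p: "p \<in> T"
        show "nbhd ?F p \<subseteq> T \<union> nbhd ?F x"
        proof
          fix u assume u: "u \<in> nbhd ?F p"
          have "nbhd ?E p = nbhd E p" using TA p xA by (auto simp: nbhd_minus_star)
          then have "{u, p} \<in> ?E" using nbF_D[OF u] nbhd_edge(1)[of u ?E p] by simp
          moreover have "p \<in> {u, p} \<inter> C" using p TC by blast
          moreover have "closed_in ?E C" using sp by (simp add: SET_component_def)
          ultimately have "{u, p} \<subseteq> C" unfolding closed_in_def by (metis empty_iff)
          then have uC: "u \<in> C" by blast
          show "u \<in> T \<union> nbhd ?F x"
          proof (cases "u \<in> T")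
            case False
            then have "\<not> even_vertex ?E u" using uC sp by (auto simp: SET_component_def)
            then have "u \<in> insert x A" using evE nbF_D[OF u] by auto
            then show ?thesis using uC xC x by (auto simp: A_def)
          qed simp
        qed
      qed
      then have b12: "{b1, b2} \<in> ?F" using cond by blast
      have "b' \<notin> C" if b'in: "b' \<in> {b1, b2}" for b'
      proof
        assume b'C: "b' \<in> C"
        obtain b'' where b'': "{b', b''} = {b1, b2}" using b'in by blast
        have "b' \<noteq> b''" using b'' dist by (auto simp: doubleton_eq_iff)
        have "b'' \<in> nbhd ?F b'" using b12 b'' by (simp add: nbhd_def insert_commute)
        moreover have "b'' \<in> A" "b' \<in> A" using b'' unfolding A_def by blast+
        ultimately have "nbhd ?F b' \<inter> T \<subseteq> nbhd ?F b' - {x, b''}" using TA by blast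
        moreover have xb'': "x \<noteq> b''" using \<open>b'' \<in> A\<close> xA by blast
        ultimately have "card (nbhd ?F b' \<inter> T) \<le> card (nbhd ?F b' - {x, b''})" using finF by (intro card_mono) auto
        also have "\<dots> = card (nbhd ?F b') - 2"
          using xb'' xb[OF \<open>b' \<in> A\<close>] \<open>b'' \<in> nbhd ?F b'\<close> \<open>b'' \<in> A\<close> xA by (subst card_Diff_subset) auto
        also have "\<dots> \<le> 1" using deg b'in by auto
        finally show False using cT[OF \<open>b' \<in> A\<close> b'C] by linarith
      qed
      then have only: "C \<inter> A = {b3}" using b by (auto simp: A_def)
      have "closed_in (E - {{b3, x}}) C" unfolding closed_in_def
      proof (intro ballI impI subsetI)
        fix e y assume e': "e \<in> E - {{b3, x}}" "e \<inter> C \<noteq> {}" "y \<in> e"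
        then obtain v where e: "e \<in> E" "e \<noteq> {b3, x}" "v \<in> e" "v \<in> C" "y \<in> e" by auto
        have "e \<in> ?E"
        proof (rule ccontr)
          assume "e \<notin> ?E"
          then obtain b where b: "b \<in> A" "e = {x, b}" using e(1) by (auto simp: star_def)
          then have "v = b" using e(3,4) xC by auto
          then have "b = b3" using b only e(4) by blast
          then show False using b e(2) by (simp add: insert_commute)
        qed
        moreover have "closed_in ?E C" using sp by (simp add: SET_component_def)
        moreover have "e \<inter> C \<noteq> {}" using e by blast
        ultimately have "e \<subseteq> C" unfolding closed_in_def by blast
        then show "y \<in> C" using e(5) by blast
      qed
      moreover have "{b3, x} \<in> E" "even_vertex E b3" using AE evA by (auto simp: A_def nbhd_def)
      ultimately have "bridge E b3 x C" using only xC evA by (auto simp: bridge_def)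
      then show False using nobr by blast
    qed
    fix f assume f: "realizable ?E f"
    have fx: "f x \<ge> 1" using realizable_odd_pos[OF g' f, of x] evE by auto
    have "\<exists>f'. realizable E f' \<and> f' x = f x + card A mod 2 \<and> (\<forall>v. v \<notin> A \<longrightarrow> v \<noteq> x \<longrightarrow> f' v = f v) \<and>
     (\<forall>V. finite V \<longrightarrow> x \<in> V \<longrightarrow> A \<subseteq> V \<longrightarrow> sum f' V = sum f V)"
    proof (rule restore_star[OF g AE _ f, of b3])
      show "b3 \<in> A" by (simp add: A_def)
      show "f v \<ge> 1" if "v \<in> nbhd E x" for v using none[of v] zero_even[OF g' f, of v] that by (cases "f v") auto
      show "1 \<le> f x + card A mod 2" using fx by simp
      show "card {v \<in> nbhd E b - {x}. f v = 0 \<or> v \<in> W} \<le> 2"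
        if W: "W \<subseteq> A" "b3 \<in> W" "card W = (card A + 1) div 2" "b \<in> A - W" for W b
      proof -
        have b: "b \<in> {b1, b2}" "b \<in> A" using W by (auto simp: A_def)
        have "{v \<in> nbhd E b - {x}. f v = 0 \<or> v \<in> W} \<subseteq> nbhd ?F b - {x}"
          using zero_even[OF g' f] evE W evA b by (auto intro!: nbF_I)
        then have "card {v \<in> nbhd E b - {x}. f v = 0 \<or> v \<in> W} \<le> card (nbhd ?F b - {x})"
          using finF by (intro card_mono) auto
        also have "\<dots> = card (nbhd ?F b) - 1" using xb[OF b(2)] by simp
        also have "\<dots> \<le> 2" using deg b by auto
        finally show ?thesis .
      qed
      \<comment> \<open>The tight case does not occur: \<open>card A\<close> is 3 and
        \<open>f x\<close> \<ge> 1, so the sum is at least 2.\<close>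
      show "\<exists>b\<in>A - W. card {v \<in> nbhd E b - {x}. f v = 0 \<or> v \<in> W} \<le> 1" if "f x + card A mod 2 = 1" for W
        using that fx cA by simp
    qed
    then obtain f' where f': "realizable E f'" "\<forall>v. v \<notin> A \<longrightarrow> v \<noteq> x \<longrightarrow> f' v = f v"
      "\<forall>V. finite V \<longrightarrow> x \<in> V \<longrightarrow> A \<subseteq> V \<longrightarrow> sum f' V = sum f V" by blast
    have inV: "x \<in> V" "A \<subseteq> V" using AE V by (auto simp: nbhd_def A_def)
    then have "same_total V f f'" using f' V(1) unfolding same_total_def by blast
    then show "\<exists>f'. realizable E f' \<and> same_total V f f'" using f'(1) by blast
  qed
qed

section \<open>Isolated triangles of even vertices\<close>

lemma same_totalI:
  assumes "finite V" "D \<subseteq> V" "\<forall>v. v \<notin> D \<longrightarrow> f' v = f v" "\<forall>V. finite V \<longrightarrow> D \<subseteq> V \<longrightarrow> sum f' V = sum f V"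
  shows "same_total V f f'"
  unfolding same_total_def
proof (intro conjI allI impI)
  fix v assume "v \<notin> V"
  then show "f' v = f v" using assms(2,3) by auto
qed (use assms in simp)

text \<open>$Y$ is empty or consists of an odd neighbour of $z$ that is added to the deleted star; in the latter case an
  even number of edges is deleted at $z$.\<close>

definition refills :: "'a set set \<Rightarrow> 'a set set \<Rightarrow> 'a \<Rightarrow> 'a set \<Rightarrow> 'a set \<Rightarrow> bool" where
  "refills H X z T Y \<longleftrightarrow> H \<subset> X \<and> (\<forall>e\<in>X - H. e \<subseteq> insert z (T \<union> Y)) \<and>
    (\<forall>v. even_vertex H v \<longleftrightarrow> (even_vertex X v \<noteq> (v \<in> T \<union> Y \<or> Y = {} \<and> v = z))) \<and>
    (\<forall>f. realizable H f \<longrightarrow> f z \<ge> 1 \<longrightarrow> (\<forall>v\<in>T \<union> nbhd X z \<union> (\<Union>y\<in>T. nbhd X y). f v \<ge> 1) \<longrightarrow>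
      (\<exists>f'. realizable X f' \<and> (Y = {} \<longrightarrow> f' z \<ge> 2) \<and> (\<forall>v. v \<notin> insert z (T \<union> Y) \<longrightarrow> f' v = f v) \<and>
        (\<forall>V. finite V \<longrightarrow> insert z (T \<union> Y) \<subseteq> V \<longrightarrow> sum f' V = sum f V)))"

lemma refillsD:
  assumes "refills H X z T Y"
  shows "H \<subset> X" "e \<in> X - H \<Longrightarrow> e \<subseteq> insert z (T \<union> Y)"
    "even_vertex H v \<longleftrightarrow> (even_vertex X v \<noteq> (v \<in> T \<union> Y \<or> Y = {} \<and> v = z))"
    "realizable H f \<Longrightarrow> f z \<ge> 1 \<Longrightarrow> \<forall>v\<in>T \<union> nbhd X z \<union> (\<Union>y\<in>T. nbhd X y). f v \<ge> 1 \<Longrightarrow>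
      \<exists>f'. realizable X f' \<and> (Y = {} \<longrightarrow> f' z \<ge> 2) \<and> (\<forall>v. v \<notin> insert z (T \<union> Y) \<longrightarrow> f' v = f v) \<and>
        (\<forall>V. finite V \<longrightarrow> insert z (T \<union> Y) \<subseteq> V \<longrightarrow> sum f' V = sum f V)"
  using assms unfolding refills_def by simp_all

text \<open>If \<open>z\<close> is adjacent to all of \<open>T\<close>, the edges from
  \<open>z\<close> to \<open>T\<close> are deleted. Otherwise \<open>z\<close> is adjacent to just
  two vertices \<open>a\<close> and \<open>b\<close> of \<open>T\<close>, and \<open>za\<close> is
  deleted together with the opposite edge \<open>bc\<close>. Either way each vertex of
  \<open>T\<close> loses one edge and \<open>z\<close> loses an odd number of edges to
  \<open>T\<close>; an edge to \<open>Y\<close> makes this number even.\<close>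

lemma refill:
  assumes g: "graph X" and T: "clique3 X T" and z: "z \<notin> T" "card (nbhd X z \<inter> T) \<ge> 2"
    and Y: "Y \<subseteq> nbhd X z - T" "card Y \<le> 1" "\<And>y. y \<in> T \<Longrightarrow> nbhd X y \<inter> Y = {}"
  shows "\<exists>H. refills H X z T Y"
proof -
  have finT: "finite T" "card T = 3" using T by (auto simp: clique3_def intro: card_ge_0_finite)
  have finX: "finite (nbhd X v)" for v by (rule finite_nbhd[OF g])
  have zY: "z \<notin> Y" using Y nbhd_irrefl[OF g] by blast
  have finY: "finite Y" using Y finX by (meson Diff_subset finite_subset)
  have Yc: "Y = {} \<or> (\<exists>w. Y = {w})" using Y(2) finY by (metis card_0_eq card_1_singletonE le_neq_implies_less less_one)
  show ?thesis
  proof (cases "T \<subseteq> nbhd X z")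
    case True
    define A where "A = T \<union> Y"
    have AX: "A \<subseteq> nbhd X z" using True Y by (auto simp: A_def)
    have cA: "card A = 3 + card Y" 
    proof -
      have "T \<inter> Y = {}" using Y(1) by blast
      then show ?thesis using card_Un_disjoint[OF finT(1) finY] finT(2) by (simp add: A_def)
    qed
    let ?H = "X - star z A"
    have "A \<noteq> {}" using finT by (auto simp: A_def)
    have 1: "?H \<subset> X"
    proof -
      obtain y where "y \<in> A" using \<open>A \<noteq> {}\<close> by blast
      then have "{z, y} \<in> X \<inter> star z A" using AX nbhd_edge(2)[of y X z] by (auto simp: star_def)
      then show ?thesis by blast
    qed
    have 2: "\<forall>e\<in>X - ?H. e \<subseteq> insert z (T \<union> Y)" by (auto simp: star_def A_def)
    have 3: "even_vertex ?H v \<longleftrightarrow> (even_vertex X v \<noteq> (v \<in> T \<union> Y \<or> Y = {} \<and> v = z))" for v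
      using ev_star[OF g AX, of v] cA Yc z zY by (auto simp: A_def)
    have 4: "\<exists>f'. realizable X f' \<and> (Y = {} \<longrightarrow> f' z \<ge> 2) \<and> (\<forall>v. v \<notin> insert z (T \<union> Y) \<longrightarrow> f' v = f v) \<and>
        (\<forall>V. finite V \<longrightarrow> insert z (T \<union> Y) \<subseteq> V \<longrightarrow> sum f' V = sum f V)"
      if f: "realizable ?H f" "f z \<ge> 1" and pos: "\<forall>v\<in>T \<union> nbhd X z \<union> (\<Union>y\<in>T. nbhd X y). f v \<ge> 1" for f
    proof -
      \<comment> \<open>If \<open>Y\<close> is nonempty, the edge to its vertex comes back first, so
        that all pivots other than \<open>z\<close> lie in \<open>T\<close>, whose vertices have no
        neighbour in \<open>Y\<close>.\<close>
      obtain x where x: "x \<in> A" "Y \<noteq> {} \<longrightarrow> Y = {x}" using \<open>A \<noteq> {}\<close> Yc by (auto simp: A_def)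
      have zset: "{v \<in> nbhd X b - {z}. f v = 0 \<or> v \<in> W} \<subseteq> W \<inter> T - {b}"
        if W: "W \<subseteq> A" "x \<in> W" "b \<in> A - W" "b \<in> T" for W b
      proof
        fix v assume v: "v \<in> {v \<in> nbhd X b - {z}. f v = 0 \<or> v \<in> W}"
        then have "f v \<ge> 1" using pos that by blast
        then have "v \<in> W" using v by auto
        moreover have "v \<notin> Y" using Y(3)[OF W(4)] v by blast
        ultimately show "v \<in> W \<inter> T - {b}" using W by (auto simp: A_def)
      qed
      have bT: "b \<in> T" if "W \<subseteq> A" "x \<in> W" "b \<in> A - W" for W b using that x(2) by (auto simp: A_def)
      have "\<exists>f'. realizable X f' \<and> f' z = f z + card A mod 2 \<and> (\<forall>v. v \<notin> A \<longrightarrow> v \<noteq> z \<longrightarrow> f' v = f v) \<and>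
         (\<forall>V. finite V \<longrightarrow> z \<in> V \<longrightarrow> A \<subseteq> V \<longrightarrow> sum f' V = sum f V)"
      proof (rule restore_star[OF g AX x(1) f(1)])
        show "f v \<ge> 1" if "v \<in> nbhd X z" for v using pos that by blast
        show "1 \<le> f z + card A mod 2" using f by simp
        show "card {v \<in> nbhd X b - {z}. f v = 0 \<or> v \<in> W} \<le> 2"
          if W: "W \<subseteq> A" "x \<in> W" "card W = (card A + 1) div 2" "b \<in> A - W" for W b
        proof -
          have "card {v \<in> nbhd X b - {z}. f v = 0 \<or> v \<in> W} \<le> card (T - {b})"
            using zset[OF W(1,2,4) bT[OF W(1,2,4)]] finT by (intro card_mono) auto
          then show ?thesis using bT[OF W(1,2,4)] finT by simp
        qed
        show "\<exists>b\<in>A - W. card {v \<in> nbhd X b - {z}. f v = 0 \<or> v \<in> W} \<le> 1"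
          if W: "W \<subseteq> A" "x \<in> W" "card W = (card A + 1) div 2" "W \<noteq> A" and t: "f z + card A mod 2 = 1" for W
        proof -
          \<comment> \<open>Here \<open>f z\<close> is 1 and the star is even, so it has four edges
            and \<open>W\<close> has two vertices. One of them is in \<open>Y\<close>, hence at most
            one vertex of \<open>W\<close> can block a pivot in \<open>T\<close>.\<close>
          have "even (card A)" using t f(2) by presburger
          then have Yx: "Y = {x}" using cA x(2) by (cases "Y = {}") auto
          then have cA4: "card A = 4" using cA by simp
          obtain b where b: "b \<in> A - W" using W by blast
          have "W \<inter> T \<subseteq> W - {x}" using Yx Y(1) by auto
          then have "card (W \<inter> T) \<le> card (W - {x})" using W(1) finT finY by (intro card_mono) (auto simp: A_def intro: finite_subset)
          also have "\<dots> = 1" using W cA4 by simp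
          finally have "card (W \<inter> T) \<le> 1" .
          moreover have "card {v \<in> nbhd X b - {z}. f v = 0 \<or> v \<in> W} \<le> card (W \<inter> T)"
            using zset[OF W(1,2) b bT[OF W(1,2) b]] finT by (intro card_mono) auto
          ultimately show ?thesis using b by (intro bexI[of _ b]) auto
        qed
      qed
      then obtain f' where f': "realizable X f'" "f' z = f z + card A mod 2" "\<forall>v. v \<notin> A \<longrightarrow> v \<noteq> z \<longrightarrow> f' v = f v"
         "\<forall>V. finite V \<longrightarrow> z \<in> V \<longrightarrow> A \<subseteq> V \<longrightarrow> sum f' V = sum f V" by blast
      have "Y = {} \<longrightarrow> f' z \<ge> 2" using f'(2) cA f(2) by auto
      then show ?thesis using f' unfolding A_def by (intro exI[of _ f']) auto
    qed
    have "refills ?H X z T Y"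
      unfolding refills_def by (intro conjI 1 2 allI 3 impI; rule 4; assumption)
    then show ?thesis by blast
  next
    case False
    obtain c where c: "c \<in> T" "c \<notin> nbhd X z" using False by blast
    have cT: "card (T - {c}) = 2" using c finT by simp
    have "nbhd X z \<inter> T \<subseteq> T - {c}" using c by blast
    then have eq: "nbhd X z \<inter> T = T - {c}" using cT z(2) finT card_mono[of "T - {c}" "nbhd X z \<inter> T"] by (intro card_subset_eq) auto
    obtain a b where ab: "T - {c} = {a, b}" "a \<noteq> b" using cT by (meson card_2_iff)
    have Tabc: "T = {a, b, c}" using ab c by blast
    have ca: "c \<noteq> a" "c \<noteq> b" using ab by auto
    have abz: "a \<in> nbhd X z" "b \<in> nbhd X z" using eq ab by auto
    define A where "A = insert a Y"
    have aY: "a \<notin> Y" "b \<notin> Y" "c \<notin> Y" using Y Tabc by auto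
    have AX: "A \<subseteq> nbhd X z" using abz Y by (auto simp: A_def)
    have cA: "card A = 1 + card Y" using finY aY by (simp add: A_def)
    have bA: "b \<notin> A" "c \<notin> A" "z \<notin> A" using ab ca aY zY z Tabc by (auto simp: A_def)
    have zne: "z \<noteq> a" "z \<noteq> b" "z \<noteq> c" using z Tabc by auto
    let ?X = "X - star z A"
    let ?H = "?X - {{b, c}}"
    have bcX: "{b, c} \<in> X" using T Tabc ca by (auto simp: clique3_def)
    have bc: "{b, c} \<in> ?X" using bcX zne by (auto simp: star_def doubleton_eq_iff)
    have gX: "graph ?X" by (rule graph_subset[OF g]) auto
    have gH: "graph ?H" by (rule graph_subset[OF gX]) auto
    have 1: "?H \<subset> X" using bcX by blast
    have 2: "\<forall>e\<in>X - ?H. e \<subseteq> insert z (T \<union> Y)" using Tabc by (auto simp: star_def A_def)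
    have evX: "even_vertex ?X v \<longleftrightarrow> (even_vertex X v \<noteq> (v \<in> insert a Y \<or> Y = {} \<and> v = z))" for v
      using ev_star[OF g AX, of v] cA Yc zne zY by (auto simp: A_def)
    have 3: "even_vertex ?H v \<longleftrightarrow> (even_vertex X v \<noteq> (v \<in> T \<union> Y \<or> Y = {} \<and> v = z))" for v
      using odd_removed[OF gX bc, of v] evX[of v] Tabc aY zne ca ab by auto
    have 4: "\<exists>f'. realizable X f' \<and> (Y = {} \<longrightarrow> f' z \<ge> 2) \<and> (\<forall>v. v \<notin> insert z (T \<union> Y) \<longrightarrow> f' v = f v) \<and>
        (\<forall>V. finite V \<longrightarrow> insert z (T \<union> Y) \<subseteq> V \<longrightarrow> sum f' V = sum f V)"
      if f: "realizable ?H f" "f z \<ge> 1" and pos: "\<forall>v\<in>T \<union> nbhd X z \<union> (\<Union>y\<in>T. nbhd X y). f v \<ge> 1" for f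
    proof -
      have bT: "b \<in> T" "c \<in> T" "a \<in> T" using Tabc by auto
      have posT: "f v \<ge> 1" if "v \<in> T" for v using pos that by blast
      \<comment> \<open>\<open>bc\<close> comes back before the star, with pivot \<open>b\<close>:
        the end is spent at \<open>c\<close>, which is not adjacent to \<open>z\<close>, so all
        neighbours of \<open>z\<close> still carry ends afterwards.\<close>
      have "f v \<noteq> 0" if "v \<in> nbhd ?X b" for v using pos that nbhd_mono[of ?X X b] bT by (metis Diff_subset UN_I UnI2 not_one_le_zero subsetD)
      then have "{v \<in> nbhd ?X b - {c}. f v = 0} = {}" by blast
      then have "card {v \<in> nbhd ?X b - {c}. f v = 0} < f c" using posT[OF bT(2)] by (simp only: card.empty)
      then have r1: "realizable ?X (shift b c f)" by (rule restore_edge[OF gX bc f(1)])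
      let ?g = "shift b c f"
      have gpos: "?g v \<ge> 1" if "v \<noteq> c" "f v \<ge> 1" for v using that by (auto simp: shift_def)
      obtain x where x: "x \<in> A" "A = {a, x}" "Y \<noteq> {} \<longrightarrow> Y = {x}" using Yc by (auto simp: A_def)
      \<comment> \<open>At most one edge is left for a pivot other than \<open>z\<close>, namely
        \<open>za\<close> with pivot \<open>a\<close>, and only \<open>c\<close> can then be without
        ends.\<close>
      have key: "A - W = {a} \<and> card {v \<in> nbhd X a - {z}. ?g v = 0 \<or> v \<in> W} \<le> 1"
        if W: "W \<subseteq> A" "x \<in> W" "d \<in> A - W" for W d
      proof -
        have xa: "x \<noteq> a" "A - W = {a}" using W x by auto
        then have Yx: "Y = {x}" using x A_def by auto
        have "{v \<in> nbhd X a - {z}. ?g v = 0 \<or> v \<in> W} \<subseteq> {c}"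
        proof
          fix v assume v: "v \<in> {v \<in> nbhd X a - {z}. ?g v = 0 \<or> v \<in> W}"
          have "v \<noteq> x" using Y(3)[OF bT(3)] v Yx by auto
          then have "v \<notin> W" using W xa x by auto
          then have "?g v = 0" using v by auto
          moreover have "f v \<ge> 1" using pos v bT by blast
          ultimately show "v \<in> {c}" using gpos[of v] by auto
        qed
        then have "card {v \<in> nbhd X a - {z}. ?g v = 0 \<or> v \<in> W} \<le> card {c}" by (intro card_mono) auto
        then show ?thesis using xa by simp
      qed
      have "\<exists>f'. realizable X f' \<and> f' z = ?g z + card A mod 2 \<and> (\<forall>v. v \<notin> A \<longrightarrow> v \<noteq> z \<longrightarrow> f' v = ?g v) \<and>
         (\<forall>V. finite V \<longrightarrow> z \<in> V \<longrightarrow> A \<subseteq> V \<longrightarrow> sum f' V = sum ?g V)"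
      proof (rule restore_star[OF g AX x(1) r1])
        show "?g v \<ge> 1" if "v \<in> nbhd X z" for v using pos that c gpos[of v] by blast
        show "1 \<le> ?g z + card A mod 2" using gpos[of z] f zne by simp
        show "card {v \<in> nbhd X d - {z}. ?g v = 0 \<or> v \<in> W} \<le> 2"
          if W: "W \<subseteq> A" "x \<in> W" "card W = (card A + 1) div 2" "d \<in> A - W" for W d
          using key[OF W(1,2,4)] W(4) by auto
        show "\<exists>d\<in>A - W. card {v \<in> nbhd X d - {z}. ?g v = 0 \<or> v \<in> W} \<le> 1"
          if W: "W \<subseteq> A" "x \<in> W" "card W = (card A + 1) div 2" "W \<noteq> A" for W
        proof -
          obtain d where "d \<in> A - W" using W by blast
          then show ?thesis using key[OF W(1,2)] by blast
        qed
      qed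
      then obtain f' where f': "realizable X f'" "f' z = ?g z + card A mod 2" "\<forall>v. v \<notin> A \<longrightarrow> v \<noteq> z \<longrightarrow> f' v = ?g v"
         "\<forall>V. finite V \<longrightarrow> z \<in> V \<longrightarrow> A \<subseteq> V \<longrightarrow> sum f' V = sum ?g V" by blast
      have "Y = {} \<longrightarrow> f' z \<ge> 2" using f'(2) cA gpos[of z] f zne by auto
      moreover have "f' v = f v" if "v \<notin> insert z (T \<union> Y)" for v
        using f'(3) that bT by (auto simp: A_def shift_def)
      moreover have "sum f' V = sum f V" if "finite V" "insert z (T \<union> Y) \<subseteq> V" for V
      proof -
        have "sum f' V = sum ?g V" using f'(4) that bT by (auto simp: A_def)
        also have "\<dots> = sum f V" using that bT ca posT[of c] by (intro shift_sum) auto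
        finally show ?thesis .
      qed
      ultimately show ?thesis using f'(1) by (intro exI[of _ f']) blast
    qed
    have "refills ?H X z T Y"
      unfolding refills_def by (intro conjI 1 2 allI 3 impI; rule 4; assumption)
    then show ?thesis by blast
  qed
qed

section \<open>Even subgraphs made of isolated vertices and triangles\<close>

locale triangles =
  fixes E :: "'a set set" and V :: "'a set"
  assumes g: "graph E" and ns: "no_SET_component E" and IH: "gallai_below E" and V: "finite V" "\<Union>E \<subseteq> V"
    and tri: "\<And>v. nbhd (even_edges E) v = {} \<or> (\<exists>a b. a \<noteq> b \<and> nbhd (even_edges E) v = {a, b} \<and>
       nbhd (even_edges E) a = {v, b} \<and> nbhd (even_edges E) b = {v, a})"
begin

text \<open>For even \<open>v\<close> this is, by \<open>tri\<close>, the component of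
  \<open>v\<close> in the even subgraph, a vertex or a triangle. An odd vertex forms a class of its
  own, so the classes partition all vertices.\<close>

definition even_class :: "'a \<Rightarrow> 'a set" where "even_class v = insert v (nbhd (even_edges E) v)"

definition even_nbhd :: "'a \<Rightarrow> 'a set" where "even_nbhd z = {u \<in> nbhd E z. even_vertex E u}"

lemma finB: "finite (even_nbhd z)" using finite_nbhd[OF g] by (simp add: even_nbhd_def)

lemma gF: "graph (even_edges E)" by (rule graph_even_edges[OF g])

lemma even_class_eq: "u \<in> even_class v \<Longrightarrow> even_class u = even_class v"
  using tri[of v] by (auto simp: even_class_def)

lemma even_class_self: "v \<in> even_class v" by (simp add: even_class_def)

lemma even_class_disj: "even_class u \<inter> even_class v \<noteq> {} \<Longrightarrow> even_class u = even_class v"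
  using even_class_eq by blast

lemma nbF: "nbhd (even_edges E) v = even_class v - {v}"
  using nbhd_irrefl[OF gF] by (auto simp: even_class_def)

lemma even_class_card: "card (even_class v) = 1 \<or> card (even_class v) = 3" "finite (even_class v)"
proof -
  have "v \<notin> nbhd (even_edges E) v" by (rule nbhd_irrefl[OF gF])
  then show "card (even_class v) = 1 \<or> card (even_class v) = 3" "finite (even_class v)" using tri[of v] by (auto simp: even_class_def)
qed

lemma even_class_ev: "even_vertex E v \<Longrightarrow> u \<in> even_class v \<Longrightarrow> even_vertex E u"
  using nbF_D[of u E v] by (auto simp: even_class_def)

lemma even_nbhd_in_class: "even_vertex E v \<Longrightarrow> even_vertex E u \<Longrightarrow> u \<in> nbhd E v \<Longrightarrow> u \<in> even_class v - {v}"
  using nbF_I[of u E v] nbF by blast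

lemma even_class_clique: "card (even_class v) = 3 \<Longrightarrow> clique3 E (even_class v)"
  unfolding clique3_def
proof (intro conjI ballI impI)
  fix x y assume xy: "x \<in> even_class v" "y \<in> even_class v" "x \<noteq> y"
  then have "x \<in> even_class y - {y}" using even_class_eq by blast
  then show "{x, y} \<in> E" using nbF_D[of x E y] nbF by blast
qed

lemma even_class_V:
  assumes "t \<in> even_class r" "card (even_class r) = 3" shows "t \<in> V"
proof -
  have "clique3 E (even_class t)" using even_class_clique[of t] even_class_eq[OF assms(1)] assms(2) by simp
  then have "card (nbhd E t \<inter> even_class t) \<ge> 2" using clique3_nbhd[of E "even_class t" t] even_class_self by blast
  then have "nbhd E t \<inter> even_class t \<noteq> {}" by (intro notI) simp
  then obtain s where "s \<in> nbhd E t" by blast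
  then show ?thesis using V(2) by (auto simp: nbhd_def)
qed

lemma clique_even_class:
  assumes "clique3 E T" "\<And>t. t \<in> T \<Longrightarrow> even_vertex E t" "t \<in> T"
  shows "T = even_class t"
proof -
  have sub: "T \<subseteq> even_class t"
  proof
    fix s assume "s \<in> T"
    then show "s \<in> even_class t" using assms even_nbhd_in_class[of t s] even_class_self by (cases "s = t") (auto simp: clique3_def nbhd_def)
  qed
  then have "card (even_class t) = 3" using even_class_card[of t] assms(1) card_mono[OF even_class_card(2) sub] by (auto simp: clique3_def)
  then show ?thesis using sub assms(1) even_class_card(2) by (intro card_subset_eq) (auto simp: clique3_def)
qed

text \<open>A new SET component meets a deleted edge in a vertex of \<open>D\<close>, and every
  vertex of a SET component has neighbours in the even triangle.\<close>

lemma no_SET_component_removed: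
  assumes sub: "H \<subseteq> E" and D: "\<And>e. e \<in> E - H \<Longrightarrow> e \<subseteq> D"
    and loss: "\<And>v u. v \<in> D \<Longrightarrow> u \<in> nbhd H v \<Longrightarrow> even_vertex H u \<Longrightarrow> False"
  shows "no_SET_component H"
  unfolding no_SET_component_def
proof safe
  fix C T assume sp: "SET_component H C T"
  obtain d where "d \<in> E - H" "d \<inter> C \<noteq> {}" using SET_component_touch[OF ns sp sub] by blast
  then obtain y where y: "y \<in> D" "y \<in> C" using D by blast
  have "nbhd H y \<inter> T \<noteq> {}" using SET_component_nbhd[OF sp y(2)] by auto
  then obtain t where "t \<in> nbhd H y" "t \<in> T" by blast
  then show False using loss[OF y(1)] sp by (auto simp: SET_component_def)
qed

text \<open>If \<open>w\<close> has no even neighbours, \<open>zw\<close> is deleted on top of the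
  deletion from \<open>refill\<close> at \<open>z\<close>; this makes \<open>w\<close> even, but it
  has no even neighbours. Otherwise \<open>w\<close> sees a triangle \<open>U\<close> of its own:
  \<open>refill\<close> at \<open>z\<close> takes \<open>zw\<close> along as the edge to
  \<open>Y\<close>, and a second \<open>refill\<close> at \<open>w\<close> makes \<open>w\<close>
  odd again. In both cases no end of a deleted edge keeps an even neighbour, so no SET component
  arises.\<close>

lemma gallai_odd_edge:
  assumes z: "\<not> even_vertex E z" and w: "\<not> even_vertex E w" and zw: "{z, w} \<in> E"
    and Bz: "even_nbhd z \<subseteq> even_class p" "card (even_nbhd z) \<ge> 2" and Bw: "even_nbhd w \<inter> even_class p = {}"
    and Bw': "even_nbhd w = {} \<or> (\<exists>q. even_nbhd w \<subseteq> even_class q \<and> card (even_nbhd w) \<ge> 2)"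
  shows "gallai V E"
proof -
  let ?T = "even_class p"
  have c2: "card ?T \<ge> 2" using Bz card_mono[OF even_class_card(2) Bz(1)] by linarith
  then have cT: "card ?T = 3" using even_class_card(1)[of p] by auto
  have ne: "z \<noteq> w" using zw g graph_not_self by metis
  have "even_nbhd z \<noteq> {}" using Bz(2) by (intro notI) simp
  then obtain y where y: "y \<in> even_nbhd z" by blast
  then have "even_class y = ?T" using Bz(1) even_class_eq by blast
  have evT: "even_vertex E t" if "t \<in> ?T" for t using that even_class_ev[of y t] y \<open>even_class y = ?T\<close> by (auto simp: even_nbhd_def)
  have nbT: "v \<in> ?T" if "t \<in> ?T" "v \<in> nbhd E t" "even_vertex E v" for t v
    using even_nbhd_in_class[of t v] evT that even_class_eq by blast
  have nbz: "v \<in> ?T" if "v \<in> nbhd E z" "even_vertex E v" for v using that Bz by (auto simp: even_nbhd_def)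
  have zT: "z \<notin> ?T" "w \<notin> ?T" using evT z w by blast+
  have wT: "w \<notin> nbhd E t" if "t \<in> ?T" for t using Bw evT[OF that] that nbhd_sym[of w E t] by (auto simp: even_nbhd_def)
  have BzT: "nbhd E z \<inter> ?T = even_nbhd z" using Bz evT by (auto simp: even_nbhd_def)
  show ?thesis
  proof (cases "even_nbhd w = {}")
    case True
    have nbw: "\<not> even_vertex E v" if "v \<in> nbhd E w" for v using True that by (auto simp: even_nbhd_def)
    let ?X = "E - {{z, w}}"
    have gX: "graph ?X" by (rule graph_subset[OF g]) auto
    have evX: "even_vertex ?X v \<longleftrightarrow> v = z \<or> v = w \<or> even_vertex E v" for v using odd_removed[OF g zw, of v] z w by auto
    have TX: "clique3 ?X ?T" using even_class_clique[OF cT] zT by (auto simp: clique3_def doubleton_eq_iff)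
    have nbX: "nbhd ?X z \<inter> ?T = even_nbhd z" using BzT ne zT by (auto simp: nbhd_remove)
    have "\<exists>H. refills H ?X z ?T {}"
      by (rule refill[OF gX TX zT(1)]) (use nbX Bz in auto)
    then obtain H where RH: "refills H ?X z ?T {}" by blast
    note H = refillsD[OF RH, unfolded Un_empty_right simp_thms]
    have evH: "even_vertex H v \<longleftrightarrow> v = w \<or> v \<notin> ?T \<and> v \<noteq> z \<and> even_vertex E v" for v
      using H(3)[of v] evX[of v] evT zT z w ne by auto
    have HE: "H \<subseteq> E" using H by blast
    have gH: "graph H" by (rule graph_subset[OF g HE])
    have loss: False if "v \<in> insert z (insert w ?T)" "u \<in> nbhd H v" "even_vertex H u" for v u
    proof -
      have u: "u \<in> nbhd E v" using that nbhd_mono[OF HE] by blast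
      have "\<not> (v = z \<and> u = w)" using that(2) H(1) by (auto simp: nbhd_def insert_commute)
      then show False using that u evH[of u] nbz nbw nbT wT w nbhd_irrefl[OF g] by blast
    qed
    show ?thesis
    proof (rule gallai_reduce[OF IH _ _ _ V])
      show "H \<subset> E" using H by blast
      show "even_edges H \<subseteq> even_edges E"
      proof
        fix e assume e: "e \<in> even_edges H"
        then have eH: "e \<in> H" "\<forall>v\<in>e. even_vertex H v" by (auto simp: even_edges_def)
        then obtain p q where pq: "e = {p, q}" using graph_edgeE[OF gH] by metis
        have "p \<noteq> w" "q \<noteq> w" using loss[of w q] loss[of w p] eH pq by (auto simp: nbhd_def insert_commute)
        then show "e \<in> even_edges E" using eH pq evH HE by (auto simp: even_edges_def)
      qed
      show "no_SET_component H"
      proof (rule no_SET_component_removed[OF HE, of "insert z (insert w ?T)"])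
        show "e \<subseteq> insert z (insert w ?T)" if "e \<in> E - H" for e using H(2)[of e] that by blast
      qed (use loss in blast)
      fix f assume f: "realizable H f"
      have odd: "f v \<ge> 1" if "\<not> even_vertex H v" for v using realizable_odd_pos[OF gH f that] .
      have "\<not> even_vertex H z" using evH ne z by auto
      moreover have "\<forall>v\<in>?T \<union> nbhd ?X z \<union> (\<Union>y\<in>?T. nbhd ?X y). f v \<ge> 1"
      proof
        fix v assume v: "v \<in> ?T \<union> nbhd ?X z \<union> (\<Union>y\<in>?T. nbhd ?X y)"
        have "\<not> even_vertex H v"
        proof (cases "v \<in> ?T")
          case True then show ?thesis using evH[of v] zT by auto
        next
          case False
          then consider "v \<in> nbhd ?X z" | t where "t \<in> ?T" "v \<in> nbhd ?X t" using v by blast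
          then show ?thesis
          proof cases
            case 1
            then have "v \<in> nbhd E z" "v \<noteq> w" using ne by (auto simp: nbhd_remove split: if_splits)
            then show ?thesis using evH[of v] nbz False by blast
          next
            case 2
            then have "v \<in> nbhd E t" using nbhd_mono[of ?X E t] by blast
            then show ?thesis using evH[of v] nbT[of t v] wT[of t] 2 False by blast
          qed
        qed
        then show "f v \<ge> 1" by (rule odd)
      qed
      \<comment> \<open>In \<open>?X\<close> the vertex \<open>z\<close> is even, so parity alone
        would not give it an end; the clause \<open>f' z\<close> \<ge> 2 of \<open>refills\<close>
        provides the one that is spent on \<open>zw\<close>.\<close>
      ultimately obtain f' where f': "realizable ?X f'" "f' z \<ge> 2" "\<forall>v. v \<notin> insert z ?T \<longrightarrow> f' v = f v"
        "\<forall>V. finite V \<longrightarrow> insert z ?T \<subseteq> V \<longrightarrow> sum f' V = sum f V"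
        using H(4)[OF f] odd[of z] by blast
      have wz: "{w, z} \<in> E" using zw by (simp add: insert_commute)
      have "f' v \<noteq> 0" if "v \<in> nbhd E w - {z}" for v
      proof -
        have "v \<notin> ?T" using that nbw evT by blast
        moreover have "\<not> even_vertex H v" using evH[of v] that nbw nbhd_irrefl[OF g] by blast
        ultimately show ?thesis using f'(3) that odd[of v] by fastforce
      qed
      then have "{v \<in> nbhd E w - {z}. f' v = 0} = {}" by blast
      then have "card {v \<in> nbhd E w - {z}. f' v = 0} < f' z" using f'(2) by (simp only: card.empty)
      moreover have "realizable (E - {{w, z}}) f'" using f'(1) by (simp add: insert_commute)
      ultimately have "realizable E (shift w z f')" using restore_edge[OF g wz] by blast
      moreover have "same_total V f f'"
      proof -
        have "z \<in> V" using zw V by blast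
        moreover have "?T \<subseteq> V" using even_class_V[OF _ cT] by blast
        ultimately have "insert z ?T \<subseteq> V" by blast
        then show ?thesis by (rule same_totalI[OF V(1) _ f'(3,4)])
      qed
      moreover have "same_total V f' (shift w z f')" using V zw ne f'(2) by (intro same_total_shift) auto
      ultimately show "\<exists>f'. realizable E f' \<and> same_total V f f'" using same_total_trans by blast
    qed
  next
    case False
    then obtain q where q: "even_nbhd w \<subseteq> even_class q" "card (even_nbhd w) \<ge> 2" using Bw' by blast
    let ?U = "even_class q"
    have UT: "?U \<inter> ?T = {}"
    proof (rule ccontr)
      assume "?U \<inter> ?T \<noteq> {}"
      then have "?U = ?T" by (rule even_class_disj)
      then show False using q Bw False by blast
    qed
    have "card ?U \<ge> 2" using q card_mono[OF even_class_card(2) q(1)] by linarith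
    then have cU: "card ?U = 3" using even_class_card(1)[of q] by auto
    obtain y' where y': "y' \<in> even_nbhd w" using False by blast
    then have "even_class y' = ?U" using q(1) even_class_eq by blast
    have evU: "even_vertex E t" if "t \<in> ?U" for t using that even_class_ev[of y' t] y' \<open>even_class y' = ?U\<close> by (auto simp: even_nbhd_def)
    have nbU: "v \<in> ?U" if "t \<in> ?U" "v \<in> nbhd E t" "even_vertex E v" for t v
      using even_nbhd_in_class[of t v] evU that even_class_eq by blast
    have nbw: "v \<in> ?U" if "v \<in> nbhd E w" "even_vertex E v" for v using that q by (auto simp: even_nbhd_def)
    have zU: "z \<notin> ?U" "w \<notin> ?U" using evU z w by blast+
    have zU': "z \<notin> nbhd E t" if "t \<in> ?U" for t using that evU nbz[of t] UT nbhd_sym[of z E t] by blast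
    \<comment> \<open>The deletions are nested: first those at \<open>T\<close> with
      \<open>zw\<close>, then those at \<open>U\<close>. They are undone in the opposite order, so
      \<open>w\<close> has its ends back when the edges at \<open>z\<close> are restored.\<close>
    have "\<exists>H. refills H E z ?T {w}"
      by (rule refill[OF g even_class_clique[OF cT] zT(1)]) (use BzT Bz zw zT wT in \<open>auto simp: nbhd_edge(2)\<close>)
    then obtain H1 where RH1: "refills H1 E z ?T {w}" by blast
    have Tw: "?T \<union> {w} = insert w ?T" by auto
    note H1 = refillsD[OF RH1, unfolded Tw insert_not_empty simp_thms]
    have g1: "graph H1" by (rule graph_subset[OF g]) (use H1 in blast)
    have keep: "e \<in> H1" if "e \<in> E" "t \<in> ?U" "t \<in> e" for e t
      using H1(2)[of e] that UT zU by blast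
    have UX: "clique3 H1 ?U" using even_class_clique[OF cU] keep by (auto simp: clique3_def)
    have nbwU: "nbhd H1 w \<inter> ?U = even_nbhd w"
    proof
      show "nbhd H1 w \<inter> ?U \<subseteq> even_nbhd w" using nbhd_mono[of H1 E w] H1 evU by (auto simp: even_nbhd_def)
      show "even_nbhd w \<subseteq> nbhd H1 w \<inter> ?U"
      proof
        fix t assume t: "t \<in> even_nbhd w"
        then have "t \<in> ?U" "{t, w} \<in> E" using q by (auto simp: even_nbhd_def nbhd_def)
        then show "t \<in> nbhd H1 w \<inter> ?U" using keep[of "{t, w}" t] by (auto simp: nbhd_def)
      qed
    qed
    have "\<exists>H. refills H H1 w ?U {}"
      by (rule refill[OF g1 UX zU(2)]) (use nbwU q in auto)
    then obtain H where RH: "refills H H1 w ?U {}" by blast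
    note H = refillsD[OF RH, unfolded Un_empty_right simp_thms]
    have evH: "even_vertex H v \<longleftrightarrow> v \<notin> ?T \<and> v \<notin> ?U \<and> even_vertex E v" for v
      using H(3)[of v] H1(3)[of v] evT evU UT zT zU w by auto
    have HE: "H \<subseteq> E" using H H1 by blast
    have gH: "graph H" by (rule graph_subset[OF g HE])
    let ?D = "insert z (insert w (?T \<union> ?U))"
    have lossE: "v \<in> ?T \<union> ?U \<or> \<not> even_vertex E v" if "d \<in> ?D" "v \<in> nbhd E d" for d v
      using that nbz nbw nbT nbU by blast
    have DV: "?D \<subseteq> V"
    proof -
      have "t \<in> V" if "t \<in> even_class r" "card (even_class r) = 3" for t r using even_class_V[OF that] .
      moreover have "z \<in> V" "w \<in> V" using zw V by blast+
      ultimately show ?thesis using cT cU by blast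
    qed
    show ?thesis
    proof (rule gallai_reduce[OF IH _ _ _ V])
      show "H \<subset> E" using H H1 by blast
      show "even_edges H \<subseteq> even_edges E" by (rule even_edges_mono[OF HE]) (use evH in blast)
      show "no_SET_component H"
      proof (rule no_SET_component_removed[OF HE, of ?D])
        show "e \<subseteq> ?D" if "e \<in> E - H" for e using H(2)[of e] H1(2)[of e] that by blast
        show False if "v \<in> ?D" "u \<in> nbhd H v" "even_vertex H u" for v u
          using lossE[OF that(1), of u] that(2,3) nbhd_mono[OF HE, of v] evH[of u] by blast
      qed
      fix f assume f: "realizable H f"
      have odd: "f v \<ge> 1" if "\<not> even_vertex H v" for v using realizable_odd_pos[OF gH f that] .
      have pos: "f v \<ge> 1" if "d \<in> ?D" "v = d \<or> v \<in> nbhd E d" for d v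
        using odd[of v] evH[of v] lossE[OF that(1)] that z w by blast
      have "\<forall>v\<in>?U \<union> nbhd H1 w \<union> (\<Union>y\<in>?U. nbhd H1 y). f v \<ge> 1"
        using pos nbhd_mono[of H1 E] H1(1) by blast
      then obtain f1 where f1: "realizable H1 f1" "f1 w \<ge> 2" "\<forall>v. v \<notin> insert w ?U \<longrightarrow> f1 v = f v"
        "\<forall>V. finite V \<longrightarrow> insert w ?U \<subseteq> V \<longrightarrow> sum f1 V = sum f V"
        using H(4)[OF f] pos[of w w] by blast
      have "f1 v \<ge> 1" if v: "v \<in> ?T \<union> nbhd E z \<union> (\<Union>y\<in>?T. nbhd E y)" for v
      proof (cases "v = w")
        case False
        have "v \<notin> ?U" using v nbz nbT evU UT by blast
        moreover have "f v \<ge> 1" using pos v by blast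
        ultimately show ?thesis using f1(3) False by auto
      qed (use f1(2) in auto)
      moreover have "f1 z \<ge> 1" using f1(3) ne zU pos[of z z] by auto
      ultimately obtain f' where f': "realizable E f'" "\<forall>v. v \<notin> insert z (insert w ?T) \<longrightarrow> f' v = f1 v"
        "\<forall>V. finite V \<longrightarrow> insert z (insert w ?T) \<subseteq> V \<longrightarrow> sum f' V = sum f1 V"
        using H1(4)[OF f1(1)] by blast
      have "same_total V f f1" by (rule same_totalI[OF V(1) _ f1(3,4)]) (use DV in blast)
      moreover have "same_total V f1 f'" by (rule same_totalI[OF V(1) _ f'(2,3)]) (use DV in blast)
      ultimately show "\<exists>f'. realizable E f' \<and> same_total V f f'" using f'(1) same_total_trans by blast
    qed
  qed
qed

text \<open>The triangles in \<open>S\<close> are seen by \<open>z\<close> only in part. Deleting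
  the star from \<open>z\<close> to \<open>A\<close> and the edge from \<open>b T\<close> to
  \<open>c T\<close> in each of them makes all even neighbours of \<open>z\<close> and all these
  triangles odd. The edges in the triangles come back first, with pivot \<open>b T\<close> and the
  end spent at \<open>c T\<close>, outside the neighbourhood of \<open>z\<close>; the star follows.
  \<open>P1\<close> prevents \<open>z\<close>, if it has become even, from blocking a pivot
  \<open>b T\<close>, and \<open>P2\<close> serves the tight case of
  \<open>restore_star\<close>.\<close>

lemma gallai_strip_with:
  fixes a b c :: "'a set \<Rightarrow> 'a"
  assumes z: "\<not> even_vertex E z" and Bne: "even_nbhd z \<noteq> {}" and finS: "finite S"
    and S: "\<And>T. T \<in> S \<Longrightarrow> T = {a T, b T, c T} \<and> a T \<noteq> b T \<and> a T \<noteq> c T \<and> b T \<noteq> c T \<and>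
        a T \<in> even_nbhd z \<and> c T \<notin> even_nbhd z \<and> T = even_class (a T)"
    and A: "A = (even_nbhd z - \<Union>S) \<union> a ` S"
    and P1: "\<And>T. odd (card A) \<Longrightarrow> T \<in> S \<Longrightarrow> b T \<notin> even_nbhd z"
    and P2: "\<And>W. W \<subseteq> A \<Longrightarrow> card W = (card A + 1) div 2 \<Longrightarrow> W \<noteq> A \<Longrightarrow>
       \<exists>d\<in>A - W. d \<in> \<Union>S \<or> card {v \<in> even_class d - {d}. v \<in> W \<or> v \<notin> even_nbhd z} \<le> 1"
  shows "gallai V E"
proof -
  have disj: "T = T'" if "T \<in> S" "T' \<in> S" "v \<in> T" "v \<in> T'" for T T' v
    using S[OF that(1)] S[OF that(2)] that(3,4) even_class_eq by metis
  have AB: "A \<subseteq> even_nbhd z" using A S by blast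
  have AN: "A \<subseteq> nbhd E z" using AB by (auto simp: even_nbhd_def)
  have finA: "finite A" using AB finB by (meson finite_subset)
  have BA: "even_nbhd z \<subseteq> A \<union> \<Union>S" using A by blast
  have Ane: "A \<noteq> {}" using Bne A S by blast
  have aT: "a T \<in> T" "b T \<in> T" "c T \<in> T" if "T \<in> S" for T using S[OF that] by blast+
  have Tin: "v = a T \<or> v = b T \<or> v = c T" if "T \<in> S" "v \<in> T" for T v
  proof -
    have eq: "T = {a T, b T, c T}" using S[OF that(1)] by (elim conjE)
    have "v \<in> {a T, b T, c T}" using that(2) by (subst (asm) eq)
    then show ?thesis by simp
  qed
  have evB: "even_vertex E v" if "v \<in> even_nbhd z" for v using that by (simp add: even_nbhd_def)
  have evS: "even_vertex E v" if "T \<in> S" "v \<in> T" for T v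
    using S[OF that(1)] evB even_class_ev[of "a T" v] that(2) by metis
  have zS: "z \<notin> T" if "T \<in> S" for T using evS[OF that] z by blast
  have zA: "z \<notin> A" using AN nbhd_irrefl[OF g] by blast
  have AT: "v = a T" if v: "T \<in> S" "v \<in> T" "v \<in> A" for T v
  proof -
    have "v \<in> a ` S" using A v by blast
    then obtain T' where "T' \<in> S" "v = a T'" by blast
    then show ?thesis using disj[OF v(1), of T' v] v aT by blast
  qed
  define mb where "mb T = {b T, c T}" for T
  have mbT: "mb T \<subseteq> T" if "T \<in> S" for T using aT[OF that] by (auto simp: mb_def)
  have mbA: "v \<notin> A" if "T \<in> S" "v \<in> mb T" for T v
    using AT[OF that(1), of v] mbT[OF that(1)] S[OF that(1)] that(2) unfolding mb_def by auto
  have mbE: "mb T \<in> E" if "T \<in> S" for T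
  proof -
    have "card (even_class (a T)) = 3" using S[OF that] by (metis card_3_iff)
    then have "clique3 E T" using even_class_clique S[OF that] by metis
    then show ?thesis using aT[OF that] S[OF that] unfolding clique3_def mb_def by blast
  qed
  let ?E1 = "E - star z A"
  define EE where "EE D = ?E1 - mb ` D" for D
  have EE0: "EE {} = ?E1" by (simp add: EE_def)
  have gE: "graph (EE D)" for D by (rule graph_subset[OF g]) (auto simp: EE_def)
  have ev1: "even_vertex ?E1 v \<longleftrightarrow> (if v = z then odd (card A) else even_vertex E v \<and> v \<notin> A)" for v
    using ev_star[OF g AN, of v] z AB evB by auto
  have mbin: "mb T \<in> EE D" if "T \<in> S" "D \<subseteq> S" "T \<notin> D" for T D
  proof -
    have "mb T \<noteq> mb T'" if "T' \<in> D" for T'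
    proof
      assume eq: "mb T = mb T'"
      have "b T \<in> mb T" by (simp add: mb_def)
      then have "b T \<in> T'" using mbT[of T'] that \<open>D \<subseteq> S\<close> unfolding eq by blast
      then have "T = T'" using disj[of T T' "b T"] aT[OF \<open>T \<in> S\<close>] \<open>T \<in> S\<close> \<open>D \<subseteq> S\<close> that by blast
      then show False using that \<open>T \<notin> D\<close> by blast
    qed
    moreover have "mb T \<notin> star z A" using zS[OF that(1)] mbT[OF that(1)] by (auto simp: star_def)
    ultimately show ?thesis using mbE[OF that(1)] by (auto simp: EE_def)
  qed
  have evD: "even_vertex (EE D) v \<longleftrightarrow> (if v = z then odd (card A) else even_vertex E v \<and> v \<notin> A \<and> v \<notin> \<Union>(mb ` D))"
    if "finite D" "D \<subseteq> S" for D v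
    using that
  proof (induction D rule: finite_induct)
    case empty
    then show ?case using ev1 by (simp add: EE0)
  next
    case (insert T D)
    have TS: "T \<in> S" "D \<subseteq> S" using insert by auto
    have eq: "EE (insert T D) = EE D - {{b T, c T}}" by (auto simp: EE_def mb_def)
    have "{b T, c T} \<in> EE D" using mbin[OF TS insert(2)] by (simp add: mb_def)
    from odd_removed[OF gE this, of v] 
    have "even_vertex (EE (insert T D)) v \<longleftrightarrow> (if v \<in> mb T then \<not> even_vertex (EE D) v else even_vertex (EE D) v)"
      unfolding eq mb_def by simp
    moreover have "v \<noteq> z \<and> even_vertex E v \<and> v \<notin> A \<and> v \<notin> \<Union>(mb ` D)" if v: "v \<in> mb T"
    proof -
      have "v \<in> T" using v mbT[OF TS(1)] by blast
      moreover have "v \<notin> mb T'" if "T' \<in> D" for T'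
        using disj[OF TS(1), of T' v] mbT[of T'] that TS insert(2) \<open>v \<in> T\<close> by blast
      ultimately show ?thesis using mbA[OF TS(1) v] evS[OF TS(1)] zS[OF TS(1)] by blast
    qed
    ultimately show ?case using insert.IH[OF TS(2)] by auto
  qed
  let ?H = "EE S"
  have evH: "even_vertex ?H v \<longleftrightarrow> (if v = z then odd (card A) else even_vertex E v \<and> v \<notin> A \<and> v \<notin> \<Union>S)" for v
  proof -
    have "v \<in> A \<or> v \<in> \<Union>(mb ` S)" if "T \<in> S" "v \<in> T" for T
    proof -
      have "v = a T \<or> v \<in> mb T" using that S[OF that(1)] unfolding mb_def by blast
      then show ?thesis using A that by blast
    qed
    moreover have "\<Union>(mb ` S) \<subseteq> \<Union>S" using mbT by blast
    ultimately show ?thesis using evD[OF finS order_refl, of v] by auto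
  qed
  have HE: "?H \<subseteq> E" by (auto simp: EE_def)
  have lossz: "\<not> even_vertex ?H u" if "u \<in> nbhd ?H z" for u
  proof
    assume e: "even_vertex ?H u"
    have u: "u \<in> nbhd E z" using that nbhd_mono[OF HE] by blast
    then have "u \<noteq> z" using nbhd_irrefl[OF g] by blast
    then have "even_vertex E u" "u \<notin> A \<union> \<Union>S" using evH[of u] e by auto
    then show False using u BA by (auto simp: even_nbhd_def)
  qed
  define fm where "fm f Q = (\<lambda>v. if v \<in> b ` Q then f v + 1 else if v \<in> c ` Q then f v - 1 else f v)"
    for f :: "'a \<Rightarrow> nat" and Q
  have TV: "T \<subseteq> V" if "T \<in> S" for T
  proof -
    have "card (even_class (a T)) = 3" using S[OF that] by (metis card_3_iff)
    then show ?thesis using even_class_V[of _ "a T"] S[OF that] by blast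
  qed
  have AV: "insert z A \<subseteq> V"
  proof -
    have "v \<in> V \<and> z \<in> V" if "v \<in> A" for v using that AN V(2) by (auto simp: nbhd_def)
    then show ?thesis using Ane by blast
  qed
  show ?thesis
  proof (rule gallai_reduce[OF IH _ _ _ V])
    obtain d where "d \<in> A" using Ane by blast
    then have "{z, d} \<in> E \<inter> star z A" using AN nbhd_edge(2)[of d E z] by (auto simp: star_def)
    then show "?H \<subset> E" by (auto simp: EE_def)
    show "even_edges ?H \<subseteq> even_edges E"
    proof
      fix e assume e: "e \<in> even_edges ?H"
      then have eH: "e \<in> ?H" "\<forall>v\<in>e. even_vertex ?H v" by (auto simp: even_edges_def)
      then obtain p q where pq: "e = {p, q}" using graph_edgeE[OF gE] by metis
      have "p \<noteq> z" "q \<noteq> z" using lossz[of q] lossz[of p] eH pq by (auto simp: nbhd_def insert_commute)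
      then have "even_vertex E p" "even_vertex E q" using eH(2) pq evH[of p] evH[of q] by auto
      then show "e \<in> even_edges E" using eH pq HE by (auto simp: even_edges_def)
    qed
    \<comment> \<open>The triangle of a new SET component is a whole class, disjoint from
      \<open>A\<close> and from the triangles in \<open>S\<close>. The component contains an end
      \<open>y\<close> of a deleted edge other than \<open>z\<close>; being even in \<open>E\<close>
      and adjacent to the triangle, \<open>y\<close> belongs to that class, although it lies in
      \<open>A\<close> or in a triangle of \<open>S\<close>.\<close>
    show "no_SET_component ?H" unfolding no_SET_component_def
    proof safe
      fix C T2 assume sp: "SET_component ?H C T2"
      have T2: "even_vertex ?H t" "clique3 ?H T2" if "t \<in> T2" for t using sp that by (auto simp: SET_component_def)
      have cl: "clique3 ?H T2" using sp by (simp add: SET_component_def)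
      have nbt: "\<exists>s. s \<in> nbhd ?H y \<and> s \<in> T2" if "y \<in> C" for y
      proof -
        have "card (nbhd ?H y \<inter> T2) \<ge> 2" by (rule SET_component_nbhd[OF sp that])
        then have "nbhd ?H y \<inter> T2 \<noteq> {}" by (intro notI) simp
        then show ?thesis by blast
      qed
      have zC: "z \<notin> C" using nbt[of z] lossz T2(1) by blast
      have T2C: "T2 \<subseteq> C" using sp by (simp add: SET_component_def)
      have T2E: "even_vertex E t \<and> t \<notin> A \<union> \<Union>S" if "t \<in> T2" for t
        using evH[of t] T2(1)[OF that] zC T2C that by (auto split: if_splits)
      have "clique3 E T2" using cl HE by (auto simp: clique3_def)
      then have T2t: "T2 = even_class t" if "t \<in> T2" for t using clique_even_class[of T2 t] T2E that by blast
      obtain d where d: "d \<in> E - ?H" "d \<inter> C \<noteq> {}" using SET_component_touch[OF ns sp HE] by blast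
      have "d \<subseteq> insert z (A \<union> \<Union>S)" using d(1) mbT by (auto simp: EE_def star_def)
      then obtain y where y: "y \<in> A \<union> \<Union>S" "y \<in> C" using d(2) zC by blast
      obtain t where t: "t \<in> nbhd ?H y" "t \<in> T2" using nbt[OF y(2)] by blast
      have "even_vertex E y" using y(1) evB AB evS by blast
      moreover have "y \<in> nbhd E t" using t(1) nbhd_mono[OF HE] nbhd_sym[of y E t] by blast
      ultimately have "y \<in> even_class t" using even_nbhd_in_class[of t y] T2E[OF t(2)] by blast
      then show False using T2t[OF t(2)] T2E y(1) by blast
    qed
    fix f assume f: "realizable ?H f"
    have pos: "f v \<ge> 1" if "T \<in> S" "v \<in> T" for T v
    proof -
      have "v \<noteq> z" using zS[OF that(1)] that(2) by blast
      then have "\<not> even_vertex ?H v" using evH[of v] that by auto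
      then show ?thesis by (rule realizable_odd_pos[OF gE f])
    qed
    have inj: "b T \<notin> b ` Q" "b T \<notin> c ` Q" "c T \<notin> b ` Q" "c T \<notin> c ` Q" if T: "T \<in> S" "Q \<subseteq> S" "T \<notin> Q" for T Q
    proof -
      have no: "b T' \<notin> T" "c T' \<notin> T" if "T' \<in> Q" for T'
        using disj[of T T'] aT[of T'] T that by blast+
      show "b T \<notin> b ` Q" using no(1) aT(2)[OF T(1)] by (metis imageE)
      show "b T \<notin> c ` Q" using no(2) aT(2)[OF T(1)] by (metis imageE)
      show "c T \<notin> b ` Q" using no(1) aT(3)[OF T(1)] by (metis imageE)
      show "c T \<notin> c ` Q" using no(2) aT(3)[OF T(1)] by (metis imageE)
    qed
    have stage: "realizable (EE (S - Q)) (fm f Q) \<and> same_total V f (fm f Q)" if "finite Q" "Q \<subseteq> S" for Q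
      using that
    proof (induction Q rule: finite_induct)
      case empty
      then show ?case using f by (simp add: fm_def same_total_def)
    next
      case (insert T Q)
      have TS: "T \<in> S" "Q \<subseteq> S" using insert by auto
      note injT = inj[OF TS insert(2)]
      have IHr: "realizable (EE (S - Q)) (fm f Q)" "same_total V f (fm f Q)" using insert.IH[OF TS(2)] by auto
      let ?X = "EE (S - insert T Q)"
      have eX: "{b T, c T} \<in> ?X" using mbin[OF TS(1), of "S - insert T Q"] by (auto simp: mb_def)
      have eq: "?X - {{b T, c T}} = EE (S - Q)"
        using TS insert(2) by (auto simp: EE_def mb_def)
      \<comment> \<open>A neighbour of \<open>b T\<close> without ends would be even at this stage.
        By \<open>P1\<close> it is not \<open>z\<close>, and in \<open>E\<close> the even neighbours
        of \<open>b T\<close> are only \<open>c T\<close> and \<open>a T\<close>, the latter being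
        in \<open>A\<close> and hence odd now.\<close>
      have "fm f Q v \<noteq> 0" if v: "v \<in> nbhd ?X (b T) - {c T}" for v
      proof
        assume "fm f Q v = 0"
        then have e: "even_vertex (EE (S - Q)) v" using zero_even[OF gE IHr(1)] by blast
        have vE: "v \<in> nbhd E (b T)" using v nbhd_mono[of ?X E "b T"] by (auto simp: EE_def)
        have evb: "even_vertex E (b T)" using evS[OF TS(1)] aT[OF TS(1)] by blast
        have finSQ: "finite (S - Q)" using finS by simp
        show False
        proof (cases "v = z")
          case True
          then have "b T \<in> even_nbhd z" using vE evb nbhd_sym[of v E "b T"] by (auto simp: even_nbhd_def)
          moreover have "odd (card A)" using e evD[OF finSQ, of v] True by simp
          ultimately show False using P1 TS(1) by blast
        next
          case False
          then have even_vertex: "even_vertex E v" "v \<notin> A" using e evD[OF finSQ, of v] by auto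
          have "v \<in> even_class (b T) - {b T}" using even_nbhd_in_class[OF evb even_vertex(1) vE] .
          moreover have "even_class (b T) = T" using S[OF TS(1)] aT[OF TS(1)] even_class_eq by metis
          ultimately have "v = a T" using S[OF TS(1)] v by blast
          then show False using even_vertex A TS by blast
        qed
      qed
      then have "{v \<in> nbhd ?X (b T) - {c T}. fm f Q v = 0} = {}" by blast
      moreover have fc: "fm f Q (c T) \<ge> 1" using pos[OF TS(1) aT(3)[OF TS(1)]] injT by (simp add: fm_def)
      ultimately have "card {v \<in> nbhd ?X (b T) - {c T}. fm f Q v = 0} < fm f Q (c T)" by (simp only: card.empty)
      then have r: "realizable ?X (shift (b T) (c T) (fm f Q))"
        using restore_edge[OF gE eX] IHr(1) eq by simp
      have sh: "shift (b T) (c T) (fm f Q) = fm f (insert T Q)"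
      proof
        fix v
        have bc: "b T \<noteq> c T" using S[OF TS(1)] by blast
        show "shift (b T) (c T) (fm f Q) v = fm f (insert T Q) v"
          using injT bc by (auto simp: shift_def fm_def)
      qed
      have "same_total V (fm f Q) (shift (b T) (c T) (fm f Q))"
        using V(1) TV[OF TS(1)] aT[OF TS(1)] S[OF TS(1)] fc by (intro same_total_shift) auto
      then show ?case using r IHr(2) same_total_trans unfolding sh by blast
    qed
    define h where "h = fm f S"
    have h: "realizable ?E1 h" "same_total V f h" using stage[OF finS order_refl] by (auto simp: EE0 h_def)
    have g1: "graph ?E1" using gE[of "{}"] EE0 by simp
    have hz: "v \<noteq> z \<Longrightarrow> even_vertex E v \<and> v \<notin> A \<and> (\<forall>T\<in>S. v \<noteq> b T)" if "h v = 0" for v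
    proof -
      have "even_vertex ?E1 v" using zero_even[OF g1 h(1) that] .
      moreover have "v \<noteq> b T" if "T \<in> S" for T using \<open>h v = 0\<close> that by (auto simp: h_def fm_def)
      ultimately show "v \<noteq> z \<Longrightarrow> ?thesis" using ev1[of v] by auto
    qed
    obtain x where x: "x \<in> A" using Ane by blast
    have zsub: "{v \<in> nbhd E d - {z}. h v = 0 \<or> v \<in> W} \<subseteq> even_class d - {d}" if "W \<subseteq> A" "d \<in> A - W" for W d
    proof
      fix v assume v: "v \<in> {v \<in> nbhd E d - {z}. h v = 0 \<or> v \<in> W}"
      have "even_vertex E v" using v hz[of v] that AB evB by blast
      then show "v \<in> even_class d - {d}" using even_nbhd_in_class[of d v] v that AB evB by blast
    qed
    have "\<exists>f'. realizable E f' \<and> f' z = h z + card A mod 2 \<and> (\<forall>v. v \<notin> A \<longrightarrow> v \<noteq> z \<longrightarrow> f' v = h v) \<and>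
       (\<forall>V. finite V \<longrightarrow> z \<in> V \<longrightarrow> A \<subseteq> V \<longrightarrow> sum f' V = sum h V)"
    proof (rule restore_star[OF g AN x h(1)])
      show "h v \<ge> 1" if v: "v \<in> nbhd E z" for v
      proof (rule ccontr)
        assume "\<not> h v \<ge> 1"
        then have h0: "h v = 0" by simp
        have "v \<noteq> z" using v nbhd_irrefl[OF g] by blast
        then have *: "even_vertex E v" "v \<notin> A" "\<forall>T\<in>S. v \<noteq> b T" using hz[OF h0] by auto
        then have vB: "v \<in> even_nbhd z" using v by (simp add: even_nbhd_def)
        then obtain T where T: "T \<in> S" "v \<in> T" using BA * by blast
        then have "v = a T \<or> v = c T" using S[OF T(1)] * by blast
        then show False using S[OF T(1)] vB A * T by blast
      qed
      show "1 \<le> h z + card A mod 2"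
      proof (cases "odd (card A)")
        case False
        then have "\<not> even_vertex ?E1 z" using ev1[of z] by simp
        then show ?thesis using realizable_odd_pos[OF g1 h(1), of z] by simp
      qed (simp add: odd_iff_mod_2_eq_one)
      show "card {v \<in> nbhd E d - {z}. h v = 0 \<or> v \<in> W} \<le> 2"
        if W: "W \<subseteq> A" "x \<in> W" "card W = (card A + 1) div 2" "d \<in> A - W" for W d
      proof -
        have "card {v \<in> nbhd E d - {z}. h v = 0 \<or> v \<in> W} \<le> card (even_class d - {d})"
          using zsub[OF W(1,4)] even_class_card(2) by (intro card_mono) auto
        also have "\<dots> \<le> 2" using even_class_card[of d] even_class_self[of d] by auto
        finally show ?thesis .
      qed
      show "\<exists>d\<in>A - W. card {v \<in> nbhd E d - {z}. h v = 0 \<or> v \<in> W} \<le> 1"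
        if W: "W \<subseteq> A" "x \<in> W" "card W = (card A + 1) div 2" "W \<noteq> A" for W
      proof -
        obtain d where d: "d \<in> A - W" "d \<in> \<Union>S \<or> card {v \<in> even_class d - {d}. v \<in> W \<or> v \<notin> even_nbhd z} \<le> 1"
          using P2[OF W(1,3,4)] by blast
        let ?Z = "{v \<in> nbhd E d - {z}. h v = 0 \<or> v \<in> W}"
        have "card ?Z \<le> 1"
        proof (cases "d \<in> \<Union>S")
          case True
          then obtain T where T: "T \<in> S" "d \<in> T" by blast
          then have "d = a T" using AT d(1) by blast
          \<comment> \<open>\<open>b T\<close> has gained an end and is not in \<open>W\<close>, so
            inside \<open>T\<close> only \<open>c T\<close> can block the pivot
            \<open>a T\<close>.\<close>
          have "?Z \<subseteq> {c T}"
          proof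
            fix v assume v: "v \<in> ?Z"
            then have "v \<in> even_class d - {d}" using zsub[OF W(1) d(1)] by blast
            moreover have "even_class d = T" using S[OF T(1)] \<open>d = a T\<close> by simp
            ultimately have "v = b T \<or> v = c T" using Tin[OF T(1), of v] \<open>d = a T\<close> by auto
            moreover have "v \<noteq> b T"
            proof
              assume vb: "v = b T"
              then have "v \<notin> W" using mbA[OF T(1), of v] W(1) by (auto simp: mb_def)
              then have "h v = 0" using v by blast
              then show False using hz[of v] v vb T(1) by blast
            qed
            ultimately show "v \<in> {c T}" by blast
          qed
          then have "card ?Z \<le> card {c T}" by (intro card_mono) auto
          then show ?thesis by simp
        next
          case False
          have "?Z \<subseteq> {v \<in> even_class d - {d}. v \<in> W \<or> v \<notin> even_nbhd z}"
          proof
            fix v assume v: "v \<in> ?Z"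
            then have vt: "v \<in> even_class d - {d}" using zsub[OF W(1) d(1)] by blast
            have "v \<in> W" if vB: "v \<in> even_nbhd z"
            proof (rule ccontr)
              assume "v \<notin> W"
              then have "h v = 0" using v by blast
              then have "v \<notin> A" using hz[of v] v by blast
              then obtain T where T: "T \<in> S" "v \<in> T" using BA vB by blast
              then have "even_class v = T" using S[OF T(1)] even_class_eq by metis
              moreover have "even_class v = even_class d" using vt even_class_eq by blast
              ultimately have "d \<in> T" using even_class_self[of d] by simp
              then show False using False T(1) by blast
            qed
            then show "v \<in> {v \<in> even_class d - {d}. v \<in> W \<or> v \<notin> even_nbhd z}" using vt by blast
          qed
          then have "card ?Z \<le> card {v \<in> even_class d - {d}. v \<in> W \<or> v \<notin> even_nbhd z}"
            using even_class_card(2)[of d] by (intro card_mono) auto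
          then show ?thesis using d(2) False by linarith
        qed
        then show ?thesis using d(1) by blast
      qed
    qed
    then obtain f' where f': "realizable E f'" "\<forall>v. v \<notin> A \<longrightarrow> v \<noteq> z \<longrightarrow> f' v = h v"
       "\<forall>V. finite V \<longrightarrow> z \<in> V \<longrightarrow> A \<subseteq> V \<longrightarrow> sum f' V = sum h V" by blast
    have "same_total V h f'" by (rule same_totalI[OF V(1) AV]) (use f' in auto)
    then show "\<exists>f'. realizable E f' \<and> same_total V f f'" using f'(1) h(2) same_total_trans by blast
  qed
qed

text \<open>If \<open>P2\<close> failed for some \<open>W\<close>, each vertex of
  \<open>A - W\<close> would lie in a triangle whose other vertices adjacent to \<open>z\<close> all
  belong to \<open>W\<close>. As \<open>W\<close> is only half of \<open>A\<close>, rounded up, this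
  leaves for \<open>A\<close> a single triangle, or a single pair inside the exceptional triangle
  \<open>T0\<close>. Then all even neighbours of \<open>z\<close> lie in one class, against
  \<open>nfail\<close>.\<close>

lemma gallai_strip:
  assumes z: "\<not> even_vertex E z" and Bne: "even_nbhd z \<noteq> {}"
    and nfail: "\<And>v. even_nbhd z \<subseteq> even_class v \<Longrightarrow> card (even_nbhd z) \<le> 1"
  shows "gallai V E"
proof -
  define TT where "TT = {T. \<exists>v\<in>even_nbhd z. T = even_class v \<and> \<not> T \<subseteq> even_nbhd z}"
  have finTT: "finite TT"
  proof -
    have "TT \<subseteq> even_class ` even_nbhd z" by (auto simp: TT_def)
    then show ?thesis using finB by (meson finite_imageI finite_subset)
  qed
  have "\<exists>a b c. T = {a, b, c} \<and> a \<noteq> b \<and> a \<noteq> c \<and> b \<noteq> c \<and> a \<in> even_nbhd z \<and> c \<notin> even_nbhd z \<and> T = even_class a"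
    if T: "T \<in> TT" for T
  proof -
    obtain v c where v: "v \<in> even_nbhd z" "T = even_class v" "c \<in> T" "c \<notin> even_nbhd z" using T by (auto simp: TT_def)
    have vT: "v \<in> T" using v even_class_self by blast
    have vc: "v \<noteq> c" using v by blast
    have "card T = 3"
    proof -
      have "{v, c} \<subseteq> T" using v vT by blast
      then have "card {v, c} \<le> card T" using even_class_card(2) v(2) by (intro card_mono) auto
      then show ?thesis using even_class_card(1)[of v] v(2) vc by auto
    qed
    then have "card (T - {v, c}) = 1" using vT v(3) vc by (subst card_Diff_subset) auto
    then obtain b where "T - {v, c} = {b}" by (meson card_1_singletonE)
    then have "T = {v, b, c}" "v \<noteq> b" "b \<noteq> c" using vT v(3) by blast+
    then show ?thesis using v vc by blast
  qed
  then have "\<forall>T\<in>TT. \<exists>a b c. T = {a, b, c} \<and> a \<noteq> b \<and> a \<noteq> c \<and> b \<noteq> c \<and> a \<in> even_nbhd z \<and> c \<notin> even_nbhd z \<and> T = even_class a" by blast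
  then obtain a b c where abc: "\<And>T. T \<in> TT \<Longrightarrow> T = {a T, b T, c T} \<and> a T \<noteq> b T \<and> a T \<noteq> c T \<and> b T \<noteq> c T \<and>
        a T \<in> even_nbhd z \<and> c T \<notin> even_nbhd z \<and> T = even_class (a T)" by metis
  have disj: "T = T'" if "T \<in> TT" "T' \<in> TT" "v \<in> T" "v \<in> T'" for T T' v
    using abc[OF that(1)] abc[OF that(2)] that(3,4) even_class_eq by metis
  have outside: "even_class d \<subseteq> even_nbhd z" if "d \<in> even_nbhd z" "d \<notin> \<Union>TT" for d
  proof (rule ccontr)
    assume "\<not> ?thesis"
    then have "even_class d \<in> TT" using that by (auto simp: TT_def)
    then show False using that even_class_self by blast
  qed
  \<comment> \<open>Each vertex of \<open>L\<close> has two partners in \<open>W\<close> from its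
    own class, only one if the class is \<open>T0\<close>; different vertices of \<open>L\<close>
    have disjoint classes.\<close>
  have count: "card W \<ge> 2 * card L - card {d \<in> L. even_class d = T0}"
    if fin: "finite L" "finite W" and one: "\<And>d. d \<in> L \<Longrightarrow> card ((even_class d - {d}) \<inter> W) \<ge> (if even_class d = T0 then 1 else 2)"
      and dj: "L \<inter> W = {}" and inj: "\<And>d d'. d \<in> L \<Longrightarrow> d' \<in> L \<Longrightarrow> even_class d = even_class d' \<Longrightarrow> d = d'" for L W :: "'a set" and T0
  proof -
    have "2 * card L = (\<Sum>d\<in>L. 2)" by simp
    also have "\<dots> = (\<Sum>d\<in>L. (if even_class d = T0 then 1 else 2) + of_bool (even_class d = T0))" by (intro sum.cong) auto
    also have "\<dots> = (\<Sum>d\<in>L. (if even_class d = T0 then 1 else 2)) + card {d \<in> L. even_class d = T0}"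
      using fin by (subst sum.distrib) (simp add: of_bool_def sum.If_cases Int_def)
    also have "(\<Sum>d\<in>L. (if even_class d = T0 then 1 else 2)) \<le> (\<Sum>d\<in>L. card ((even_class d - {d}) \<inter> W))"
      by (intro sum_mono one)
    also have "\<dots> = card (\<Union>d\<in>L. (even_class d - {d}) \<inter> W)"
    proof (rule card_UN_disjoint[symmetric])
      show "\<forall>i\<in>L. \<forall>j\<in>L. i \<noteq> j \<longrightarrow> (even_class i - {i}) \<inter> W \<inter> ((even_class j - {j}) \<inter> W) = {}"
        using inj even_class_disj by blast
    qed (use fin in auto)
    also have "\<dots> \<le> card W" using fin by (intro card_mono) auto
    finally show ?thesis by linarith
  qed
  have half: "card (A - W) = card A div 2" if "W \<subseteq> A" "card W = (card A + 1) div 2" "finite A" for A W :: "'a set"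
  proof -
    have "card (A - W) = card A - card W" using that by (meson card_Diff_subset finite_subset)
    moreover have "n - (n + 1) div 2 = n div 2" for n :: nat by (cases "even n") (auto elim!: evenE oddE)
    ultimately show ?thesis using that(2) by metis
  qed
  define A0 where "A0 = (even_nbhd z - \<Union>TT) \<union> a ` TT"
  have A0B: "A0 \<subseteq> even_nbhd z" using abc by (auto simp: A0_def)
  have finA0: "finite A0" using A0B finB by (meson finite_subset)
  show ?thesis
  proof (cases "odd (card A0) \<and> (\<exists>T\<in>TT. b T \<in> even_nbhd z)")
    case False
    show ?thesis
    proof (rule gallai_strip_with[OF z Bne finTT abc A0_def])
      show "b T \<notin> even_nbhd z" if "odd (card A0)" "T \<in> TT" for T using False that by blast
      show "\<exists>d\<in>A0 - W. d \<in> \<Union>TT \<or> card {v \<in> even_class d - {d}. v \<in> W \<or> v \<notin> even_nbhd z} \<le> 1"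
        if W: "W \<subseteq> A0" "card W = (card A0 + 1) div 2" "W \<noteq> A0" for W
      proof (rule ccontr)
        assume neg: "\<not> ?thesis"
        define L where "L = A0 - W"
        have finW: "finite W" "finite L" using W finA0 by (auto simp: L_def intro: finite_subset)
        have L: "even_class d \<subseteq> even_nbhd z \<and> card (even_class d) = 3 \<and> even_class d - {d} \<subseteq> W" if d: "d \<in> L" for d
        proof -
          have neg': "\<not> (d \<in> \<Union>TT \<or> card {v \<in> even_class d - {d}. v \<in> W \<or> v \<notin> even_nbhd z} \<le> 1)"
            using neg d unfolding L_def by blast
          have d': "d \<notin> \<Union>TT" using neg' by blast
          have d'': "card {v \<in> even_class d - {d}. v \<in> W \<or> v \<notin> even_nbhd z} \<ge> 2" using neg' by linarith
          have sub: "even_class d \<subseteq> even_nbhd z" using outside d' d A0B by (auto simp: L_def)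
          have "{v \<in> even_class d - {d}. v \<in> W \<or> v \<notin> even_nbhd z} = (even_class d - {d}) \<inter> W" using sub by blast
          then have c2: "card ((even_class d - {d}) \<inter> W) \<ge> 2" using d'' by simp
          have fin: "finite (even_class d - {d})" using even_class_card(2) by simp
          have "card ((even_class d - {d}) \<inter> W) \<le> card (even_class d - {d})" using fin by (intro card_mono) auto
          then have c3: "card (even_class d) = 3" using c2 even_class_card[of d] even_class_self[of d] by auto
          then have "card (even_class d - {d}) = 2" using even_class_self[of d] even_class_card(2)[of d] by simp
          then have "(even_class d - {d}) \<inter> W = even_class d - {d}"
            using c2 fin card_mono[OF fin, of "(even_class d - {d}) \<inter> W"] by (intro card_subset_eq) auto
          then show ?thesis using sub c3 by blast
        qed
        have cL: "card L = card A0 div 2" unfolding L_def by (rule half[OF W(1,2) finA0])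
        have "L \<noteq> {}" using W by (auto simp: L_def)
        then have cL1: "card L \<ge> 1" using finW by (simp add: Suc_leI card_gt_0_iff)
        \<comment> \<open>No class is empty, so \<open>{}\<close> in the role of \<open>T0\<close>
          means that there is no exception.\<close>
        have "card W \<ge> 2 * card L - card {d \<in> L. even_class d = {}}"
        proof (rule count[OF finW(2,1)])
          show "(if even_class d = {} then 1 else 2) \<le> card ((even_class d - {d}) \<inter> W)" if "d \<in> L" for d
          proof -
            have "(even_class d - {d}) \<inter> W = even_class d - {d}" using L[OF that] by blast
            then show ?thesis using L[OF that] even_class_self[of d] even_class_card(2)[of d] by auto
          qed
          show "L \<inter> W = {}" by (auto simp: L_def)
          show "d = d'" if "d \<in> L" "d' \<in> L" "even_class d = even_class d'" for d d'
            using L[OF that(1)] that even_class_self[of d'] by (auto simp: L_def)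
        qed
        moreover have "{d \<in> L. even_class d = {}} = {}" using even_class_self by blast
        ultimately have cW: "card W \<ge> 2 * card L" by simp
        have "card A0 div 2 \<ge> 1" using cL1 cL by simp
        moreover have "(card A0 + 1) div 2 \<ge> 2 * (card A0 div 2)" using cW cL W(2) by simp
        \<comment> \<open>Half of \<open>card A0\<close> rounded up is at least twice the half
          rounded down, and the latter is positive: only 3 is left.\<close>
        ultimately have "card A0 = 3" by presburger
        then have cc: "card W = 2" "card L = 1" using W(2) cL by auto
        obtain d where d: "L = {d}" using cc by (meson card_1_singletonE)
        have Ld: "even_class d \<subseteq> even_nbhd z" "card (even_class d) = 3" "even_class d - {d} \<subseteq> W" using L[of d] d by auto
        have "card (even_class d - {d}) = 2" using Ld even_class_self[of d] even_class_card(2)[of d] by simp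
        then have "even_class d - {d} = W" using Ld(3) cc finW by (intro card_subset_eq) auto
        then have A0d: "A0 = even_class d" using d W(1) even_class_self[of d] by (auto simp: L_def)
        have "even_nbhd z \<subseteq> even_class d"
        proof
          fix v assume v: "v \<in> even_nbhd z"
          show "v \<in> even_class d"
          proof (cases "v \<in> \<Union>TT")
            case True
            then obtain T where T: "T \<in> TT" "v \<in> T" by blast
            then have "a T \<in> even_class d" using A0d by (auto simp: A0_def)
            then have "T = even_class d" using abc[OF T(1)] even_class_eq by metis
            then show ?thesis using T(2) by simp
          qed (use v A0d A0_def in blast)
        qed
        then have "card (even_nbhd z) \<le> 1" by (rule nfail)
        moreover have "card (even_class d) \<le> card (even_nbhd z)" using Ld(1) finB by (intro card_mono) auto
        ultimately show False using Ld(2) by linarith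
      qed
    qed
  next
    case True
    \<comment> \<open>Here $z$ would become even and might not be a path end, which blocks the restoration of the edges
      $b(T)c(T)$ with $b(T)$ adjacent to $z$. So one triangle loses both its edges to $z$ instead.\<close>
    then obtain T0 where T0: "T0 \<in> TT" "b T0 \<in> even_nbhd z" and oddA0: "odd (card A0)" by blast
    note abc0 = abc[OF T0(1)]
    let ?S = "TT - {T0}"
    define A where "A = insert (b T0) A0"
    have aT: "a T \<in> T" if "T \<in> TT" for T using abc[OF that] by blast
    have bA0: "b T0 \<notin> A0"
    proof
      assume "b T0 \<in> A0"
      moreover have "b T0 \<in> \<Union>TT" using abc0 T0 by blast
      ultimately obtain T where T: "T \<in> TT" "b T0 = a T" by (auto simp: A0_def)
      then have "T = T0" using disj[of T T0 "b T0"] aT[OF T(1)] abc0 T0(1) by (metis insertCI)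
      then show False using T abc0 by auto
    qed
    have cA: "card A = card A0 + 1" using bA0 finA0 by (simp add: A_def)
    have evA: "even (card A)" using cA oddA0 by simp
    have BT0: "even_nbhd z \<inter> T0 = {a T0, b T0}" using abc0 T0(2) by blast
    have Aeq: "A = (even_nbhd z - \<Union>?S) \<union> a ` ?S"
    proof
      show "A \<subseteq> (even_nbhd z - \<Union>?S) \<union> a ` ?S"
      proof
        fix v assume "v \<in> A"
        then consider "v = b T0" | "v \<in> even_nbhd z" "v \<notin> \<Union>TT" | T where "T \<in> TT" "v = a T" by (auto simp: A_def A0_def)
        then show "v \<in> (even_nbhd z - \<Union>?S) \<union> a ` ?S"
        proof cases
          case 1
          have "v \<notin> T" if "T \<in> ?S" for T using disj[of T T0 v] that T0(1) abc0 1 by blast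
          then show ?thesis using 1 T0(2) by blast
        next
          case 2 then show ?thesis by blast
        next
          case 3
          show ?thesis
          proof (cases "T = T0")
            case True
            have "v \<notin> T'" if "T' \<in> ?S" for T' using disj[of T' T0 v] that T0(1) abc0 3 True by blast
            then show ?thesis using 3 abc[OF 3(1)] by blast
          qed (use 3 in blast)
        qed
      qed
      show "(even_nbhd z - \<Union>?S) \<union> a ` ?S \<subseteq> A"
      proof
        fix v assume "v \<in> (even_nbhd z - \<Union>?S) \<union> a ` ?S"
        then consider "v \<in> even_nbhd z" "v \<in> T0" | "v \<in> even_nbhd z" "v \<notin> \<Union>TT" | "v \<in> a ` TT" by blast
        then show "v \<in> A"
        proof cases
          case 1
          then have "v = a T0 \<or> v = b T0" using BT0 by blast
          then show ?thesis using T0(1) by (auto simp: A_def A0_def)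
        qed (auto simp: A_def A0_def)
      qed
    qed
    have AB: "A \<subseteq> even_nbhd z" using A0B T0 by (auto simp: A_def)
    have finA: "finite A" using finA0 by (simp add: A_def)
    show ?thesis
    proof (rule gallai_strip_with[OF z Bne _ _ Aeq])
      show "finite ?S" using finTT by simp
      show "T = {a T, b T, c T} \<and> a T \<noteq> b T \<and> a T \<noteq> c T \<and> b T \<noteq> c T \<and>
        a T \<in> even_nbhd z \<and> c T \<notin> even_nbhd z \<and> T = even_class (a T)" if "T \<in> ?S" for T using abc[of T] that by blast
      show "b T \<notin> even_nbhd z" if "odd (card A)" for T using evA that by blast
      show "\<exists>d\<in>A - W. d \<in> \<Union>?S \<or> card {v \<in> even_class d - {d}. v \<in> W \<or> v \<notin> even_nbhd z} \<le> 1"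
        if W: "W \<subseteq> A" "card W = (card A + 1) div 2" "W \<noteq> A" for W
      proof (rule ccontr)
        assume neg: "\<not> ?thesis"
        define L where "L = A - W"
        have finW: "finite W" "finite L" using W finA by (auto simp: L_def intro: finite_subset)
        have L: "d \<notin> \<Union>?S \<and> card {v \<in> even_class d - {d}. v \<in> W \<or> v \<notin> even_nbhd z} \<ge> 2" if d: "d \<in> L" for d
        proof -
          have neg': "\<not> (d \<in> \<Union>?S \<or> card {v \<in> even_class d - {d}. v \<in> W \<or> v \<notin> even_nbhd z} \<le> 1)"
            using neg d unfolding L_def by blast
          then have "card {v \<in> even_class d - {d}. v \<in> W \<or> v \<notin> even_nbhd z} \<ge> 2" by linarith
          then show ?thesis using neg' by blast
        qed
        have c3: "card (even_class d - {d}) = 2" if d: "d \<in> L" for d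
        proof -
          have fin: "finite (even_class d - {d})" using even_class_card(2) by simp
          have "card {v \<in> even_class d - {d}. v \<in> W \<or> v \<notin> even_nbhd z} \<le> card (even_class d - {d})" using fin by (intro card_mono) auto
          then have "card (even_class d - {d}) \<ge> 2" using L[OF d] by linarith
          moreover have "card (even_class d - {d}) = card (even_class d) - 1" using even_class_card(2)[of d] even_class_self[of d] by simp
          ultimately show ?thesis using even_class_card(1)[of d] by linarith
        qed
        have all: "v \<in> W \<or> v \<notin> even_nbhd z" if d: "d \<in> L" and v: "v \<in> even_class d - {d}" for d v
        proof -
          have fin: "finite (even_class d - {d})" using even_class_card(2) by simp
          have sub: "{v \<in> even_class d - {d}. v \<in> W \<or> v \<notin> even_nbhd z} \<subseteq> even_class d - {d}" by blast
          have "card {v \<in> even_class d - {d}. v \<in> W \<or> v \<notin> even_nbhd z} = card (even_class d - {d})"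
            using L[OF d] c3[OF d] card_mono[OF fin sub] by linarith
          then have "{v \<in> even_class d - {d}. v \<in> W \<or> v \<notin> even_nbhd z} = even_class d - {d}"
            by (rule card_subset_eq[OF fin sub])
          then show ?thesis using v by blast
        qed
        have cL: "card L = card A div 2" unfolding L_def by (rule half[OF W(1,2) finA])
        have "L \<noteq> {}" using W by (auto simp: L_def)
        then have cL1: "card L \<ge> 1" using finW by (simp add: Suc_leI card_gt_0_iff)
        have inj: "d = d'" if "d \<in> L" "d' \<in> L" "even_class d = even_class d'" for d d'
        proof (rule ccontr)
          assume "d \<noteq> d'"
          then have "d' \<in> even_class d - {d}" using that even_class_self[of d'] by auto
          then show False using all[OF that(1), of d'] that(2) AB by (auto simp: L_def)
        qed
        have "card W \<ge> 2 * card L - card {d \<in> L. even_class d = T0}"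
        proof (rule count[OF finW(2,1)])
          show "(if even_class d = T0 then 1 else 2) \<le> card ((even_class d - {d}) \<inter> W)" if d: "d \<in> L" for d
          proof (cases "even_class d = T0")
            case True
            have ab: "a T0 \<noteq> b T0" using abc0 by (elim conjE)
            define d' where "d' = (if d = a T0 then b T0 else a T0)"
            have d': "d' \<in> {a T0, b T0}" "d' \<noteq> d" using ab unfolding d'_def by (simp_all split: if_splits)
            then have "d' \<in> even_class d - {d}" "d' \<in> even_nbhd z" using True BT0 by auto
            then have "d' \<in> (even_class d - {d}) \<inter> W" using all[OF d, of d'] by blast
            then have "(even_class d - {d}) \<inter> W \<noteq> {}" by blast
            then have "card ((even_class d - {d}) \<inter> W) > 0" using finW by (simp add: card_gt_0_iff)
            then show ?thesis using True by simp
          next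
            case False
            have "d \<notin> \<Union>TT"
            proof
              assume "d \<in> \<Union>TT"
              then have "d \<in> T0" using L[OF d] by blast
              then show False using abc0 even_class_eq False by metis
            qed
            then have "even_class d \<subseteq> even_nbhd z" using outside d AB by (auto simp: L_def)
            then have "(even_class d - {d}) \<inter> W = even_class d - {d}" using all[OF d] by blast
            then show ?thesis using c3[OF d] by simp
          qed
          show "L \<inter> W = {}" by (auto simp: L_def)
        qed (rule inj)
        moreover have "card {d \<in> L. even_class d = T0} \<le> 1"
        proof -
          have "\<forall>x\<in>{d \<in> L. even_class d = T0}. \<forall>y\<in>{d \<in> L. even_class d = T0}. x = y" using inj by simp
          then show ?thesis using card_le_Suc0_iff_eq[of "{d \<in> L. even_class d = T0}"] finW(2) by simp
        qed
        ultimately have cW: "card W + 1 \<ge> 2 * card L" by linarith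
        have "card A div 2 \<ge> 1" using cL1 cL by simp
        moreover have "(card A + 1) div 2 + 1 \<ge> 2 * (card A div 2)" using cW cL W(2) by simp
        \<comment> \<open>For even \<open>n\<close> \<ge> 2 the inequality
          \<open>n div 2 + 1\<close> \<ge> \<open>n\<close> leaves only 2.\<close>
        ultimately have "card A = 2" using evA by presburger
        moreover have "{a T0, b T0} \<subseteq> A" using T0(1) by (auto simp: A_def A0_def)
        ultimately have Aab: "A = {a T0, b T0}" using abc0 finA by (intro card_subset_eq[symmetric]) auto
        have "even_nbhd z \<subseteq> even_class (a T0)"
        proof
          fix v assume v: "v \<in> even_nbhd z"
          show "v \<in> even_class (a T0)"
          proof (cases "v \<in> \<Union>?S")
            case True
            then obtain T where T: "T \<in> ?S" "v \<in> T" by blast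
            then have "a T \<in> A" using Aeq by blast
            then have "a T \<in> T0" using Aab abc0 by blast
            then have "T = T0" using disj[of T T0 "a T"] aT[of T] T T0(1) by blast
            then show ?thesis using T by blast
          next
            case False
            then have "v \<in> A" using v Aeq by blast
            then show ?thesis using Aab abc0 by blast
          qed
        qed
        then have "card (even_nbhd z) \<le> 1" by (rule nfail)
        moreover have "card {a T0, b T0} \<le> card (even_nbhd z)" using AB Aab finB by (intro card_mono) auto
        ultimately show False using abc0 by auto
      qed
    qed
  qed
qed

text \<open>When \<open>gallai_strip\<close> does not apply, each odd vertex with even neighbours
  has at least two of them, all in one class. When \<open>gallai_odd_edge\<close> does not apply
  either, an odd vertex next to it sees the same class. Then a nonisolated even vertex has a
  triangle as its class, and this triangle with the odd vertices that see it is a SET component. So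
  all nonisolated vertices are odd, and \<open>realizable_one_zero\<close> finishes.\<close>

theorem gallai_triangles: "gallai V E"
proof (cases "\<exists>z. \<not> even_vertex E z \<and> even_nbhd z \<noteq> {} \<and> (\<forall>v. even_nbhd z \<subseteq> even_class v \<longrightarrow> card (even_nbhd z) \<le> 1)")
  case True
  then show ?thesis using gallai_strip by blast
next
  case False
  then have type: "\<exists>v. even_nbhd z \<subseteq> even_class v \<and> card (even_nbhd z) \<ge> 2" if "\<not> even_vertex E z" "even_nbhd z \<noteq> {}" for z
    using that by (metis not_less_eq_eq numeral_2_eq_2 One_nat_def)
  show ?thesis
  proof (cases "\<exists>z w p. \<not> even_vertex E z \<and> \<not> even_vertex E w \<and> {z, w} \<in> E \<and> even_nbhd z \<subseteq> even_class p \<and> card (even_nbhd z) \<ge> 2 \<and> even_nbhd w \<inter> even_class p = {}")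
    case True
    then obtain z w p where zw: "\<not> even_vertex E z" "\<not> even_vertex E w" "{z, w} \<in> E" "even_nbhd z \<subseteq> even_class p" "card (even_nbhd z) \<ge> 2" "even_nbhd w \<inter> even_class p = {}" by blast
    show ?thesis by (rule gallai_odd_edge[OF zw]) (use type[OF zw(2)] in blast)
  next
    case no: False
    show ?thesis
    proof (cases "\<exists>p. even_vertex E p \<and> nbhd E p \<noteq> {}")
      case True
      then obtain p where p: "even_vertex E p" "nbhd E p \<noteq> {}" by blast
      have c3: "card (even_class p) = 3"
      proof (rule ccontr)
        assume "card (even_class p) \<noteq> 3"
        then have "card (even_class p) = 1" using even_class_card(1) by blast
        then have tp: "even_class p = {p}" using even_class_self by (metis card_1_singletonE singletonD)
        obtain u where u: "u \<in> nbhd E p" using p by blast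
        have "\<not> even_vertex E u" using even_nbhd_in_class[OF p(1) _ u] tp by blast
        moreover have pB: "p \<in> even_nbhd u" using u p nbhd_sym[of u E p] by (auto simp: even_nbhd_def)
        ultimately obtain v where v: "even_nbhd u \<subseteq> even_class v" "card (even_nbhd u) \<ge> 2" using type[of u] by blast
        have "even_class v = {p}" using v pB even_class_eq[of p v] tp by blast
        then have "card (even_nbhd u) \<le> card {p}" using v(1) by (intro card_mono) auto
        then show False using v(2) by simp
      qed
      let ?T = "even_class p"
      define C where "C = ?T \<union> {z. \<not> even_vertex E z \<and> even_nbhd z \<inter> ?T \<noteq> {}}"
      have evT: "even_vertex E t" if "t \<in> ?T" for t using even_class_ev[OF p(1) that] .
      have BT: "even_nbhd z \<subseteq> ?T \<and> card (even_nbhd z) \<ge> 2" if Bz: "\<not> even_vertex E z" "even_nbhd z \<inter> ?T \<noteq> {}" for z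
      proof -
        obtain v where v: "even_nbhd z \<subseteq> even_class v" "card (even_nbhd z) \<ge> 2" using type[of z] Bz by blast
        then have "even_class v = ?T" using Bz(2) even_class_disj[of v p] by blast
        then show ?thesis using v by simp
      qed
      have "SET_component E C ?T" unfolding SET_component_def
      proof (intro conjI ballI)
        show "clique3 E ?T" by (rule even_class_clique[OF c3])
        show "?T \<subseteq> C" by (simp add: C_def)
        show "even_vertex E v" if "v \<in> ?T" for v using evT that .
        show "\<not> even_vertex E v" if "v \<in> C - ?T" for v using that by (auto simp: C_def)
        show "card (nbhd E v \<inter> ?T) \<ge> 2" if v: "v \<in> C - ?T" for v
        proof -
          have *: "even_nbhd v \<subseteq> ?T" "card (even_nbhd v) \<ge> 2" using BT[of v] v by (auto simp: C_def)
          then have "even_nbhd v \<subseteq> nbhd E v \<inter> ?T" by (auto simp: even_nbhd_def)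
          then have "card (even_nbhd v) \<le> card (nbhd E v \<inter> ?T)" using even_class_card(2) by (intro card_mono) auto
          then show ?thesis using * by linarith
        qed
        have step: "y \<in> C" if xy: "{x, y} \<in> E" and x: "x \<in> C" for x y
        proof (cases "x \<in> ?T")
          case True
          have yx: "y \<in> nbhd E x" using xy nbhd_edge(2)[of y E x] by blast
          show ?thesis
          proof (cases "even_vertex E y")
            case evy: True
            have "y \<in> even_class x" using even_nbhd_in_class[OF evT[OF True] evy yx] by blast
            then show ?thesis using even_class_eq[OF True] by (auto simp: C_def)
          next
            case odd: False
            have "x \<in> even_nbhd y" using evT[OF True] xy nbhd_edge(1)[of x E y] by (auto simp: even_nbhd_def)
            then show ?thesis using True odd by (auto simp: C_def)
          qed
        next
          case nT: False
          then have xo: "\<not> even_vertex E x" "even_nbhd x \<inter> ?T \<noteq> {}" using x by (auto simp: C_def)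
          note bx = BT[OF xo]
          show ?thesis
          proof (cases "even_vertex E y")
            case True
            then have "y \<in> even_nbhd x" using xy nbhd_edge(2)[of y E x] by (auto simp: even_nbhd_def)
            then show ?thesis using bx by (auto simp: C_def)
          next
            case odd: False
            then have "even_nbhd y \<inter> ?T \<noteq> {}" using no xo bx xy by blast
            then show ?thesis using odd by (auto simp: C_def)
          qed
        qed
        show "closed_in E C" unfolding closed_in_def
        proof (intro ballI impI)
          fix e assume e: "e \<in> E" "e \<inter> C \<noteq> {}"
          obtain x y where xy: "e = {x, y}" using graph_edgeE[OF g e(1)] by metis
          then have "x \<in> C \<or> y \<in> C" using e by blast
          moreover have "{x, y} \<in> E" "{y, x} \<in> E" using e(1) xy by (simp_all add: insert_commute)
          ultimately have "x \<in> C \<and> y \<in> C" using step[of x y] step[of y x] by blast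
          then show "e \<subseteq> C" using xy by simp
        qed
      qed
      then show ?thesis using ns by (auto simp: no_SET_component_def)
    next
      case False
      \<comment> \<open>One end at each odd vertex and none elsewhere is the least that parity
        allows.\<close>
      define f where "f v = card (nbhd E v) mod 2" for v
      have "realizable E f"
      proof (rule realizable_one_zero[OF g V(1)])
        show "even (f v) \<longleftrightarrow> even_vertex E v" for v by (simp add: f_def)
        show "f v = 0" if "v \<notin> V" for v
        proof -
          have "nbhd E v = {}" using that V(2) by (auto simp: nbhd_def)
          then show ?thesis by (simp add: f_def)
        qed
        show "u = v" if u: "u \<in> \<Union>E" "f u = 0" for u v
        proof -
          obtain e where e: "e \<in> E" "u \<in> e" using u by blast
          then obtain x y where "e = {x, y}" using graph_edgeE[OF g] by metis
          then have "nbhd E u \<noteq> {}" using e by (auto simp: nbhd_def insert_commute)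
          moreover have "even_vertex E u" using u(2) by (simp add: f_def even_iff_mod_2_eq_zero)
          ultimately show ?thesis using False by blast
        qed
        show "\<Union>E \<subseteq> V" by (rule V(2))
      qed
      moreover have "f v = 0" if "v \<notin> V" for v
      proof -
        have "nbhd E v = {}" using that V(2) by (auto simp: nbhd_def)
        then show ?thesis by (simp add: f_def)
      qed
      moreover have "sum f V \<le> card V"
      proof -
        have "sum f V \<le> (\<Sum>v\<in>V. 1)" by (intro sum_mono) (simp add: f_def)
        then show ?thesis by simp
      qed
      ultimately show ?thesis unfolding gallai_def by blast
    qed
  qed
qed

end

section \<open>Configurations\<close>

text \<open>The three alternatives are the situations treated by \<open>gallai_leaf\<close>,
  \<open>gallai_path\<close> and \<open>gallai_star\<close>, with \<open>F\<close> in the role of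
  \<open>even_edges E\<close>.\<close>

definition reducible :: "'a set set \<Rightarrow> bool" where
  "reducible F \<longleftrightarrow> (\<exists>x b. nbhd F x = {b}) \<or>
    (\<exists>v1 v2 v3 w. distinct [v1, v2, v3, w] \<and> nbhd F v2 = {v1, v3} \<and> nbhd F v3 = {v2, w} \<and> card (nbhd F v1) \<le> 2) \<or>
    (\<exists>x b1 b2 b3. distinct [b1, b2, b3] \<and> nbhd F x = {b1, b2, b3} \<and> card (nbhd F b1) \<le> 3 \<and> card (nbhd F b2) \<le> 3 \<and>
       ({b1, b2} \<in> F \<or> (\<forall>b T. \<not> trapped_triangle F x b T)))"

definition triangle_at :: "'a set set \<Rightarrow> 'a \<Rightarrow> bool" where
  "triangle_at F v \<longleftrightarrow> (\<exists>a b. a \<noteq> b \<and> nbhd F v = {a, b} \<and> nbhd F a = {v, b} \<and> nbhd F b = {v, a})"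

definition manageable :: "'a set set \<Rightarrow> bool" where
  "manageable F \<longleftrightarrow> reducible F \<or> (\<forall>v. nbhd F v = {} \<or> triangle_at F v)"

text \<open>\<open>F0\<close> is fixed while \<open>E\<close> shrinks: after deletions the even
  edges form some subset of \<open>F0\<close>, which is why all subsets have to be
  \<open>manageable\<close>. \<open>V\<close> varies in the induction because a bridge splits
  it.\<close>

theorem gallai_of_manageable:
  assumes man: "\<And>F. F \<subseteq> F0 \<Longrightarrow> manageable F"
    and "graph E" "no_SET_component E" "even_edges E \<subseteq> F0" "finite V" "\<Union>E \<subseteq> V"
  shows "gallai V E"
  using assms(2-)
proof (induction "card E" arbitrary: E V rule: less_induct)
  case less
  note g = less.prems(1) and ns = less.prems(2) and V = less.prems(4,5)
  have IH: "gallai_below E" unfolding gallai_below_def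
  proof (intro allI impI)
    fix E' V' assume E': "E' \<subset> E" "even_edges E' \<subseteq> even_edges E" "no_SET_component E'" "finite V'" "\<Union>E' \<subseteq> V'"
    have "card E' < card E" using E'(1) g by (intro psubset_card_mono) (auto simp: graph_def)
    moreover have "graph E'" by (rule graph_subset[OF g]) (use E' in blast)
    ultimately show "gallai V' E'" using less.hyps[of E' V'] E' less.prems(3) by blast
  qed
  show ?case
  proof (cases "\<exists>u v C. bridge E u v C")
    case True
    then show ?thesis using gallai_bridge[OF g ns IH V] by blast
  next
    case False
    then have nobr: "\<not> bridge E u v C" for u v C by blast
    have "manageable (even_edges E)" by (rule man[OF less.prems(3)])
    then consider x b where "nbhd (even_edges E) x = {b}"
      | v1 v2 v3 w where "distinct [v1, v2, v3, w]" "nbhd (even_edges E) v2 = {v1, v3}"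
          "nbhd (even_edges E) v3 = {v2, w}" "card (nbhd (even_edges E) v1) \<le> 2"
      | x b1 b2 b3 where "distinct [b1, b2, b3]" "nbhd (even_edges E) x = {b1, b2, b3}"
          "card (nbhd (even_edges E) b1) \<le> 3" "card (nbhd (even_edges E) b2) \<le> 3"
          "{b1, b2} \<in> even_edges E \<or> (\<forall>b T. \<not> trapped_triangle (even_edges E) x b T)"
      | "\<forall>v. nbhd (even_edges E) v = {} \<or> triangle_at (even_edges E) v"
      unfolding manageable_def reducible_def by blast
    then show ?thesis
    proof cases
      case 1
      show ?thesis by (rule gallai_leaf[OF g ns IH V nobr 1])
    next
      case 2
      show ?thesis by (rule gallai_path[OF g ns IH V nobr 2])
    next
      case 3
      show ?thesis by (rule gallai_star[OF g ns IH V nobr 3(2,1,3,4,5)])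
    next
      case 4
      interpret triangles E V
        by unfold_locales (use g ns IH V 4 in \<open>auto simp: triangle_at_def\<close>)
      show ?thesis by (rule gallai_triangles)
    qed
  qed
qed

text \<open>The host graph has its own vertex type. The property is proved for the image inside the
  host and is carried back along the inverse embedding.\<close>

lemma manageable_image:
  assumes g: "graph F" and inj: "inj_on h (\<Union>F)" and man: "manageable F"
  shows "manageable ((`) h ` F)"
proof -
  let ?F = "(`) h ` F"
  have mem: "{h u, h v} \<in> ?F \<longleftrightarrow> {u, v} \<in> F" if "u \<in> \<Union>F" "v \<in> \<Union>F" for u v
  proof
    assume "{h u, h v} \<in> ?F"
    then obtain e where e: "e \<in> F" "h ` e = h ` {u, v}" by auto
    have "e = {u, v}" using e that inj_on_image_eq_iff[OF inj, of e "{u, v}"] by blast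
    then show "{u, v} \<in> F" using e by simp
  next
    assume "{u, v} \<in> F"
    then have "h ` {u, v} \<in> ?F" by (rule imageI)
    then show "{h u, h v} \<in> ?F" by simp
  qed
  have nbU: "nbhd F v \<subseteq> \<Union>F" for v by (auto simp: nbhd_def)
  have nbv: "v \<in> \<Union>F" if "nbhd F v \<noteq> {}" for v using that by (auto simp: nbhd_def)
  have nbI: "nbhd ?F (h v) = h ` nbhd F v" if v: "v \<in> \<Union>F" for v
  proof
    show "nbhd ?F (h v) \<subseteq> h ` nbhd F v"
    proof
      fix w assume "w \<in> nbhd ?F (h v)"
      then have w: "{w, h v} \<in> ?F" by (simp add: nbhd_def)
      then obtain e where e: "e \<in> F" "{w, h v} = h ` e" by auto
      then have "w \<in> h ` e" by blast
      then obtain u where u: "u \<in> e" "w = h u" by blast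
      have "{u, v} \<in> F" using w mem[of u v] u e v by auto
      then show "w \<in> h ` nbhd F v" using u by (auto simp: nbhd_def)
    qed
    show "h ` nbhd F v \<subseteq> nbhd ?F (h v)"
    proof
      fix w assume "w \<in> h ` nbhd F v"
      then obtain u where "u \<in> nbhd F v" "w = h u" by blast
      then show "w \<in> nbhd ?F (h v)" using mem[of u v] nbU[of v] v by (auto simp: nbhd_def)
    qed
  qed
  have cardI: "card (nbhd ?F (h v)) = card (nbhd F v)" if "v \<in> \<Union>F" for v
    unfolding nbI[OF that] by (rule card_image) (rule inj_on_subset[OF inj nbU])
  have UF: "\<Union>?F = h ` \<Union>F" by auto
  have ne: "h u \<noteq> h v" if "u \<noteq> v" "u \<in> \<Union>F" "v \<in> \<Union>F" for u v using inj that by (meson inj_onD)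
  have trapped_triangle: "\<exists>b' T'. trapped_triangle F x b' T'" if x: "x \<in> \<Union>F" and trapped_triangle: "trapped_triangle ?F (h x) b T" for x b T
  proof -
    have "b \<in> h ` nbhd F x" using trapped_triangle nbI[OF x] by (simp add: trapped_triangle_def)
    then obtain b' where b': "b' \<in> nbhd F x" "b = h b'" by blast
    have b'U: "b' \<in> \<Union>F" using b' nbU by blast
    have clT: "clique3 ?F T" using trapped_triangle by (simp add: trapped_triangle_def)
    have "T \<subseteq> h ` \<Union>F"
    proof
      fix t assume "t \<in> T"
      then have "card (nbhd ?F t \<inter> T) \<ge> 2" using clique3_nbhd[OF clT] by blast
      then have "nbhd ?F t \<noteq> {}" by (intro notI) simp
      then obtain y where "{y, t} \<in> ?F" by (auto simp: nbhd_def)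
      then have "t \<in> \<Union>?F" by (rule UnionI) simp
      then show "t \<in> h ` \<Union>F" unfolding UF .
    qed
    then obtain T' where T': "T' \<subseteq> \<Union>F" "T = h ` T'" by (meson subset_imageE)
    have injT: "inj_on h T'" by (rule inj_on_subset[OF inj T'(1)])
    have interI: "h ` A \<inter> h ` T' = h ` (A \<inter> T')" if "A \<subseteq> \<Union>F" for A
      using inj_on_image_Int[OF inj that T'(1)] by simp
    have "trapped_triangle F x b' T'" unfolding trapped_triangle_def
    proof (intro conjI ballI)
      show "b' \<in> nbhd F x" by fact
      show "clique3 F T'" unfolding clique3_def
      proof (intro conjI ballI impI)
        show "card T' = 3" using clT card_image[OF injT] T' by (simp add: clique3_def)
        fix u v assume uv: "u \<in> T'" "v \<in> T'" "u \<noteq> v"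
        then have "{h u, h v} \<in> ?F" using clT ne[of u v] T' unfolding clique3_def by blast
        then show "{u, v} \<in> F" using mem[of u v] uv T' by blast
      qed
      have "insert x (nbhd F x) \<subseteq> \<Union>F" using x nbU by blast
      from interI[OF this] have "h ` (insert x (nbhd F x) \<inter> T') = insert (h x) (nbhd ?F (h x)) \<inter> T"
        unfolding nbI[OF x] T'(2) by (simp only: image_insert)
      also have "\<dots> = {}" using trapped_triangle unfolding trapped_triangle_def by (simp only: Int_commute)
      finally have "h ` (insert x (nbhd F x) \<inter> T') = {}" .
      then show "T' \<inter> insert x (nbhd F x) = {}" by blast
      show "nbhd F p \<subseteq> T' \<union> nbhd F x" if p: "p \<in> T'" for p
      proof
        fix u assume u: "u \<in> nbhd F p"
        have pU: "p \<in> \<Union>F" using p T' by blast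
        have "h u \<in> nbhd ?F (h p)" using u nbI[OF pU] by blast
        moreover have "nbhd ?F (h p) \<subseteq> T \<union> nbhd ?F (h x)" using trapped_triangle p T' by (auto simp: trapped_triangle_def)
        ultimately have "h u \<in> h ` (T' \<union> nbhd F x)" using nbI[OF x] T' by blast
        moreover have TU: "T' \<union> nbhd F x \<subseteq> \<Union>F" using T' nbU by blast
        moreover have "u \<in> \<Union>F" using u nbU by blast
        ultimately show "u \<in> T' \<union> nbhd F x" using inj_on_image_mem_iff[OF inj, of u "T' \<union> nbhd F x"] by blast
      qed
      have "card (h ` (nbhd F b' \<inter> T')) \<ge> 2" using trapped_triangle interI[OF nbU] nbI[OF b'U] b' T' by (simp add: trapped_triangle_def)
      moreover have "card (h ` (nbhd F b' \<inter> T')) = card (nbhd F b' \<inter> T')"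
        by (rule card_image) (rule inj_on_subset[OF injT], blast)
      ultimately show "card (nbhd F b' \<inter> T') \<ge> 2" by simp
    qed
    then show ?thesis by blast
  qed
  from man consider (leaf) x b where "nbhd F x = {b}"
      | (path) v1 v2 v3 w where "distinct [v1, v2, v3, w]" "nbhd F v2 = {v1, v3}"
          "nbhd F v3 = {v2, w}" "card (nbhd F v1) \<le> 2"
      | (star) x b1 b2 b3 where "distinct [b1, b2, b3]" "nbhd F x = {b1, b2, b3}"
          "card (nbhd F b1) \<le> 3" "card (nbhd F b2) \<le> 3"
          "{b1, b2} \<in> F \<or> (\<forall>b T. \<not> trapped_triangle F x b T)"
      | (tri) "\<forall>v. nbhd F v = {} \<or> triangle_at F v"
    unfolding manageable_def reducible_def by blast
  then show ?thesis
  proof cases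
    case leaf
    then have "nbhd ?F (h x) = {h b}" using nbI[of x] nbv[of x] by simp
    then show ?thesis unfolding manageable_def reducible_def by blast
  next
    case path
    have U: "v2 \<in> \<Union>F" "v3 \<in> \<Union>F" "v1 \<in> \<Union>F" "w \<in> \<Union>F"
      using nbv[of v2] nbv[of v3] nbU[of v2] nbU[of v3] path by auto
    have "distinct [h v1, h v2, h v3, h w]" using path(1)
      by (simp add: inj_on_eq_iff[OF inj U(3) U(1)] inj_on_eq_iff[OF inj U(3) U(2)] inj_on_eq_iff[OF inj U(3) U(4)] inj_on_eq_iff[OF inj U(1) U(2)] inj_on_eq_iff[OF inj U(1) U(4)] inj_on_eq_iff[OF inj U(2) U(4)])
    moreover have "nbhd ?F (h v2) = {h v1, h v3}" "nbhd ?F (h v3) = {h v2, h w}" "card (nbhd ?F (h v1)) \<le> 2"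
      using nbI[OF U(1)] nbI[OF U(2)] cardI[OF U(3)] path by auto
    ultimately show ?thesis unfolding manageable_def reducible_def by blast
  next
    case star
    have U: "x \<in> \<Union>F" "b1 \<in> \<Union>F" "b2 \<in> \<Union>F" "b3 \<in> \<Union>F"
      using nbv[of x] nbU[of x] star by auto
    have "distinct [h b1, h b2, h b3]" using star(1)
      by (simp add: inj_on_eq_iff[OF inj U(2) U(3)] inj_on_eq_iff[OF inj U(2) U(4)] inj_on_eq_iff[OF inj U(3) U(4)])
    moreover have "nbhd ?F (h x) = {h b1, h b2, h b3}" "card (nbhd ?F (h b1)) \<le> 3" "card (nbhd ?F (h b2)) \<le> 3"
      using nbI[OF U(1)] cardI[OF U(2)] cardI[OF U(3)] star by auto
    moreover have "{h b1, h b2} \<in> ?F \<or> (\<forall>b T. \<not> trapped_triangle ?F (h x) b T)"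
    proof (cases "{b1, b2} \<in> F")
      case True
      then show ?thesis using mem[OF U(2,3)] by simp
    next
      case False
      then have "\<not> trapped_triangle F x b T" for b T using star(5) by blast
      then show ?thesis using trapped_triangle[OF U(1)] by metis
    qed
    ultimately show ?thesis unfolding manageable_def reducible_def by blast
  next
    case tri
    have "nbhd ?F w = {} \<or> triangle_at ?F w" for w
    proof (cases "w \<in> h ` \<Union>F")
      case True
      then obtain v where v: "v \<in> \<Union>F" "w = h v" by blast
      show ?thesis
      proof (cases "nbhd F v = {}")
        case True
        then show ?thesis using nbI[OF v(1)] v(2) by simp
      next
        case False
        then have "triangle_at F v" using tri by blast
        then obtain a b where ab: "a \<noteq> b" "nbhd F v = {a, b}" "nbhd F a = {v, b}" "nbhd F b = {v, a}"
          unfolding triangle_at_def by blast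
        have U: "a \<in> \<Union>F" "b \<in> \<Union>F" using nbU[of v] ab by auto
        have "h a \<noteq> h b" "nbhd ?F w = {h a, h b}" "nbhd ?F (h a) = {w, h b}" "nbhd ?F (h b) = {w, h a}"
          using ne[OF ab(1) U] nbI[OF v(1)] nbI[OF U(1)] nbI[OF U(2)] ab v(2) by auto
        then show ?thesis unfolding triangle_at_def by blast
      qed
    next
      case False
      have "nbhd ?F w = {}"
      proof (rule ccontr)
        assume "nbhd ?F w \<noteq> {}"
        then obtain y where "{y, w} \<in> ?F" by (auto simp: nbhd_def)
        then have "w \<in> \<Union>?F" by (rule UnionI) simp
        then show False using False unfolding UF by blast
      qed
      then show ?thesis by simp
    qed
    then show ?thesis unfolding manageable_def by blast
  qed
qed

text \<open>The trapped triangle is itself a place to reduce. A vertex \<open>p\<close> of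
  \<open>T\<close> adjacent to \<open>b\<close> has just the neighbours \<open>q\<close>,
  \<open>r\<close> and \<open>b\<close>, and since \<open>qr\<close> is an edge, the star at
  \<open>p\<close> is reducible by the first alternative of its side condition.\<close>

lemma trapped_triangle_reducible:
  assumes g: "graph F" and trapped_triangle: "trapped_triangle F x b T" and deg: "\<And>t. t \<in> T \<Longrightarrow> card (nbhd F t) \<le> 3"
  shows "reducible F"
proof -
  have fin: "finite (nbhd F v)" for v by (rule finite_nbhd[OF g])
  have T: "clique3 F T" "b \<notin> T" "card (nbhd F b \<inter> T) \<ge> 2" using trapped_triangle by (auto simp: trapped_triangle_def)
  have finT: "finite T" "card T = 3" using T by (auto simp: clique3_def intro: card_ge_0_finite)
  have "nbhd F b \<inter> T \<noteq> {}" using T(3) by (intro notI) simp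
  then obtain p where p: "p \<in> T" "p \<in> nbhd F b" by blast
  have "card (T - {p}) = 2" using p finT by simp
  then obtain q r where qr: "T - {p} = {q, r}" "q \<noteq> r" by (meson card_2_iff)
  have qrT: "q \<in> T" "r \<in> T" "q \<noteq> p" "r \<noteq> p" using qr by auto
  have "{q, r, b} \<subseteq> nbhd F p" 
  proof -
    have "{q, p} \<in> F" "{r, p} \<in> F" using T(1) p(1) qrT by (auto simp: clique3_def)
    then show ?thesis using p(2) nbhd_sym[of p F b] by (simp add: nbhd_edge(1))
  qed
  moreover have "q \<noteq> b" "r \<noteq> b" using qrT T(2) by blast+
  then have c3: "card {q, r, b} = 3" using qr(2) by simp
  ultimately have "nbhd F p = {q, r, b}"
    using card_seteq[OF fin, of "{q, r, b}" p] deg[OF p(1)] by simp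
  moreover have "{q, r} \<in> F" using T(1) qrT qr(2) by (auto simp: clique3_def)
  moreover have "distinct [q, r, b]" using qr(2) qrT T(2) by auto
  ultimately show ?thesis using deg qrT unfolding reducible_def by blast
qed

section \<open>End blocks\<close>

lemma connected_graphI:
  assumes ne: "L \<noteq> {}" and cross: "\<And>A. A \<subseteq> L \<Longrightarrow> A \<noteq> {} \<Longrightarrow> A \<noteq> L \<Longrightarrow> \<exists>a\<in>A. \<exists>b\<in>L - A. {a, b} \<in> Es"
  shows "connected_graph (SGraph L Es)"
  unfolding connected_graph_def sgraph.sel
proof (intro conjI ballI)
  show "L \<noteq> {}" by fact
  fix u v assume uv: "u \<in> L" "v \<in> L"
  let ?R = "{(x, y). {x, y} \<in> Es}"
  let ?A = "{w \<in> L. (u, w) \<in> ?R\<^sup>*}"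
  have "?A = L"
  proof (rule ccontr)
    assume "?A \<noteq> L"
    moreover have "u \<in> ?A" using uv by simp
    ultimately obtain a b where ab: "a \<in> ?A" "b \<in> L - ?A" "{a, b} \<in> Es" using cross[of ?A] by blast
    then have "(u, a) \<in> ?R\<^sup>*" "(a, b) \<in> ?R" by auto
    then have "(u, b) \<in> ?R\<^sup>*" by (rule rtrancl.rtrancl_into_rtrancl)
    then show False using ab by blast
  qed
  then show "(u, v) \<in> ?R\<^sup>*" using uv by blast
qed

text \<open>A minimal nonempty set that is attached to the rest through a single vertex $s$ forms, together with
  $s$, a 2-connected end block.\<close>

lemma leaf_block:
  assumes g: "graph F" and X0: "finite X0" "X0 \<noteq> {}" "s0 \<notin> X0" "\<And>x. x \<in> X0 \<Longrightarrow> nbhd F x \<subseteq> insert s0 X0"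
    and noniso: "\<And>x. x \<in> X0 \<Longrightarrow> nbhd F x \<noteq> {}"
    and bound: "\<And>L v. two_connected (SGraph L {e \<in> F. e \<subseteq> L}) \<Longrightarrow> v \<in> L \<Longrightarrow> card (nbhd F v \<inter> L) \<le> 3"
    and nred: "\<not> reducible F"
  shows "\<exists>u u' y. u \<in> X0 \<and> u' \<in> X0 \<and> u \<noteq> u' \<and> u \<noteq> y \<and> u' \<noteq> y \<and> nbhd F u = {u', y} \<and> nbhd F u' = {u, y}"
proof -
  have finF: "finite (nbhd F v)" for v by (rule finite_nbhd[OF g])
  have irr: "v \<notin> nbhd F v" for v by (rule nbhd_irrefl[OF g])
  \<comment> \<open>\<open>X\<close> is attached to the rest through \<open>s\<close> only. The
    minimum is taken over all attachment vertices, not just \<open>s0\<close>;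
    \<open>smaller\<close> is the form in which it is used.\<close>
  define P where "P X s \<longleftrightarrow> X \<subseteq> X0 \<and> X \<noteq> {} \<and> s \<notin> X \<and> (\<forall>x\<in>X. nbhd F x \<subseteq> insert s X)" for X s
  have "\<exists>n X s. P X s \<and> card X = n" using X0 unfolding P_def by blast
  define n where "n = (LEAST n. \<exists>X s. P X s \<and> card X = n)"
  have "\<exists>X s. P X s \<and> card X = n" unfolding n_def using \<open>\<exists>n X s. P X s \<and> card X = n\<close> by (rule LeastI_ex)
  then obtain X s where Xs: "P X s" "card X = n" by blast
  have min: "card X \<le> card Y" if "P Y t" for Y t
    unfolding Xs(2) n_def using that by (intro Least_le) blast
  have X: "X \<subseteq> X0" "X \<noteq> {}" "s \<notin> X" "\<And>x. x \<in> X \<Longrightarrow> nbhd F x \<subseteq> insert s X" using Xs by (auto simp: P_def)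
  have finX: "finite X" using X X0 by (meson finite_subset)
  have smaller: False if Y: "Y \<subset> X" "Y \<noteq> {}" "t \<notin> Y" "\<And>x. x \<in> Y \<Longrightarrow> nbhd F x \<subseteq> insert t Y" for Y t
  proof -
    have "P Y t" using Y X(1) unfolding P_def by blast
    then have "card X \<le> card Y" by (rule min)
    then show False using psubset_card_mono[OF finX Y(1)] by simp
  qed
  have noleaf: "card (nbhd F x) \<ge> 2" if "x \<in> X" for x
  proof (rule ccontr)
    assume "\<not> ?thesis"
    then have "card (nbhd F x) = 1" using noniso[of x] that X(1) finF[of x] by (auto simp: card_gt_0_iff not_less_eq_eq numeral_2_eq_2 le_Suc_eq)
    then obtain b where "nbhd F x = {b}" by (meson card_1_singletonE)
    then show False using nred by (auto simp: reducible_def)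
  qed
  have two: "card X \<ge> 2"
  proof (rule ccontr)
    assume "\<not> ?thesis"
    moreover obtain x where x: "x \<in> X" using X by blast
    ultimately have "X = {x}" using finX by (metis One_nat_def Suc_leI card_1_singletonE card_gt_0_iff le_antisym not_less_eq_eq numeral_2_eq_2 singletonD X(2))
    then have "nbhd F x \<subseteq> {s}" using X(4)[OF x] irr[of x] by blast
    then have "card (nbhd F x) \<le> card {s}" by (intro card_mono) auto
    then show False using noleaf[OF x] by simp
  qed
  let ?L = "insert s X"
  let ?G = "SGraph ?L {e \<in> F. e \<subseteq> ?L}"
  \<comment> \<open>If removing \<open>c\<close> disconnected the rest, a part without
    \<open>s\<close> would be attached through \<open>c\<close> only, against minimality.\<close>
  have part: "\<exists>a\<in>A. \<exists>b\<in>?L - {c} - A. {a, b} \<in> {e \<in> F. e \<subseteq> ?L - {c}}"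
    if c: "c \<in> ?L" and A: "A \<subseteq> ?L - {c}" "A \<noteq> {}" "A \<noteq> ?L - {c}" for A c
  proof (rule ccontr)
    assume neg: "\<not> ?thesis"
    let ?A' = "?L - {c} - A"
    have no: "{a, b} \<notin> F" if "a \<in> A" "b \<in> ?A'" for a b using neg that A by blast
    have use: False if D: "D \<subseteq> ?L - {c}" "D \<noteq> {}" "D \<noteq> ?L - {c}" "s \<notin> D"
        and noD: "\<And>a b. a \<in> D \<Longrightarrow> b \<in> ?L - {c} - D \<Longrightarrow> {a, b} \<notin> F" for D
    proof (rule smaller[of D c])
      show "D \<subset> X" using D c by blast
      show "D \<noteq> {}" "c \<notin> D" using D by auto
      fix x assume x: "x \<in> D"
      then have "x \<in> X" using D by blast
      show "nbhd F x \<subseteq> insert c D"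
      proof
        fix y assume y: "y \<in> nbhd F x"
        then have "y \<in> ?L" using X(4)[OF \<open>x \<in> X\<close>] by blast
        then show "y \<in> insert c D" using noD[OF x, of y] y nbhd_edge(2)[of y F x] by blast
      qed
    qed
    show False
    proof (cases "s \<in> A")
      case False
      then show False using use[OF A] no by blast
    next
      case True
      show False
      proof (rule use[of ?A'])
        show "{a, b} \<notin> F" if "a \<in> ?A'" "b \<in> ?L - {c} - ?A'" for a b
          using no[of b a] that A by (auto simp: insert_commute)
      qed (use A True in auto)
    qed
  qed
  have conn: "\<exists>a\<in>A. \<exists>b\<in>?L - A. {a, b} \<in> {e \<in> F. e \<subseteq> ?L}"
    if A: "A \<subseteq> ?L" "A \<noteq> {}" "A \<noteq> ?L" for A
  proof (rule ccontr)
    assume neg: "\<not> ?thesis"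
    have no: "{a, b} \<notin> F" if "a \<in> A" "b \<in> ?L - A" for a b using neg that A by blast
    have use: False if D: "D \<subseteq> X" "D \<noteq> {}" and noD: "\<And>a b. a \<in> D \<Longrightarrow> b \<in> ?L - D \<Longrightarrow> {a, b} \<notin> F" for D
    proof -
      have nbD: "nbhd F x \<subseteq> D" if "x \<in> D" for x
      proof
        fix y assume y: "y \<in> nbhd F x"
        then have "y \<in> ?L" using X(4)[of x] that D by blast
        then show "y \<in> D" using noD[OF that, of y] y nbhd_edge(2)[of y F x] by blast
      qed
      show False
      proof (cases "D = X")
        case False
        then show False using smaller[of D s] D X(3) nbD by blast
      next
        \<comment> \<open>No edge leads from \<open>X\<close> to \<open>s\<close>. Then
          \<open>X\<close> without any one of its vertices \<open>x\<close> is attached through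
          \<open>x\<close>, and it is smaller.\<close>
        case True
        obtain x where x: "x \<in> X" using X by blast
        have "X - {x} \<noteq> {}"
        proof
          assume "X - {x} = {}"
          then have "card X \<le> card {x}" by (intro card_mono) auto
          then show False using two by simp
        qed
        then show False using smaller[of "X - {x}" x] x nbD True by blast
      qed
    qed
    show False
    proof (cases "s \<in> A")
      case False
      then show False using use[of A] A no by blast
    next
      case True
      show False
      proof (rule use[of "?L - A"])
        show "{a, b} \<notin> F" if "a \<in> ?L - A" "b \<in> ?L - (?L - A)" for a b
          using no[of b a] that A by (auto simp: insert_commute)
      qed (use A True in auto)
    qed
  qed
  have cL: "card ?L \<ge> 3" using two finX X(3) by simp
  have "two_connected ?G" unfolding two_connected_def
  proof (intro conjI ballI)
    show "card (verts ?G) \<ge> 3" using cL by simp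
    show "connected_graph ?G" by (rule connected_graphI) (use conn in auto)
    fix c assume "c \<in> verts ?G"
    then have c: "c \<in> ?L" by simp
    have eq: "induced_subgraph ?G (verts ?G - {c}) = SGraph (?L - {c}) {e \<in> F. e \<subseteq> ?L - {c}}"
      by (auto simp: induced_subgraph_def)
    have "?L - {c} \<noteq> {}"
    proof
      assume "?L - {c} = {}"
      then have "card ?L \<le> card {c}" by (intro card_mono) auto
      then show False using cL by simp
    qed
    then show "connected_graph (induced_subgraph ?G (verts ?G - {c}))"
      unfolding eq by (rule connected_graphI) (use part[OF c] in blast)
  qed
  note bL = bound[OF this]
  have deg: "card (nbhd F x) \<le> 3" if "x \<in> X" for x
  proof -
    have "nbhd F x \<inter> ?L = nbhd F x" using X(4)[OF that] by blast
    then show ?thesis using bL[of x] that by simp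
  qed
  \<comment> \<open>A vertex of degree three has two neighbours in \<open>X\<close>, of degree at
    most three. So it is reducible unless there is a trapped triangle, and then that triangle has
    degrees at most three and is reducible instead.\<close>
  have all2: "card (nbhd F x) = 2" if x: "x \<in> X" for x
  proof (rule ccontr)
    assume "card (nbhd F x) \<noteq> 2"
    then have c3: "card (nbhd F x) = 3" using noleaf[OF x] deg[OF x] by linarith
    have "\<exists>b1 b2 b3. distinct [b1, b2, b3] \<and> nbhd F x = {b1, b2, b3} \<and> b1 \<in> X \<and> b2 \<in> X"
    proof (cases "s \<in> nbhd F x")
      case True
      then have "card (nbhd F x - {s}) = 2" using c3 finF by simp
      then obtain b1 b2 where b: "nbhd F x - {s} = {b1, b2}" "b1 \<noteq> b2" by (meson card_2_iff)
      then have "distinct [b1, b2, s]" "nbhd F x = {b1, b2, s}" "b1 \<in> X" "b2 \<in> X" using True X(4)[OF x] by auto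
      then show ?thesis by blast
    next
      case False
      obtain b1 b2 b3 where b: "nbhd F x = {b1, b2, b3}" "b1 \<noteq> b2" "b1 \<noteq> b3" "b2 \<noteq> b3" using c3 by (auto simp: card_3_iff)
      then have "b1 \<in> X" "b2 \<in> X" using X(4)[OF x] False by auto
      then show ?thesis using b by auto
    qed
    then obtain b1 b2 b3 where b: "distinct [b1, b2, b3]" "nbhd F x = {b1, b2, b3}" "b1 \<in> X" "b2 \<in> X" by blast
    have "\<exists>b T. trapped_triangle F x b T" using nred b deg[OF b(3)] deg[OF b(4)] unfolding reducible_def by blast
    then obtain b T where trapped_triangle: "trapped_triangle F x b T" by blast
    have T: "clique3 F T" "T \<inter> insert x (nbhd F x) = {}" "b \<in> nbhd F x" "card (nbhd F b \<inter> T) \<ge> 2" "\<And>p. p \<in> T \<Longrightarrow> nbhd F p \<subseteq> T \<union> nbhd F x"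
      using trapped_triangle by (auto simp: trapped_triangle_def)
    have finT: "finite T" "card T = 3" using T(1) by (auto simp: clique3_def intro: card_ge_0_finite)
    have nbT: "t' \<in> nbhd F t" if "t \<in> T" "t' \<in> T" "t' \<noteq> t" for t t' using T(1) that by (auto simp: clique3_def nbhd_def)
    have nxL: "nbhd F x \<subseteq> ?L" by (rule X(4)[OF x])
    \<comment> \<open>If \<open>T\<close> meets \<open>X\<close>, it lies in the end block and so do
      the neighbours of its vertices, where degrees are bounded. Otherwise the only neighbour that a
      vertex of \<open>T\<close> can have outside \<open>T\<close> is \<open>s\<close>.\<close>
    have "card (nbhd F t) \<le> 3" if t: "t \<in> T" for t
    proof (cases "T \<inter> X = {}")
      case False
      then obtain t0 where t0: "t0 \<in> T" "t0 \<in> X" by blast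
      have TL: "T \<subseteq> ?L" using nbT[OF t0(1)] X(4)[OF t0(2)] t0 by blast
      show ?thesis
      proof (cases "t \<in> X")
        case True then show ?thesis by (rule deg)
      next
        case False
        then have "t = s" using t TL by blast
        moreover have "nbhd F t \<inter> ?L = nbhd F t" using T(5)[OF t] TL nxL by blast
        ultimately show ?thesis using bL[of s] by simp
      qed
    next
      case True
      have sT: "s \<notin> T"
      proof
        assume s: "s \<in> T"
        then have "b \<in> X" using T(2,3) nxL by blast
        then have "nbhd F b \<inter> T \<subseteq> {s}" using X(4)[of b] True by blast
        then have "card (nbhd F b \<inter> T) \<le> card {s}" by (intro card_mono) auto
        then show False using T(4) by simp
      qed
      have "nbhd F t \<subseteq> insert s (T - {t})"
      proof
        fix y assume y: "y \<in> nbhd F t"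
        have "y \<notin> X"
        proof
          assume "y \<in> X"
          then have "t \<in> ?L" using X(4)[of y] y nbhd_sym[of y F t] by blast
          then show False using t True sT by blast
        qed
        then show "y \<in> insert s (T - {t})" using T(5)[OF t] y nxL irr[of t] by blast
      qed
      then have "card (nbhd F t) \<le> card (insert s (T - {t}))" using finT by (intro card_mono) auto
      also have "\<dots> = 3" using finT t sT by simp
      finally show ?thesis .
    qed
    then show False using trapped_triangle_reducible[OF g trapped_triangle] nred by blast
  qed
  show ?thesis
  \<comment> \<open>A vertex with both neighbours in \<open>X\<close> gives a reducible path, or a
    triangle two of whose vertices form a smaller set attached through the third. So every vertex of
    \<open>X\<close> is adjacent to \<open>s\<close>, and \<open>u\<close>, its other neighbour and
    \<open>s\<close> form the triangle.\<close>
  proof (cases "\<exists>v2\<in>X. nbhd F v2 \<subseteq> X")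
    case True
    then obtain v2 where v2: "v2 \<in> X" "nbhd F v2 \<subseteq> X" by blast
    obtain v1 v3 where v13: "nbhd F v2 = {v1, v3}" "v1 \<noteq> v3" using all2[OF v2(1)] by (meson card_2_iff)
    have inX: "v1 \<in> X" "v3 \<in> X" using v13 v2 by auto
    have v2n: "v2 \<in> nbhd F v1" "v2 \<in> nbhd F v3" using v13 nbhd_sym[of v2 F v1] nbhd_sym[of v2 F v3] by auto
    have "card (nbhd F v3 - {v2}) = 1" using v2n(2) all2[OF inX(2)] finF by simp
    then obtain w where "nbhd F v3 - {v2} = {w}" by (meson card_1_singletonE)
    then have w: "nbhd F v3 = {v2, w}" "w \<noteq> v2" using v2n(2) by auto
    show ?thesis
    proof (cases "w = v1")
      case True
      then have "v3 \<in> nbhd F v1" using w nbhd_sym[of v1 F v3] by auto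
      moreover have "v2 \<noteq> v3" using irr[of v3] v2n(2) by auto
      ultimately have "nbhd F v1 = {v2, v3}" using v2n(1) all2[OF inX(1)] card_seteq[OF finF, of "{v2, v3}" v1] by simp
      moreover have "v1 \<noteq> v2" using irr[of v1] v2n(1) by auto
      ultimately have False using smaller[of "{v1, v2}" v3] v2(1) inX v13 \<open>v2 \<noteq> v3\<close> by blast
      then show ?thesis ..
    next
      case False
      have "distinct [v1, v2, v3, w]" using False v13(2) w irr[of v1] irr[of v3] v2n by auto
      then have "reducible F" using v13(1) w(1) all2[OF inX(1)] unfolding reducible_def by (metis order_refl)
      then show ?thesis using nred by blast
    qed
  next
    case False
    then have sn: "s \<in> nbhd F v" if "v \<in> X" for v using X(4)[OF that] that by blast
    obtain u where u: "u \<in> X" using X by blast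
    have "card (nbhd F u - {s}) = 1" using sn[OF u] all2[OF u] finF by simp
    then obtain u' where "nbhd F u - {s} = {u'}" by (meson card_1_singletonE)
    then have u': "nbhd F u = {u', s}" "u' \<noteq> s" using sn[OF u] by auto
    have u'X: "u' \<in> X" using X(4)[OF u] u' by blast
    have uu: "u \<noteq> u'" using irr[of u] u' by auto
    have us: "u \<noteq> s" using u X(3) by blast
    have "{u, s} \<subseteq> nbhd F u'" using sn[OF u'X] u' nbhd_sym[of u F u'] by auto
    then have "nbhd F u' = {u, s}" using all2[OF u'X] us card_seteq[OF finF, of "{u, s}" u'] by simp
    then show ?thesis using u u'X uu us u' X(1) by blast
  qed
qed

section \<open>Blocks and the family of host graphs\<close>

lemma finite_edges: "simple_graph G \<Longrightarrow> finite (edges G)"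
proof -
  assume "simple_graph G"
  then have "edges G \<subseteq> Pow (verts G)" "finite (verts G)" by (auto simp: simple_graph_def)
  then show ?thesis by (meson finite_Pow_iff finite_subset)
qed

lemma simple_graph_graph: "simple_graph G \<Longrightarrow> graph (edges G)"
  using finite_edges[of G] by (auto simp: graph_def simple_graph_def)

lemma subgraph_trans: "subgraph A B \<Longrightarrow> subgraph B C \<Longrightarrow> subgraph A C"
  by (auto simp: subgraph_def)

text \<open>Among the 2-connected subgraphs that contain \<open>M\<close>, one with the largest
  total number of vertices and edges is maximal.\<close>

lemma two_connected_block:
  assumes G: "simple_graph G" and M: "subgraph M G" "two_connected M"
  shows "\<exists>B. block B G \<and> subgraph M B"
proof -
  let ?P = "\<lambda>B. subgraph B G \<and> two_connected B \<and> subgraph M B"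
  let ?m = "\<lambda>B. card (verts B) + card (edges B)"
  have finG: "finite (verts G)" "finite (edges G)" using G finite_edges by (auto simp: simple_graph_def)
  have "?P M" using M by (auto simp: subgraph_def)
  moreover have "\<forall>B. ?P B \<longrightarrow> ?m B < Suc (?m G)"
    unfolding less_Suc_eq_le using finG by (intro allI impI add_mono card_mono) (auto simp: subgraph_def)
  ultimately have "\<exists>B. ?P B \<and> (\<forall>B'. ?P B' \<longrightarrow> ?m B' \<le> ?m B)"
    by (rule Lattices_Big.ex_has_greatest_nat)
  then obtain B where B: "?P B" "\<And>B'. ?P B' \<Longrightarrow> ?m B' \<le> ?m B" by metis
  have "B' = B" if B': "subgraph B' G" "two_connected B'" "subgraph B B'" for B'
  proof -
    have "?P B'" using B' B(1) subgraph_trans by blast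
    then have le: "?m B' \<le> ?m B" by (rule B(2))
    have sub: "verts B \<subseteq> verts B'" "edges B \<subseteq> edges B'" using B'(3) by (auto simp: subgraph_def)
    have fin: "finite (verts B')" "finite (edges B')" using B'(1) finG by (auto simp: subgraph_def intro: finite_subset)
    have "card (verts B) \<le> card (verts B')" "card (edges B) \<le> card (edges B')" using sub fin by (auto intro: card_mono)
    then have "card (verts B') \<le> card (verts B)" "card (edges B') \<le> card (edges B)" using le by linarith+
    then have "verts B = verts B'" "edges B = edges B'"
      using card_seteq[OF fin(1) sub(1)] card_seteq[OF fin(2) sub(2)] by blast+
    then show ?thesis by (simp add: sgraph.expand)
  qed
  then have "block B G" using B(1) unfolding block_def by blast
  then show ?thesis using B(1) by blast
qed

text \<open>The degree bound on blocks in this form applies to 2-connected subgraphs of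
  \<open>F\<close>, which need not be blocks of the host.\<close>

lemma two_connected_degree:
  assumes H: "H \<in> family_G" and M: "subgraph M H" "two_connected M" "v \<in> verts M"
  shows "card {e \<in> edges M. v \<in> e} \<le> 3"
proof -
  have sH: "simple_graph H" using H by (auto simp: family_G_def)
  obtain B where B: "block B H" "subgraph M B" using two_connected_block[OF sH M(1,2)] by blast
  have sB: "simple_graph B" using B(1) by (auto simp: block_def subgraph_def)
  have vB: "v \<in> verts B" using B(2) M(3) by (auto simp: subgraph_def)
  have "max_degree B \<le> 3" using H B(1) by (auto simp: family_G_def)
  moreover have "degree B v \<le> max_degree B"
    unfolding max_degree_def using sB vB by (intro Max_ge) (auto simp: simple_graph_def)
  moreover have "card {e \<in> edges M. v \<in> e} \<le> degree B v"
    unfolding degree_def using B(2) finite_edges[OF sB] by (intro card_mono) (auto simp: subgraph_def)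
  ultimately show ?thesis by linarith
qed

lemma connected_has_edge:
  assumes "connected_graph (SGraph L Es)" "v \<in> L" "u \<in> L" "u \<noteq> v"
  shows "\<exists>w. {v, w} \<in> Es"
proof -
  have "(v, u) \<in> {(x, y). {x, y} \<in> Es}\<^sup>*" using assms by (auto simp: connected_graph_def)
  then show ?thesis using assms(4) by (cases rule: converse_rtranclE) auto
qed

lemma distinct_walk:
  assumes "(t, q) \<in> r\<^sup>*"
  shows "\<exists>xs. xs \<noteq> [] \<and> distinct xs \<and> hd xs = t \<and> last xs = q \<and> successively (\<lambda>a b. (a, b) \<in> r) xs"
  using assms
proof (induction rule: converse_rtrancl_induct)
  case base
  show ?case by (rule exI[of _ "[q]"]) simp
next
  case (step t t')
  then obtain xs where xs: "xs \<noteq> []" "distinct xs" "hd xs = t'" "last xs = q" "successively (\<lambda>a b. (a, b) \<in> r) xs"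
    by blast
  show ?case
  proof (cases "t \<in> set xs")
    case True
    then obtain us vs where uv: "xs = us @ t # vs" by (meson split_list)
    then show ?thesis using xs by (intro exI[of _ "t # vs"]) (auto simp: successively_append_iff)
  next
    case False
    then show ?thesis using xs step by (intro exI[of _ "t # xs"]) (auto simp: successively_Cons)
  qed
qed

lemma successively_rtrancl:
  assumes "successively Q xs" "xs \<noteq> []" "\<And>a b. Q a b \<Longrightarrow> a \<in> set xs \<Longrightarrow> b \<in> set xs \<Longrightarrow> (a, b) \<in> r"
  shows "(hd xs, last xs) \<in> r\<^sup>*"
  using assms
proof (induction xs rule: induct_list012)
  case (3 x y zs)
  have "(y, last (y # zs)) \<in> r\<^sup>*" using 3 by auto
  moreover have "(x, y) \<in> r" using 3 by auto
  ultimately show ?case by (auto intro: converse_rtrancl_into_rtrancl)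
qed auto

text \<open>Follow the walk from \<open>t\<close> until it first meets \<open>Q\<close>, at
  \<open>q'\<close>. Together with \<open>yt\<close> this is an ear with ends \<open>y\<close> and
  \<open>q'\<close>, and adding an ear keeps 2-connectedness. \<open>M\<close> is taken as the
  subgraph induced by the enlarged vertex set, where further edges do no harm.\<close>

lemma ear:
  assumes C: "simple_graph C" and Q: "subgraph Q C" "two_connected Q" "y \<in> verts Q"
    and t: "{y, t} \<in> edges C" "t \<noteq> y"
    and walk: "(t, q) \<in> {(a, b). {a, b} \<in> edges C \<and> a \<noteq> y \<and> b \<noteq> y}\<^sup>*" "q \<in> verts Q"
  shows "\<exists>M. subgraph M C \<and> two_connected M \<and> subgraph Q M \<and> {y, t} \<in> edges M"
proof -
  let ?r = "{(a, b). {a, b} \<in> edges C \<and> a \<noteq> y \<and> b \<noteq> y}"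
  let ?VQ = "verts Q"
  obtain xs where xs: "xs \<noteq> []" "distinct xs" "hd xs = t" "last xs = q" "successively (\<lambda>a b. (a, b) \<in> ?r) xs"
    using distinct_walk[OF walk(1)] by blast
  have "\<exists>x\<in>set xs. x \<in> ?VQ" using xs walk(2) by (metis last_in_set)
  then obtain us q' vs where us: "xs = us @ q' # vs" "q' \<in> ?VQ" "\<forall>x\<in>set us. x \<notin> ?VQ"
    using split_list_first_prop[of xs "\<lambda>x. x \<in> ?VQ"] by blast
  define zs where "zs = us @ [q']"
  have zs: "distinct zs" "hd zs = t" "successively (\<lambda>a b. (a, b) \<in> ?r) zs"
    using xs us(1) by (auto simp: zs_def successively_append_iff hd_append split: if_splits)
  have zy: "w \<noteq> y" "w \<in> verts C" if "w \<in> set zs" for w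
  proof -
    have "successively (\<lambda>a b. (a, b) \<in> ?r) zs \<Longrightarrow> zs \<noteq> [] \<Longrightarrow> hd zs \<noteq> y \<Longrightarrow> hd zs \<in> verts C \<Longrightarrow> w \<in> set zs \<Longrightarrow> w \<noteq> y \<and> w \<in> verts C" for zs
    proof (induction zs rule: induct_list012)
      case (3 a b zs)
      have ab: "{a, b} \<in> edges C" "b \<noteq> y" using 3(3) by auto
      have "b \<in> verts C" using ab(1) C by (auto simp: simple_graph_def)
      then show ?case using 3 ab by auto
    qed auto
    moreover have "t \<in> verts C" using t C by (auto simp: simple_graph_def)
    ultimately show "w \<noteq> y" "w \<in> verts C" using zs t(2) that by (auto simp: zs_def)
  qed
  have sQ: "simple_graph Q" and QC: "?VQ \<subseteq> verts C" "edges Q \<subseteq> edges C" using Q(1) by (auto simp: subgraph_def)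
  have eQ: "e \<subseteq> ?VQ" if "e \<in> edges Q" for e using sQ that by (auto simp: simple_graph_def)
  let ?VM = "?VQ \<union> set us"
  let ?M = "SGraph ?VM {e \<in> edges C. e \<subseteq> ?VM}"
  have finVM: "finite ?VM" using sQ by (auto simp: simple_graph_def)
  have VMC: "?VM \<subseteq> verts C" using QC zy(2) by (auto simp: zs_def)
  \<comment> \<open>\<open>D = {}\<close> gives connectedness, and \<open>D = {c}\<close> shows that
    \<open>c\<close> is not a cut vertex.\<close>
  have main: "connected_graph (SGraph (?VM - D) {e \<in> edges C. e \<subseteq> ?VM - D})"
    if D: "D = {} \<or> (\<exists>c\<in>?VM. D = {c})" for D
  proof -
    let ?R = "{(a, b). {a, b} \<in> {e \<in> edges C. e \<subseteq> ?VM - D}}"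
    have symR: "sym (?R\<^sup>*)" by (rule sym_rtrancl) (auto simp: sym_def insert_commute)
    have base: "?VQ - D \<noteq> {} \<and> (\<forall>a\<in>?VQ - D. \<forall>b\<in>?VQ - D. (a, b) \<in> ?R\<^sup>*)"
    proof (cases "D \<inter> ?VQ = {}")
      case True
      have "connected_graph Q" using Q(2) by (simp add: two_connected_def)
      then have "?VQ \<noteq> {}" "\<forall>a\<in>?VQ. \<forall>b\<in>?VQ. (a, b) \<in> {(x, y). {x, y} \<in> edges Q}\<^sup>*" by (auto simp: connected_graph_def)
      moreover have "{(x, y). {x, y} \<in> edges Q} \<subseteq> ?R" using eQ QC True by blast
      then have "{(x, y). {x, y} \<in> edges Q}\<^sup>* \<subseteq> ?R\<^sup>*" by (rule rtrancl_mono)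
      ultimately show ?thesis using True by blast
    next
      case False
      then obtain c where c: "D = {c}" "c \<in> ?VQ" using D by auto
      then have "connected_graph (induced_subgraph Q (?VQ - {c}))" using Q(2) by (simp add: two_connected_def)
      then have "?VQ - {c} \<noteq> {}" "\<forall>a\<in>?VQ - {c}. \<forall>b\<in>?VQ - {c}. (a, b) \<in> {(x, y). {x, y} \<in> edges Q \<and> {x, y} \<subseteq> ?VQ - {c}}\<^sup>*"
        by (auto simp: connected_graph_def induced_subgraph_def)
      moreover have "{(x, y). {x, y} \<in> edges Q \<and> {x, y} \<subseteq> ?VQ - {c}} \<subseteq> ?R" using QC c by blast
      then have "{(x, y). {x, y} \<in> edges Q \<and> {x, y} \<subseteq> ?VQ - {c}}\<^sup>* \<subseteq> ?R\<^sup>*" by (rule rtrancl_mono)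
      ultimately show ?thesis using c by blast
    qed
    \<comment> \<open>The removed vertex interrupts the ear on at most one side of \<open>z\<close>;
      the other side leads to \<open>q'\<close> or, through \<open>t\<close>, to
      \<open>y\<close>.\<close>
    have att: "\<exists>b\<in>?VQ - D. (z, b) \<in> ?R\<^sup>*" if z: "z \<in> ?VM - D" for z
    proof (cases "z \<in> ?VQ")
      case True
      then show ?thesis using z by blast
    next
      case False
      then have "z \<in> set us" using z by blast
      then obtain as bs where ab: "us = as @ z # bs" by (meson split_list)
      show ?thesis
      proof (cases "D \<inter> set (bs @ [q']) = {}")
        case True
        let ?p = "z # bs @ [q']"
        have suc: "successively (\<lambda>a b. (a, b) \<in> ?r) ?p" using zs(3) ab by (simp add: zs_def successively_append_iff)
        have sub: "set ?p \<subseteq> ?VM - D" using True z ab us(2) by auto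
        have "(hd ?p, last ?p) \<in> ?R\<^sup>*"
        proof (rule successively_rtrancl[OF suc])
          show "(a, b) \<in> ?R" if "(a, b) \<in> ?r" "a \<in> set ?p" "b \<in> set ?p" for a b
            using that(1) subsetD[OF sub that(2)] subsetD[OF sub that(3)] by simp
        qed simp
        moreover have "q' \<in> ?VQ - D" using True us(2) by auto
        ultimately show ?thesis by (intro bexI[of _ q']) auto
      next
        case no: False
        then obtain c where c: "D = {c}" "c \<in> set (bs @ [q'])" using D by auto
        let ?p = "as @ [z]"
        have cp: "c \<notin> set ?p" using c(2) zs(1) ab by (auto simp: zs_def)
        have cy: "c \<noteq> y" using c(2) zy(1)[of c] ab by (auto simp: zs_def)
        have suc: "successively (\<lambda>a b. (a, b) \<in> ?r) ?p" using zs(3) ab by (auto simp: zs_def successively_append_iff)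
        have sub: "set ?p \<subseteq> ?VM - D" using c cp ab by auto
        have "(hd ?p, last ?p) \<in> ?R\<^sup>*"
        proof (rule successively_rtrancl[OF suc])
          show "(a, b) \<in> ?R" if "(a, b) \<in> ?r" "a \<in> set ?p" "b \<in> set ?p" for a b
            using that(1) subsetD[OF sub that(2)] subsetD[OF sub that(3)] by simp
        qed simp
        moreover have hp: "hd ?p = t" using zs(2) ab by (cases as) (auto simp: zs_def)
        moreover have "(y, t) \<in> ?R"
        proof -
          have "t \<in> set ?p" using hp by (metis list.set_sel(1) snoc_eq_iff_butlast)
          then show ?thesis using t(1) sub Q(3) cy c by auto
        qed
        ultimately have "(y, z) \<in> ?R\<^sup>*" by (auto intro: converse_rtrancl_into_rtrancl)
        then have "(z, y) \<in> ?R\<^sup>*" using symR by (auto dest: symD)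
        then show ?thesis using Q(3) cy c(1) by (intro bexI[of _ y]) auto
      qed
    qed
    show ?thesis unfolding connected_graph_def sgraph.sel
    proof (intro conjI ballI)
      show "?VM - D \<noteq> {}" using base by blast
      fix u v assume "u \<in> ?VM - D" "v \<in> ?VM - D"
      then obtain a b where "a \<in> ?VQ - D" "(u, a) \<in> ?R\<^sup>*" "b \<in> ?VQ - D" "(v, b) \<in> ?R\<^sup>*" using att by meson
      moreover have "(a, b) \<in> ?R\<^sup>*" using base calculation by blast
      moreover have "(b, v) \<in> ?R\<^sup>*" using symR calculation(4) by (auto dest: symD)
      ultimately show "(u, v) \<in> ?R\<^sup>*" by (meson rtrancl_trans)
    qed
  qed
  have "two_connected ?M" unfolding two_connected_def
  proof (intro conjI ballI)
    have "card ?VQ \<ge> 3" using Q(2) by (simp add: two_connected_def)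
    also have "card ?VQ \<le> card ?VM" using finVM by (intro card_mono) auto
    finally show "card (verts ?M) \<ge> 3" by simp
    show "connected_graph ?M" using main[of "{}"] by simp
    fix c assume "c \<in> verts ?M"
    then have "c \<in> ?VM" by simp
    moreover have "induced_subgraph ?M (verts ?M - {c}) = SGraph (?VM - {c}) {e \<in> edges C. e \<subseteq> ?VM - {c}}"
      by (auto simp: induced_subgraph_def)
    ultimately show "connected_graph (induced_subgraph ?M (verts ?M - {c}))" using main[of "{c}"] by auto
  qed
  moreover have "subgraph ?M C" using finVM VMC C by (auto simp: subgraph_def simple_graph_def)
  moreover have "subgraph Q ?M" using sQ QC eQ by (auto simp: subgraph_def)
  moreover have "{y, t} \<in> edges ?M"
  proof -
    have "t \<in> set zs" using zs(2) by (metis zs_def list.set_sel(1) snoc_eq_iff_butlast)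
    then show ?thesis using t(1) Q(3) us(2) by (auto simp: zs_def)
  qed
  ultimately show ?thesis by blast
qed

lemma triangle_two_connected:
  assumes "a \<noteq> b" "b \<noteq> c" "a \<noteq> c"
  shows "two_connected (SGraph {a, b, c} {{a, b}, {b, c}, {a, c}})" (is "two_connected ?T")
proof -
  have conn: "connected_graph (SGraph L Es)" if L: "L \<noteq> {}" and all: "\<And>x y. x \<in> L \<Longrightarrow> y \<in> L \<Longrightarrow> x \<noteq> y \<Longrightarrow> {x, y} \<in> Es" for L :: "'a set" and Es
  proof (rule connected_graphI[OF L])
    fix A assume A: "A \<subseteq> L" "A \<noteq> {}" "A \<noteq> L"
    then obtain x y where "x \<in> A" "y \<in> L - A" by blast
    then show "\<exists>a\<in>A. \<exists>b\<in>L - A. {a, b} \<in> Es" using all[of x y] A by blast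
  qed
  show ?thesis unfolding two_connected_def
  proof (intro conjI ballI)
    show "card (verts ?T) \<ge> 3" using assms by simp
    show "connected_graph ?T" by (rule conn) (auto simp: insert_commute)
    fix v assume "v \<in> verts ?T"
    then have v: "v \<in> {a, b, c}" by simp
    show "connected_graph (induced_subgraph ?T (verts ?T - {v}))"
      unfolding induced_subgraph_def sgraph.sel
    proof (rule conn)
      show "{a, b, c} \<inter> ({a, b, c} - {v}) \<noteq> {}" using assms by auto
      fix x y assume "x \<in> {a, b, c} \<inter> ({a, b, c} - {v})" "y \<in> {a, b, c} \<inter> ({a, b, c} - {v})" "x \<noteq> y"
      then show "{x, y} \<in> {e \<in> {{a, b}, {b, c}, {a, c}}. e \<subseteq> {a, b, c} - {v}}"
        by (auto simp: insert_commute)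
    qed
  qed
qed

section \<open>Components of the host graph\<close>

definition reach :: "'a set set \<Rightarrow> 'a \<Rightarrow> 'a set" where
  "reach E v = {u. (v, u) \<in> {(x, y). {x, y} \<in> E}\<^sup>*}"

lemma reach_self: "v \<in> reach E v"
  by (simp add: reach_def)

lemma reach_step: "a \<in> reach E v \<Longrightarrow> {a, b} \<in> E \<Longrightarrow> b \<in> reach E v"
  unfolding reach_def by (auto intro: rtrancl_into_rtrancl)

lemma reach_component:
  assumes H: "simple_graph H" and v: "v \<in> verts H"
  shows "component (SGraph (reach (edges H) v) {e \<in> edges H. e \<subseteq> reach (edges H) v}) H" (is "component ?C H")
proof -
  let ?R = "reach (edges H) v"
  have RH: "?R \<subseteq> verts H"
  proof
    fix u assume "u \<in> ?R"
    then have "(v, u) \<in> {(x, y). {x, y} \<in> edges H}\<^sup>*" by (simp add: reach_def)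
    then show "u \<in> verts H" by induction (use v H in \<open>auto simp: simple_graph_def\<close>)
  qed
  let ?rC = "{(x, y). {x, y} \<in> edges ?C}"
  have from_v: "(v, u) \<in> ?rC\<^sup>*" if "u \<in> ?R" for u
  proof -
    have "(v, u) \<in> {(x, y). {x, y} \<in> edges H}\<^sup>*" using that by (simp add: reach_def)
    then have "(v, u) \<in> ?rC\<^sup>* \<and> u \<in> ?R"
    proof induction
      case base
      then show ?case using reach_self by simp
    next
      case (step y z)
      then have "{y, z} \<in> edges H" "y \<in> ?R" by auto
      then have "z \<in> ?R" using reach_step by metis
      then have "(y, z) \<in> ?rC" using step by auto
      then show ?case using step \<open>z \<in> ?R\<close> by (meson rtrancl.rtrancl_into_rtrancl)
    qed
    then show ?thesis by blast
  qed
  have sym: "sym (?rC\<^sup>*)" by (rule sym_rtrancl) (auto simp: sym_def insert_commute)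
  have conn: "connected_graph ?C" unfolding connected_graph_def
  proof (intro conjI ballI)
    show "verts ?C \<noteq> {}" using reach_self[of v "edges H"] by auto
    fix a b assume ab: "a \<in> verts ?C" "b \<in> verts ?C"
    have "(v, a) \<in> ?rC\<^sup>*" "(v, b) \<in> ?rC\<^sup>*" using from_v ab by simp_all
    then have "(a, v) \<in> ?rC\<^sup>*" using sym by (auto dest: symD)
    then show "(a, b) \<in> ?rC\<^sup>*" using \<open>(v, b) \<in> ?rC\<^sup>*\<close> by (rule rtrancl_trans)
  qed
  have sub: "subgraph ?C H" using H RH by (auto simp: subgraph_def simple_graph_def intro: finite_subset)
  have "C' = ?C" if C': "subgraph C' H" "connected_graph C'" "subgraph ?C C'" for C'
  proof -
    have VC: "?R \<subseteq> verts C'" "{e \<in> edges H. e \<subseteq> ?R} \<subseteq> edges C'" using C'(3) by (auto simp: subgraph_def)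
    have EH: "edges C' \<subseteq> edges H" using C'(1) by (auto simp: subgraph_def)
    have "verts C' \<subseteq> ?R"
    proof
      fix u assume u: "u \<in> verts C'"
      have "v \<in> verts C'" using VC reach_self[of v "edges H"] by blast
      then have "(v, u) \<in> {(x, y). {x, y} \<in> edges C'}\<^sup>*" using C'(2) u by (auto simp: connected_graph_def)
      moreover have "{(x, y). {x, y} \<in> edges C'} \<subseteq> {(x, y). {x, y} \<in> edges H}" using EH by blast
      ultimately have "(v, u) \<in> {(x, y). {x, y} \<in> edges H}\<^sup>*" using rtrancl_mono by blast
      then show "u \<in> ?R" by (simp add: reach_def)
    qed
    then have vR: "verts C' = ?R" using VC by blast
    have "e \<subseteq> verts C'" if "e \<in> edges C'" for e using C'(1) that by (auto simp: subgraph_def simple_graph_def)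
    then have "edges C' = {e \<in> edges H. e \<subseteq> ?R}" using VC EH vR by blast
    then show ?thesis using vR by (simp add: sgraph.expand)
  qed
  then show ?thesis using conn sub unfolding component_def by blast
qed

text \<open>Suppose \<open>F\<close> is not reducible. In a component of maximum degree at most
  three, only vertices of degree two remain, and a cycle longer than a triangle contains a reducible
  path. In the other case \<open>leaf_block\<close> finds a triangle \<open>u\<close>,
  \<open>u'\<close>, \<open>y\<close> with exits only at \<open>y\<close>. If it is not a whole
  component of \<open>F\<close>, then \<open>y\<close> has degree at least four, so an edge
  \<open>yt\<close> leaves the block of this triangle. Beyond \<open>yt\<close> lies another
  triangle, in the same block by uniqueness, and an ear through \<open>yt\<close> contradicts the
  maximality of the block.\<close>

theorem family_manageable:
  assumes H: "H \<in> family_G" and FH: "F \<subseteq> edges H"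
  shows "manageable F"
proof (cases "reducible F")
  case True
  then show ?thesis by (simp add: manageable_def)
next
  case nred: False
  have sH: "simple_graph H" using H by (auto simp: family_G_def)
  have g: "graph F" by (rule graph_subset[OF simple_graph_graph[OF sH] FH])
  have finF: "finite (nbhd F v)" for v by (rule finite_nbhd[OF g])
  have irr: "v \<notin> nbhd F v" for v by (rule nbhd_irrefl[OF g])
  have finV: "finite (verts H)" using sH by (simp add: simple_graph_def)
  have eV: "e \<subseteq> verts H" if "e \<in> F" for e using that FH sH by (auto simp: simple_graph_def)
  have noleaf: "card (nbhd F x) \<noteq> 1" for x
  proof
    assume "card (nbhd F x) = 1"
    then obtain b where "nbhd F x = {b}" by (meson card_1_singletonE)
    then show False using nred unfolding reducible_def by blast
  qed
  have bound: "card (nbhd F v \<inter> L) \<le> 3" if tc: "two_connected (SGraph L {e \<in> F. e \<subseteq> L})" and v: "v \<in> L" for L v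
  proof -
    let ?M = "SGraph L {e \<in> F. e \<subseteq> L}"
    have c3: "card L \<ge> 3" and conn: "connected_graph ?M" using tc by (auto simp: two_connected_def)
    have finL: "finite L" using c3 by (intro card_ge_0_finite) simp
    have "L \<subseteq> verts H"
    proof
      fix x assume x: "x \<in> L"
      have "L \<noteq> {x}" using c3 by auto
      then obtain y where "y \<in> L" "y \<noteq> x" using x by blast
      then obtain w where "{x, w} \<in> {e \<in> F. e \<subseteq> L}" using connected_has_edge[OF conn x] by blast
      then show "x \<in> verts H" using eV by blast
    qed
    then have "subgraph ?M H" using FH finL sH by (auto simp: subgraph_def simple_graph_def)
    then have "card {e \<in> edges ?M. v \<in> e} \<le> 3" using two_connected_degree[OF H _ tc] v by simp
    moreover have gM: "graph {e \<in> F. e \<subseteq> L}" by (rule graph_subset[OF g]) auto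
    have "card {e \<in> {e \<in> F. e \<subseteq> L}. v \<in> e} = card (nbhd {e \<in> F. e \<subseteq> L} v)" by (rule card_nbhd[OF gM])
    moreover have "nbhd {e \<in> F. e \<subseteq> L} v = nbhd F v \<inter> L" using v by (auto simp: nbhd_def)
    ultimately show ?thesis by simp
  qed
  have "triangle_at F v" if v: "nbhd F v \<noteq> {}" for v
  proof -
    obtain v' where v': "{v', v} \<in> F" using v by (auto simp: nbhd_def)
    then have vH: "v \<in> verts H" using eV by blast
    let ?R = "reach (edges H) v"
    let ?C = "SGraph ?R {e \<in> edges H. e \<subseteq> ?R}"
    have comp: "component ?C H" by (rule reach_component[OF sH vH])
    have sC: "simple_graph ?C" using comp by (auto simp: component_def subgraph_def)
    have CH: "subgraph ?C H" using comp by (auto simp: component_def)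
    have inC: "b \<in> ?R \<and> {a, b} \<in> edges ?C" if ab: "a \<in> ?R" "{a, b} \<in> F" for a b
    proof -
      have "{a, b} \<in> edges H" using ab FH by blast
      moreover from this have "b \<in> ?R" by (rule reach_step[OF ab(1)])
      ultimately show ?thesis using ab(1) by simp
    qed
    have inR: "b \<in> ?R" if "a \<in> ?R" "b \<in> nbhd F a" for a b
      using inC[of a b] that nbhd_edge(2)[of b F a] by blast
    have "max_degree ?C \<le> 3 \<or> (\<exists>\<^sub>\<le>\<^sub>1 B. block B ?C \<and> contains_triangle B)"
      using H comp unfolding family_G_def by blast
    then show ?thesis
    proof
      assume md: "max_degree ?C \<le> 3"
      have deg3: "card (nbhd F u) \<le> 3" if u: "u \<in> ?R" for u
      proof -
        have "card (nbhd F u) = card {e \<in> F. u \<in> e}" by (rule card_nbhd[OF g, symmetric])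
        also have "\<dots> \<le> degree ?C u" unfolding degree_def
        proof (rule card_mono)
          show "finite {e \<in> edges ?C. u \<in> e}" by (rule finite_subset[OF _ finite_edges[OF sC]]) blast
          show "{e \<in> F. u \<in> e} \<subseteq> {e \<in> edges ?C. u \<in> e}"
          proof
            fix e assume e: "e \<in> {e \<in> F. u \<in> e}"
            then obtain a b where ab: "e = {a, b}" using graph_edgeE[OF g] by blast
            then obtain w where "e = {u, w}" using e by (auto simp: insert_commute)
            then show "e \<in> {e \<in> edges ?C. u \<in> e}" using inC[OF u, of w] e by simp
          qed
        qed
        also have "\<dots> \<le> max_degree ?C"
          unfolding max_degree_def using sC u by (intro Max_ge) (auto simp: simple_graph_def)
        finally show ?thesis using md by linarith
      qed
      have deg2: "card (nbhd F u) = 2" if u: "u \<in> ?R" "nbhd F u \<noteq> {}" for u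
      proof (rule ccontr)
        assume "card (nbhd F u) \<noteq> 2"
        moreover have "card (nbhd F u) \<noteq> 0" using u(2) finF by simp
        ultimately have "card (nbhd F u) = 3" using deg3[OF u(1)] noleaf[of u] by linarith
        then obtain b1 b2 b3 where b: "nbhd F u = {b1, b2, b3}" "b1 \<noteq> b2" "b1 \<noteq> b3" "b2 \<noteq> b3" by (auto simp: card_3_iff)
        have bR: "b1 \<in> ?R" "b2 \<in> ?R" using inR[OF u(1)] b by auto
        have dist: "distinct [b1, b2, b3]" using b by auto
        have "\<exists>b T. trapped_triangle F u b T" using nred b(1) dist deg3[OF bR(1)] deg3[OF bR(2)] unfolding reducible_def by blast
        then obtain b T where trapped_triangle: "trapped_triangle F u b T" by blast
        have T: "clique3 F T" "b \<in> nbhd F u" "card (nbhd F b \<inter> T) \<ge> 2" using trapped_triangle by (auto simp: trapped_triangle_def)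
        have bR: "b \<in> ?R" by (rule inR[OF u(1) T(2)])
        have "nbhd F b \<inter> T \<noteq> {}" using T(3) by (intro notI) simp
        then obtain p where p: "p \<in> T" "p \<in> nbhd F b" by blast
        have pR: "p \<in> ?R" by (rule inR[OF bR p(2)])
        have "card (nbhd F t) \<le> 3" if t: "t \<in> T" for t
        proof (cases "t = p")
          case True then show ?thesis using deg3[OF pR] by simp
        next
          case False
          then have "t \<in> nbhd F p" using T(1) t p(1) by (auto simp: clique3_def nbhd_def)
          then show ?thesis using deg3 inR[OF pR] by blast
        qed
        then show False using trapped_triangle_reducible[OF g trapped_triangle] nred by blast
      qed
      have vR: "v \<in> ?R" by (rule reach_self)
      obtain v1 v3 where v13: "nbhd F v = {v1, v3}" "v1 \<noteq> v3" using deg2[OF vR v] by (meson card_2_iff)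
      have R13: "v1 \<in> ?R" "v3 \<in> ?R" using inR[OF vR] v13 by auto
      have vn: "v \<in> nbhd F v1" "v \<in> nbhd F v3" using v13 nbhd_sym[of v F v1] nbhd_sym[of v F v3] by auto
      have c1: "card (nbhd F v1) = 2" using deg2[OF R13(1)] vn by blast
      have c3: "card (nbhd F v3) = 2" using deg2[OF R13(2)] vn by blast
      have "card (nbhd F v3 - {v}) = 1" using vn(2) c3 finF by simp
      then obtain w where "nbhd F v3 - {v} = {w}" by (meson card_1_singletonE)
      then have w: "nbhd F v3 = {v, w}" "w \<noteq> v" using vn(2) by auto
      have "w = v1"
      proof (rule ccontr)
        assume "w \<noteq> v1"
        then have "distinct [v1, v, v3, w]" using v13(2) w irr[of v1] irr[of v3] vn by auto
        then have "reducible F" using v13(1) w(1) c1 unfolding reducible_def by (metis order_refl)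
        then show False using nred by blast
      qed
      then have "v3 \<in> nbhd F v1" using w nbhd_sym[of v1 F v3] by auto
      moreover have "v \<noteq> v3" using irr[of v3] vn(2) by auto
      ultimately have "nbhd F v1 = {v, v3}" using vn(1) c1 card_seteq[OF finF, of "{v, v3}" v1] by simp
      then show ?thesis unfolding triangle_at_def using v13 w \<open>w = v1\<close> by blast
    next
      assume uniq: "\<exists>\<^sub>\<le>\<^sub>1 B. block B ?C \<and> contains_triangle B"
      have tri_block: "\<exists>Q. block Q ?C \<and> contains_triangle Q \<and> {a, b, c} \<subseteq> verts Q"
        if a: "a \<in> ?R" and abc: "{a, b} \<in> F" "{b, c} \<in> F" "{a, c} \<in> F" "a \<noteq> b" "b \<noteq> c" "a \<noteq> c" for a b c
      proof -
        let ?T = "SGraph {a, b, c} {{a, b}, {b, c}, {a, c}}"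
        have R: "b \<in> ?R" "c \<in> ?R" using inC[OF a] abc by blast+
        have "subgraph ?T ?C" using inC[OF a abc(1)] inC[OF R(1) abc(2)] inC[OF a abc(3)] a R abc(4-6)
          by (auto simp: subgraph_def simple_graph_def)
        moreover have "two_connected ?T" by (rule triangle_two_connected[OF abc(4-6)])
        ultimately obtain Q where Q: "block Q ?C" "subgraph ?T Q" using two_connected_block[OF sC] by blast
        have "is_triangle ?T" unfolding is_triangle_def using abc(4-6) by blast
        then have "contains_triangle Q" unfolding contains_triangle_def using Q(2) by blast
        then show ?thesis using Q by (auto simp: subgraph_def)
      qed
      have leafX: "\<exists>u u' y. u \<in> X \<and> u' \<in> X \<and> u \<noteq> u' \<and> u \<noteq> y \<and> u' \<noteq> y \<and> nbhd F u = {u', y} \<and> nbhd F u' = {u, y}"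
        if "finite X" "X \<noteq> {}" "s \<notin> X" "\<And>x. x \<in> X \<Longrightarrow> nbhd F x \<subseteq> insert s X" "\<And>x. x \<in> X \<Longrightarrow> nbhd F x \<noteq> {}" for X s
        by (rule leaf_block[OF g that bound nred])
      define K where "K = reach F v"
      have KR: "K \<subseteq> ?R"
      proof
        fix u assume "u \<in> K"
        then have "(v, u) \<in> {(x, y). {x, y} \<in> F}\<^sup>*" by (simp add: K_def reach_def)
        then show "u \<in> ?R"
        proof induction
          case base
          show ?case by (rule reach_self)
        next
          case (step p q)
          then show ?case using inC[of p q] by simp
        qed
      qed
      have RV: "?R \<subseteq> verts H" using CH by (simp add: subgraph_def)
      have finK: "finite K" using KR RV finV by (meson finite_subset)
      have nbK: "nbhd F x \<subseteq> K" if "x \<in> K" for x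
        using that reach_step[of x F v] nbhd_edge(2)[of _ F x] by (auto simp: K_def)
      \<comment> \<open>\<open>v\<close> itself serves as the attachment vertex: it trivially
        separates \<open>K - {v}\<close> from everything else.\<close>
      have "\<exists>u u' y. u \<in> K - {v} \<and> u' \<in> K - {v} \<and> u \<noteq> u' \<and> u \<noteq> y \<and> u' \<noteq> y \<and> nbhd F u = {u', y} \<and> nbhd F u' = {u, y}"
      proof (rule leafX[of _ v])
        show "finite (K - {v})" using finK by simp
        have vK: "v \<in> K" by (simp add: K_def reach_self)
        obtain x where "x \<in> nbhd F v" using v by blast
        then have "x \<in> K" "x \<noteq> v" using nbK[OF vK] irr by blast+
        then show "K - {v} \<noteq> {}" by blast
        show "v \<notin> K - {v}" by simp
        show "nbhd F x \<subseteq> insert v (K - {v})" if "x \<in> K - {v}" for x using nbK that by blast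
        show "nbhd F x \<noteq> {}" if x: "x \<in> K - {v}" for x
        proof -
          have "(v, x) \<in> {(x, y). {x, y} \<in> F}\<^sup>*" "x \<noteq> v" using x by (auto simp: K_def reach_def)
          then obtain y where "{y, x} \<in> F" by (auto elim: rtranclE)
          then show ?thesis by (auto simp: nbhd_def)
        qed
      qed
      then obtain u u' y where u: "u \<in> K" "u' \<in> K" "u \<noteq> u'" "u \<noteq> y" "u' \<noteq> y" "nbhd F u = {u', y}" "nbhd F u' = {u, y}" by blast
      have uR: "u \<in> ?R" "u' \<in> ?R" using u KR by auto
      have eu: "{u, u'} \<in> F" "{u', y} \<in> F" "{u, y} \<in> F"
        using u(6,7) nbhd_edge(2)[of u' F u] nbhd_edge(2)[of y F u'] nbhd_edge(2)[of y F u] by auto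
      have yR: "y \<in> ?R" using inC[OF uR(1) eu(3)] by blast
      have yn: "{u, u'} \<subseteq> nbhd F y" using eu nbhd_edge(1)[of u F y] nbhd_edge(1)[of u' F y] by simp
      have c2: "card {u, u'} = 2" using u(3) by simp
      show ?thesis
      proof (cases "nbhd F y = {u, u'}")
        case True
        have "x \<in> {u, u', y}" if "(u, x) \<in> {(x, y). {x, y} \<in> F}\<^sup>*" for x
          using that
        proof induction
          case (step p q)
          then have "q \<in> nbhd F p" by (simp add: nbhd_edge(2))
          then show ?case using step(3) True u(6,7) by auto
        qed simp
        moreover have "(u, v) \<in> {(x, y). {x, y} \<in> F}\<^sup>*"
        proof -
          have "sym ({(x, y). {x, y} \<in> F}\<^sup>*)" by (rule sym_rtrancl) (auto simp: sym_def insert_commute)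
          moreover have "(v, u) \<in> {(x, y). {x, y} \<in> F}\<^sup>*" using u(1) by (simp add: K_def reach_def)
          ultimately show ?thesis by (auto dest: symD)
        qed
        ultimately have "v \<in> {u, u', y}" by blast
        then consider "v = u" | "v = u'" | "v = y" by blast
        then show ?thesis
        proof cases
          case 1
          have "nbhd F v = {u', y}" "nbhd F u' = {v, y}" "nbhd F y = {v, u'}" using 1 True u(6,7) by simp_all
          then show ?thesis unfolding triangle_at_def using u(5) by blast
        next
          case 2
          have "nbhd F v = {u, y}" "nbhd F u = {v, y}" "nbhd F y = {v, u}" using 2 True u(6,7) by (simp_all add: insert_commute)
          then show ?thesis unfolding triangle_at_def using u(4) by blast
        next
          case 3
          have "nbhd F v = {u, u'}" "nbhd F u = {v, u'}" "nbhd F u' = {v, u}" using 3 True u(6,7) by (simp_all add: insert_commute)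
          then show ?thesis unfolding triangle_at_def using u(3) by blast
        qed
      next
        case False
        \<comment> \<open>With degree three, \<open>y\<close> would be the centre of a reducible
          star, since \<open>uu'\<close> is an edge and \<open>u\<close>, \<open>u'\<close> have
          degree two.\<close>
        have y4: "card (nbhd F y) \<ge> 4"
        proof (rule ccontr)
          assume "\<not> ?thesis"
          then have le: "card (nbhd F y) \<le> 3" by simp
          obtain b3 where b3: "b3 \<in> nbhd F y" "b3 \<notin> {u, u'}" using False yn by blast
          have "card {u, u', b3} = 3" using b3(2) u(3) by auto
          then have "nbhd F y = {u, u', b3}" using card_seteq[OF finF, of "{u, u', b3}" y] le yn b3(1) by simp
          moreover have "distinct [u, u', b3]" using b3(2) u(3) by auto
          moreover have "card (nbhd F u) \<le> 3" "card (nbhd F u') \<le> 3" using u by simp_all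
          ultimately have "reducible F" using eu(1) unfolding reducible_def by blast
          then show False using nred by blast
        qed
        obtain Q where Q: "block Q ?C" "contains_triangle Q" "{u, u', y} \<subseteq> verts Q"
          using tri_block[OF uR(1) eu u(3,5,4)] by blast
        have QC: "subgraph Q ?C" "two_connected Q" using Q(1) by (auto simp: block_def)
        have QH: "subgraph Q H" using QC(1) CH subgraph_trans by blast
        have yQ: "y \<in> verts Q" using Q(3) by simp
        have "\<exists>t. {y, t} \<in> F \<and> {y, t} \<notin> edges Q"
        proof (rule ccontr)
          assume neg: "\<not> ?thesis"
          have "{e \<in> F. y \<in> e} \<subseteq> {e \<in> edges Q. y \<in> e}"
          proof
            fix e assume e: "e \<in> {e \<in> F. y \<in> e}"
            then obtain a b where ab: "e = {a, b}" using graph_edgeE[OF g] by blast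
            then obtain w where "e = {y, w}" using e by (auto simp: insert_commute)
            then show "e \<in> {e \<in> edges Q. y \<in> e}" using neg e by auto
          qed
          moreover have "finite (edges Q)" using QC(1) finite_edges by (auto simp: subgraph_def)
          ultimately have "card {e \<in> F. y \<in> e} \<le> card {e \<in> edges Q. y \<in> e}" by (intro card_mono) auto
          then show False using two_connected_degree[OF H QH QC(2) yQ] y4 card_nbhd[OF g, of y] by simp
        qed
        then obtain t where t: "{y, t} \<in> F" "{y, t} \<notin> edges Q" by blast
        have ty: "t \<noteq> y" using t(1) graph_not_self[OF g, of y] by auto
        have tR: "t \<in> ?R" using inC[OF yR t(1)] by blast
        let ?r = "{(a, b). {a, b} \<in> F \<and> a \<noteq> y \<and> b \<noteq> y}"
        let ?rC = "{(a, b). {a, b} \<in> edges ?C \<and> a \<noteq> y \<and> b \<noteq> y}"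
        \<comment> \<open>What \<open>t\<close> reaches in \<open>F\<close> without passing
          \<open>y\<close>. It is attached through \<open>y\<close> only, so
          \<open>leaf_block\<close> applies to it.\<close>
        define X where "X = {w. (t, w) \<in> ?r\<^sup>*}"
        have XX: "w \<in> ?R \<and> w \<noteq> y \<and> (t, w) \<in> ?rC\<^sup>*" if "w \<in> X" for w
        proof -
          have "(t, w) \<in> ?r\<^sup>*" using that by (simp add: X_def)
          then show ?thesis
          proof induction
            case base
            then show ?case using tR ty by simp
          next
            case (step p q)
            then have pq: "{p, q} \<in> F" "p \<noteq> y" "q \<noteq> y" "p \<in> ?R" by auto
            then have q: "q \<in> ?R" "{p, q} \<in> edges ?C" using inC[OF pq(4,1)] by blast+
            then have "(p, q) \<in> ?rC" using pq by blast
            then show ?case using step(3) q(1) pq(3) by (meson rtrancl.rtrancl_into_rtrancl)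
          qed
        qed
        have "\<exists>u u' z. u \<in> X \<and> u' \<in> X \<and> u \<noteq> u' \<and> u \<noteq> z \<and> u' \<noteq> z \<and> nbhd F u = {u', z} \<and> nbhd F u' = {u, z}"
        proof (rule leafX[of _ y])
          have "X \<subseteq> verts H" using XX RV by blast
          then show "finite X" using finV by (meson finite_subset)
          show "X \<noteq> {}" by (auto simp: X_def)
          show "y \<notin> X" using XX by blast
          show "nbhd F x \<subseteq> insert y X" if x: "x \<in> X" for x
          proof
            fix w assume w: "w \<in> nbhd F x"
            show "w \<in> insert y X"
            proof (cases "w = y")
              case False
              then have "(x, w) \<in> ?r" using w XX[OF x] nbhd_edge(2)[of w F x] by blast
              then show ?thesis using x unfolding X_def by (auto intro: rtrancl_into_rtrancl)
            qed simp
          qed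
          show "nbhd F x \<noteq> {}" if x: "x \<in> X" for x
          proof (cases "x = t")
            case True
            then show ?thesis using t(1) nbhd_edge(1)[of y F t] by blast
          next
            case False
            then obtain p where "(p, x) \<in> ?r" using x unfolding X_def by (auto elim: rtranclE)
            then show ?thesis using nbhd_edge(1)[of p F x] by blast
          qed
        qed
        then obtain p p' z where p: "p \<in> X" "p \<noteq> p'" "p \<noteq> z" "p' \<noteq> z" "nbhd F p = {p', z}" "nbhd F p' = {p, z}" by blast
        have ep: "{p, p'} \<in> F" "{p', z} \<in> F" "{p, z} \<in> F"
          using p(5,6) nbhd_edge(2)[of p' F p] nbhd_edge(2)[of z F p'] nbhd_edge(2)[of z F p] by auto
        have pR: "p \<in> ?R" using XX[OF p(1)] by blast
        obtain Q' where Q': "block Q' ?C" "contains_triangle Q'" "{p, p', z} \<subseteq> verts Q'"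
          using tri_block[OF pR ep p(2,4,3)] by blast
        \<comment> \<open>Both triangles lie in the same block, so the walk from \<open>t\<close> to
          \<open>p\<close> comes back to \<open>Q\<close> without meeting \<open>y\<close>.\<close>
        have "Q' = Q" using Uniq_D[OF uniq, of Q' Q] Q Q' by blast
        then have pQ: "p \<in> verts Q" using Q'(3) by simp
        have "{y, t} \<in> edges ?C" using inC[OF yR t(1)] by blast
        then obtain M where M: "subgraph M ?C" "two_connected M" "subgraph Q M" "{y, t} \<in> edges M"
          using ear[OF sC QC yQ _ ty _ pQ] XX[OF p(1)] by blast
        have "M = Q" using Q(1) M(1-3) unfolding block_def by blast
        then show ?thesis using M(4) t(2) by simp
      qed
    qed
  qed
  then show ?thesis unfolding manageable_def by blast
qed

section \<open>The main theorem\<close>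

lemma path_edges_nth: "set_mset (path_edges xs) = {{xs ! i, xs ! Suc i} | i. Suc i < length xs}"
proof (induction xs rule: path_edges.induct)
  case (1 x y zs)
  have "{{(x # y # zs) ! i, (x # y # zs) ! Suc i} | i. Suc i < length (x # y # zs)} =
      insert {x, y} {{(y # zs) ! i, (y # zs) ! Suc i} | i. Suc i < length (y # zs)}" (is "?L = ?R")
  proof
    show "?L \<subseteq> ?R"
    proof
      fix e assume "e \<in> ?L"
      then obtain i where i: "e = {(x # y # zs) ! i, (x # y # zs) ! Suc i}" "Suc i < length (x # y # zs)" by blast
      then show "e \<in> ?R" by (cases i) auto
    qed
    show "?R \<subseteq> ?L"
    proof
      fix e assume "e \<in> ?R"
      then consider "e = {x, y}" | i where "e = {(y # zs) ! i, (y # zs) ! Suc i}" "Suc i < length (y # zs)" by blast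
      then show "e \<in> ?L"
      proof cases
        case 1 then show ?thesis by (intro CollectI exI[of _ 0]) simp
      next
        case 2 then show ?thesis by (intro CollectI exI[of _ "Suc i"]) simp
      qed
    qed
  qed
  then show ?case using 1 by simp
qed auto

text \<open>One-vertex lists are dropped, and passing from lists to a set of paths can only lower
  the number. Halving the number of ends then gives the bound.\<close>

lemma pn_le_of_gallai:
  assumes G: "simple_graph G" and gal: "gallai (verts G) (edges G)"
  shows "pn G \<le> card (verts G) div 2"
proof -
  let ?V = "verts G" and ?E = "edges G"
  have finV: "finite ?V" and finE: "finite ?E" using G finite_edges by (auto simp: simple_graph_def)
  obtain f where f: "realizable ?E f" "\<forall>v. v \<notin> ?V \<longrightarrow> f v = 0" "sum f ?V \<le> card ?V"
    using gal by (auto simp: gallai_def)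
  obtain ps where r: "realizes ps ?E f" using f(1) by (auto simp: realizable_def)
  have len: "2 * length ps \<le> card ?V" using realizes_sum[OF r finV] f by simp
  define P where "P p = SGraph (set p) (set_mset (path_edges p))" for p :: "'a list"
  define D where "D = P ` {p \<in> set ps. length p \<ge> 2}"
  have ok: "p \<noteq> []" "distinct p" if "p \<in> set ps" for p using r that by (auto simp: realizes_def)
  have inE: "e \<in> ?E" if "p \<in> set ps" "e \<in># path_edges p" for p e
  proof -
    obtain i where "i < length ps" "p = ps ! i" using \<open>p \<in> set ps\<close> by (metis in_set_conv_nth)
    then show ?thesis using path_edge_in[OF r _ _ finE] that(2) by blast
  qed
  have eV: "e \<subseteq> ?V \<and> card e = 2" if "e \<in> ?E" for e using G that by (auto simp: simple_graph_def)
  have "path_decomposition D G" unfolding path_decomposition_def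
  proof (intro conjI ballI impI)
    show "finite D" by (simp add: D_def)
    fix p assume "p \<in> D"
    then obtain xs where xs: "xs \<in> set ps" "length xs \<ge> 2" "p = P xs" by (auto simp: D_def)
    show "is_path p" unfolding is_path_def xs(3) P_def path_edges_nth
      using ok[OF xs(1)] by (intro exI[of _ xs]) simp
    have "set xs \<subseteq> ?V"
    proof
      fix v assume "v \<in> set xs"
      then obtain e where "e \<in># path_edges xs" "v \<in> e" using path_edges_cover[OF xs(2)] by blast
      then show "v \<in> ?V" using inE[OF xs(1)] eV by blast
    qed
    then show "subgraph p G" unfolding subgraph_def simple_graph_def xs(3) P_def sgraph.sel
      using inE[OF xs(1)] eV path_edges_subset by (auto dest: path_edges_subset)
  next
    fix p q assume "p \<in> D" "q \<in> D" and ne: "p \<noteq> q"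
    then obtain xs ys where xs: "xs \<in> set ps" "p = P xs" and ys: "ys \<in> set ps" "q = P ys" by (auto simp: D_def)
    obtain i j where ij: "i < length ps" "xs = ps ! i" "j < length ps" "ys = ps ! j"
      using xs ys by (metis in_set_conv_nth)
    have "i \<noteq> j" using ij xs ys ne by auto
    show "edges p \<inter> edges q = {}"
    proof (rule ccontr)
      assume "edges p \<inter> edges q \<noteq> {}"
      then obtain e where "e \<in># path_edges xs" "e \<in># path_edges ys" using xs ys by (auto simp: P_def)
      then show False using path_edge_unique[OF r ij(1,3) \<open>i \<noteq> j\<close>] ij by simp
    qed
  next
    have 1: "set_mset (\<Sum>p\<leftarrow>qs. path_edges p) = (\<Union>p\<in>set qs. set_mset (path_edges p))" for qs :: "'a list list"
      by (induction qs) auto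
    have "set_mset (\<Sum>p\<leftarrow>ps. path_edges p) = ?E" using r finE by (simp add: realizes_def)
    then have 2: "(\<Union>p\<in>set ps. set_mset (path_edges p)) = ?E" using 1 by simp
    have 3: "length xs \<ge> 2" if "e \<in># path_edges xs" for e and xs :: "'a list"
      using that by (cases xs rule: path_edges.cases) auto
    have "(\<Union>p\<in>D. edges p) = (\<Union>p\<in>set ps. set_mset (path_edges p))"
      unfolding D_def P_def using 3 by auto
    then show "(\<Union>p\<in>D. edges p) = ?E" using 2 by simp
  qed
  then have "pn G \<le> card D" unfolding pn_def by (intro Least_le) blast
  also have "card D \<le> card {p \<in> set ps. length p \<ge> 2}" unfolding D_def by (rule card_image_le) simp
  also have "\<dots> \<le> card (set ps)" by (intro card_mono) auto
  also have "\<dots> \<le> length ps" by (rule card_length)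
  finally show ?thesis using len by linarith
qed

lemma degree_nbhd: "simple_graph G \<Longrightarrow> degree G v = card (nbhd (edges G) v)"
  unfolding degree_def by (rule card_nbhd[OF simple_graph_graph])

text \<open>A nonempty closed set of vertices of a connected graph contains all its vertices, so
  \<open>C\<close> is the whole vertex set and \<open>T\<close> the set of even vertices.\<close>

lemma SET_graph_of_component:
  assumes G: "simple_graph G" "connected_graph G" and sp: "SET_component (edges G) C T"
  shows "SET_graph G"
proof -
  let ?E = "edges G"
  have T: "clique3 ?E T" "T \<subseteq> C" "closed_in ?E C" "\<And>v. v \<in> T \<Longrightarrow> even_vertex ?E v"
    "\<And>v. v \<in> C - T \<Longrightarrow> \<not> even_vertex ?E v \<and> card (nbhd ?E v \<inter> T) \<ge> 2"
    using sp by (auto simp: SET_component_def)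
  obtain a b c where abc: "T = {a, b, c}" "a \<noteq> b" "a \<noteq> c" "b \<noteq> c"
    using T(1) unfolding clique3_def card_3_iff by blast
  have eV: "e \<subseteq> verts G \<and> card e = 2" if "e \<in> ?E" for e using G that by (auto simp: simple_graph_def)
  have CV: "C \<subseteq> verts G" using SET_component_edge[OF sp] eV by blast
  have VC: "verts G \<subseteq> C"
  proof
    fix u assume u: "u \<in> verts G"
    have aC: "a \<in> C" using abc T(2) by blast
    then have "(a, u) \<in> {(x, y). {x, y} \<in> ?E}\<^sup>*" using G(2) u CV by (auto simp: connected_graph_def)
    then show "u \<in> C"
    proof induction
      case base
      show ?case by (rule aC)
    next
      case (step p q)
      then have pq: "{p, q} \<in> ?E" "{p, q} \<inter> C \<noteq> {}" by auto
      have "{p, q} \<subseteq> C" by (rule mp[OF bspec[OF T(3)[unfolded closed_in_def] pq(1)] pq(2)])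
      then show ?case by simp
    qed
  qed
  have even_vertex: "{v \<in> verts G. even (degree G v)} = T"
  proof -
    have "v \<in> verts G \<and> even_vertex ?E v \<longleftrightarrow> v \<in> T" for v
      using T(2) T(4)[of v] T(5)[of v] VC CV by blast
    then show ?thesis unfolding degree_nbhd[OF G(1)] by blast
  qed
  have tri: "{e \<in> ?E. e \<subseteq> T} = {{a, b}, {b, c}, {a, c}}"
  proof
    show "{e \<in> ?E. e \<subseteq> T} \<subseteq> {{a, b}, {b, c}, {a, c}}"
    proof
      fix e assume e: "e \<in> {e \<in> ?E. e \<subseteq> T}"
      then have "card e = 2" "e \<subseteq> {a, b, c}" using eV abc by auto
      then obtain x y where "e = {x, y}" "x \<noteq> y" "x \<in> {a, b, c}" "y \<in> {a, b, c}" by (auto simp: card_2_iff)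
      then show "e \<in> {{a, b}, {b, c}, {a, c}}" by (auto simp: insert_commute)
    qed
    show "{{a, b}, {b, c}, {a, c}} \<subseteq> {e \<in> ?E. e \<subseteq> T}"
      using T(1) abc unfolding clique3_def by auto
  qed
  have "verts G \<inter> T = {a, b, c}" using CV T(2) abc(1) by auto
  then have "EV G = SGraph {a, b, c} {{a, b}, {b, c}, {a, c}}"
    unfolding EV_def even_vertex induced_subgraph_def tri by simp
  then have "is_triangle (EV G)" unfolding is_triangle_def using abc by blast
  moreover have "card {u \<in> neighbors G v. even (degree G u)} \<ge> 2" if v: "v \<in> verts G" "odd (degree G v)" for v
  proof -
    have "v \<in> C - T" using v VC T(4) degree_nbhd[OF G(1)] by auto
    then have "card (nbhd ?E v \<inter> T) \<ge> 2" using T(5) by blast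
    moreover have "{u \<in> neighbors G v. even (degree G u)} = nbhd ?E v \<inter> T"
      unfolding neighbors_def nbhd_def using even_vertex eV by blast
    ultimately show ?thesis by simp
  qed
  ultimately show ?thesis unfolding SET_graph_def by blast
qed

theorem theorem1p5:
  fixes G :: "'a sgraph" and H :: "'b sgraph"
  assumes "simple_graph G" and "connected_graph G"
    and "H \<in> family_G" and "is_subgraph_of (EV G) H"
  shows "pn G \<le> card (verts G) div 2 \<or> SET_graph G"
proof (cases "no_SET_component (edges G)")
  case False
  then show ?thesis using SET_graph_of_component[OF assms(1,2)] by (auto simp: no_SET_component_def)
next
  case True
  let ?E = "edges G"
  have g: "graph ?E" by (rule simple_graph_graph[OF assms(1)])
  have eV: "e \<subseteq> verts G" if "e \<in> ?E" for e using assms(1) that by (auto simp: simple_graph_def)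
  obtain h where h: "inj_on h (verts (EV G))" "subgraph (image_graph h (EV G)) H"
    using assms(4) by (auto simp: is_subgraph_of_def)
  have EVe: "edges (EV G) = even_edges ?E"
    using eV degree_nbhd[OF assms(1)] by (auto simp: EV_def induced_subgraph_def even_edges_def)
  have EVv: "\<Union>(even_edges ?E) \<subseteq> verts (EV G)"
    using eV degree_nbhd[OF assms(1)] by (auto simp: EV_def induced_subgraph_def even_edges_def)
  \<comment> \<open>The family speaks about subgraphs of the host, so \<open>F\<close> is moved
    there by \<open>h\<close> and back by its inverse.\<close>
  have "manageable F" if F: "F \<subseteq> even_edges ?E" for F
  proof -
    let ?F = "(`) h ` F"
    have inj: "inj_on h (\<Union>F)" by (rule inj_on_subset[OF h(1)]) (use F EVv in blast)
    have "?F \<subseteq> (`) h ` edges (EV G)" by (rule image_mono) (use F EVe in simp)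
    also have "\<dots> \<subseteq> edges H" using h(2) by (simp add: subgraph_def image_graph_def)
    finally have FH: "?F \<subseteq> edges H" .
    have sH: "simple_graph H" using assms(3) by (auto simp: family_G_def)
    have gF: "graph ?F" by (rule graph_subset[OF simple_graph_graph[OF sH] FH])
    have "manageable ?F" by (rule family_manageable[OF assms(3) FH])
    moreover let ?k = "inv_into (\<Union>F) h"
    have UF: "\<Union>?F = h ` \<Union>F" by blast
    have "inj_on ?k (\<Union>?F)" unfolding UF by (rule inj_on_inv_into) simp
    ultimately have "manageable ((`) ?k ` ?F)" using manageable_image[OF gF] by blast
    moreover have "?k ` h ` e = e" if "e \<in> F" for e
      using that by (intro inv_into_image_cancel[OF inj]) blast
    then have "(`) ?k ` ?F = F" by (simp add: image_image)
    ultimately show ?thesis by simp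
  qed
  then have "gallai (verts G) ?E"
    using gallai_of_manageable[OF _ g True order_refl] assms(1) eV by (auto simp: simple_graph_def)
  then show ?thesis using pn_le_of_gallai[OF assms(1)] by blast
qed

end
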